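(* Let $\Gamma$ be a countable group with the extension-MD property, and suppose the class of free p.m.p. actions of $\Gamma$ (the models of $T_{\Gamma,free}$) has the definable cocycle property. Then the model companion $T_\Gamma^*$ exists.
   Context: p.m.p. actions are measure-preserving actions on (not necessarily standard) probability spaces; an action is free if for every $\gamma\neq e$ and every $x$ in the measure algebra with $\mu(x)>0$ there is $y\subseteq x$ with $\mu(y)>0$ and $\mu(y\cap\gamma y)=0$. For $\alpha:Y\to p=\{0,\dots,p-1\}$, $\alpha_F(y)(f)=\alpha(f^{-1}y)$. A factor map $\phi:(Y,\nu)\to(X,\mu)$ is e.c. if for all $p,q$, measurable $\alpha:Y\to p$, $\beta:X\to q$, finite $S\subseteq\Gamma$, $\epsilon>0$ there is $\tilde\alpha:X\to p$ with $|\nu(\alpha_S^{-1}(\pi)\cap\phi^{-1}\beta^{-1}(j))-\mu(\tilde\alpha_S^{-1}(\pi)\cap\beta^{-1}(j))|<\epsilon$ for all $\pi,j$; an action is e.c. if every factor map onto it is e.c.; "$T_\Gamma^*$ exists" means the class of e.c. actions is closed under ultraproducts (equivalently axiomatizable in continuous logic). A cocycle of $\Gamma\curvearrowright(X,\mu)$ into a finite group $K$ is a measurable $\sigma:\Gamma\times X\to K$ with $\sigma(\gamma_1\gamma_2,x)=\sigma(\gamma_1,\gamma_2x)\sigma(\gamma_2,x)$ for all $\gamma_i$ and a.e. $x$. A class $\mathcal C$ of p.m.p. actions has the definable cocycle property if for every finite group $K$, every family $(\Gamma\curvearrowright^{a_i}(X_i,\mu_i))_{i\in I}$ in $\mathcal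 C$, every ultrafilter $\mathcal U$ on $I$ and every cocycle $\sigma:\Gamma\times\prod_{\mathcal U}X_i\to K$ of the ultraproduct action, there are cocycles $\sigma_i:\Gamma\times X_i\to K$ of $a_i$ with $\{x:\sigma(\gamma,x)=k\}=[\{x:\sigma_i(\gamma,x)=k\}]_{\mathcal U}$ (up to null sets) for all $\gamma,k$. A p.m.p. action $\Gamma\curvearrowright^a(X,\mu)$ is extension-MD if whenever $\phi:(Y,\nu)\to(X,\mu)$ is a factor map from a p.m.p. action $b$, $p,q\in\mathbb N$, $\alpha:Y\to p$, $\beta:X\to q$ measurable, $F\subseteq\Gamma$ finite, $\epsilon>0$, there are a p.m.p. action $\Gamma\curvearrowright(Y',\nu')$ with an almost-everywhere finite-to-one factor map $\phi':Y'\to X$ and measurable $\alpha':Y'\to p$ with $|\nu(\alpha_F^{-1}(\pi)\cap\phi^{-1}\beta^{-1}(j))-\nu'((\alpha')_F^{-1}(\pi)\cap(\phi')^{-1}\beta^{-1}(j))|<\epsilon$ for all $\pi\in p^F$, $j<q$. The group $\Gamma$ has the extension-MD property if every free p.m.p. action of $\Gamma$ on a standard probability space is extension-MD.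
   Formalization: In the extension-MD property the space Y' of the almost-everywhere finite-to-one extension is required to be a standard probability space; for non-standard Y' "finite-to-one" depends on the choice of points and the condition would be void. *)

theory Defs
  imports "HOL-Probability.Probability" "HOL-Algebra.Group_Action"
begin

section \<open>Measure-preserving actions and factor maps\<close>

definition measure_preserving_map :: "'x measure \<Rightarrow> 'y measure \<Rightarrow> ('x \<Rightarrow> 'y) \<Rightarrow> bool" where
  "measure_preserving_map M N f \<longleftrightarrow> f \<in> M \<rightarrow>\<^sub>M N \<and> distr M N f = N"

definition pmp_action :: "'g monoid \<Rightarrow> 'x measure \<Rightarrow> ('g \<Rightarrow> 'x \<Rightarrow> 'x) \<Rightarrow> bool" where
  "pmp_action G M a \<longleftrightarrow>
     prob_space M \<and> group_action G (space M) a \<and>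
     (\<forall>g\<in>carrier G. measure_preserving_map M M (a g))"

definition free_pmp_action :: "'g monoid \<Rightarrow> 'x measure \<Rightarrow> ('g \<Rightarrow> 'x \<Rightarrow> 'x) \<Rightarrow> bool" where
  "free_pmp_action G M a \<longleftrightarrow>
     pmp_action G M a \<and>
     (\<forall>g\<in>carrier G. g \<noteq> \<one>\<^bsub>G\<^esub> \<longrightarrow>
        (\<forall>A\<in>sets M. 0 < measure M A \<longrightarrow>
           (\<exists>B\<in>sets M. B \<subseteq> A \<and> 0 < measure M B \<and> measure M (B \<inter> a g ` B) = 0)))"

definition factor_map ::
  "'g monoid \<Rightarrow> 'y measure \<Rightarrow> ('g \<Rightarrow> 'y \<Rightarrow> 'y) \<Rightarrow> 'x measure \<Rightarrow> ('g \<Rightarrow> 'x \<Rightarrow> 'x) \<Rightarrow> ('y \<Rightarrow> 'x) \<Rightarrow> bool"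
where
  "factor_map G N b M a \<phi> \<longleftrightarrow>
     pmp_action G N b \<and> pmp_action G M a \<and> measure_preserving_map N M \<phi> \<and>
     (\<forall>g\<in>carrier G. AE y in N. \<phi> (b g y) = a g (\<phi> y))"

definition shift_name ::
  "'g monoid \<Rightarrow> ('g \<Rightarrow> 'x \<Rightarrow> 'x) \<Rightarrow> 'g set \<Rightarrow> ('x \<Rightarrow> nat) \<Rightarrow> 'x \<Rightarrow> 'g \<Rightarrow> nat" where
  "shift_name G a F \<alpha> y = (\<lambda>f\<in>F. \<alpha> (a (inv\<^bsub>G\<^esub> f) y))"

definition joint_dist ::
  "'g monoid \<Rightarrow> 'x measure \<Rightarrow> ('g \<Rightarrow> 'x \<Rightarrow> 'x) \<Rightarrow> 'g set \<Rightarrow> ('x \<Rightarrow> nat) \<Rightarrow> ('x \<Rightarrow> nat) \<Rightarrow>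
   ('g \<Rightarrow> nat) \<Rightarrow> nat \<Rightarrow> real" where
  "joint_dist G M a F \<alpha> \<beta> \<pi> j = measure M {x \<in> space M. shift_name G a F \<alpha> x = \<pi> \<and> \<beta> x = j}"

section \<open>Existentially closed actions\<close>

definition ec_factor_map ::
  "'g monoid \<Rightarrow> 'y measure \<Rightarrow> ('g \<Rightarrow> 'y \<Rightarrow> 'y) \<Rightarrow> 'x measure \<Rightarrow> ('g \<Rightarrow> 'x \<Rightarrow> 'x) \<Rightarrow> ('y \<Rightarrow> 'x) \<Rightarrow> bool"
where
  "ec_factor_map G N b M a \<phi> \<longleftrightarrow>
     (\<forall>p q. \<forall>\<alpha> \<in> N \<rightarrow>\<^sub>M count_space {..<p}. \<forall>\<beta> \<in> M \<rightarrow>\<^sub>M count_space {..<q}.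
      \<forall>S \<epsilon>. finite S \<longrightarrow> S \<subseteq> carrier G \<longrightarrow> 0 < \<epsilon> \<longrightarrow>
        (\<exists>\<alpha>' \<in> M \<rightarrow>\<^sub>M count_space {..<p}. \<forall>\<pi> \<in> S \<rightarrow>\<^sub>E {..<p}. \<forall>j<q.
           \<bar>joint_dist G N b S \<alpha> (\<beta> \<circ> \<phi>) \<pi> j - joint_dist G M a S \<alpha>' \<beta> \<pi> j\<bar> < \<epsilon>))"

text \<open>
  One cannot quantify over all types of points inside a definition. The type
  \<^typ>\<open>'x \<times> ('g \<Rightarrow> nat)\<close> is large enough: by \<open>factor_map_canonical\<close> below, given a factor
  map \<open>\<phi>\<close> from an action on any type and a partition \<open>\<alpha>\<close>, the image of the extension under
  \<open>y \<mapsto> (\<phi> y, (\<alpha> (g\<inverse>y))\<^sub>g)\<close> has the same joint distributions. Hence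
  \<open>ec_action_all_types\<close>: every factor map onto an e.c. action, from whatever type, is e.c.
\<close>

definition ec_action :: "'g monoid \<Rightarrow> 'x measure \<Rightarrow> ('g \<Rightarrow> 'x \<Rightarrow> 'x) \<Rightarrow> bool" where
  "ec_action G M a \<longleftrightarrow>
     pmp_action G M a \<and>
     (\<forall>(N :: ('x \<times> ('g \<Rightarrow> nat)) measure) b \<phi>.
        factor_map G N b M a \<phi> \<longrightarrow> ec_factor_map G N b M a \<phi>)"

lemma group_actionI:
  assumes "group G"
    and ext: "\<And>g. g \<in> carrier G \<Longrightarrow> a g \<in> extensional E"
    and cl: "\<And>g x. g \<in> carrier G \<Longrightarrow> x \<in> E \<Longrightarrow> a g x \<in> E"
    and one: "\<And>x. x \<in> E \<Longrightarrow> a \<one>\<^bsub>G\<^esub> x = x"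
    and mult: "\<And>g h x. g \<in> carrier G \<Longrightarrow> h \<in> carrier G \<Longrightarrow> x \<in> E \<Longrightarrow>
                 a (g \<otimes>\<^bsub>G\<^esub> h) x = a g (a h x)"
  shows "group_action G E a"
proof -
  interpret group G by fact
  have bij: "a g \<in> Bij E" if g: "g \<in> carrier G" for g
  proof -
    have "bij_betw (a g) E E"
      by (rule bij_betw_byWitness[where f' = "a (inv\<^bsub>G\<^esub> g)"])
         (use g cl in \<open>auto simp: mult[symmetric] one\<close>)
    then show ?thesis using ext[OF g] by (simp add: Bij_def)
  qed
  have "a \<in> hom G (BijGroup E)"
  proof (rule homI)
    show "a g \<in> carrier (BijGroup E)" if "g \<in> carrier G" for g
      using bij[OF that] by (simp add: BijGroup_def)
    fix g h assume gh: "g \<in> carrier G" "h \<in> carrier G"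
    have "a (g \<otimes>\<^bsub>G\<^esub> h) = compose E (a g) (a h)"
      by (rule extensionalityI[of _ E]) (use gh in \<open>auto simp: ext mult compose_eq\<close>)
    then show "a (g \<otimes>\<^bsub>G\<^esub> h) = a g \<otimes>\<^bsub>BijGroup E\<^esub> a h"
      using bij gh by (simp add: BijGroup_def)
  qed
  then show ?thesis
    by (simp add: group_action_def group_hom_def group_hom_axioms_def group_BijGroup is_group)
qed

lemma pmp_action_facts:
  assumes "pmp_action G M a"
  shows "group G" and "prob_space M"
    and "g \<in> carrier G \<Longrightarrow> a g \<in> M \<rightarrow>\<^sub>M M" and "g \<in> carrier G \<Longrightarrow> distr M M (a g) = M"
    and "g \<in> carrier G \<Longrightarrow> x \<in> space M \<Longrightarrow> a g x \<in> space M"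
    and "x \<in> space M \<Longrightarrow> a \<one>\<^bsub>G\<^esub> x = x"
    and "g \<in> carrier G \<Longrightarrow> h \<in> carrier G \<Longrightarrow> x \<in> space M \<Longrightarrow> a (g \<otimes>\<^bsub>G\<^esub> h) x = a g (a h x)"
proof -
  have ga: "group_action G (space M) a" using assms by (simp add: pmp_action_def)
  then interpret ga: group_action G "space M" a .
  show "group G" using ga.group_hom by (simp add: group_hom_def)
  show "prob_space M" using assms by (simp add: pmp_action_def)
  show m: "a g \<in> M \<rightarrow>\<^sub>M M" if "g \<in> carrier G" for g
    using assms that by (auto simp: pmp_action_def measure_preserving_map_def)
  show "distr M M (a g) = M" if "g \<in> carrier G"
    using assms that by (auto simp: pmp_action_def measure_preserving_map_def)
  show "a g x \<in> space M" if "g \<in> carrier G" "x \<in> space M"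
    using m that by (auto dest: measurable_space)
  show "a \<one>\<^bsub>G\<^esub> x = x" if "x \<in> space M"
    using ga.id_eq_one that by (metis restrict_apply')
  show "a (g \<otimes>\<^bsub>G\<^esub> h) x = a g (a h x)" if "g \<in> carrier G" "h \<in> carrier G" "x \<in> space M"
    using ga.composition_rule that by simp
qed

lemma sets_eq_const:
  assumes "f \<in> M \<rightarrow>\<^sub>M count_space A"
  shows "{x \<in> space M. f x = c} \<in> sets M"
proof -
  have "Measurable.pred M (\<lambda>x. f x = c)"
    by (rule pred_eq_const1[OF assms]) auto
  then show ?thesis by (simp add: pred_def)
qed

lemma sets_shift_name:
  assumes M: "pmp_action G M a" and F: "finite F" "F \<subseteq> carrier G"
    and \<alpha>: "\<alpha> \<in> M \<rightarrow>\<^sub>M count_space A" and \<beta>: "\<beta> \<in> M \<rightarrow>\<^sub>M count_space B"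
  shows "{x \<in> space M. shift_name G a F \<alpha> x = \<pi> \<and> \<beta> x = j} \<in> sets M"
proof (cases "\<pi> \<in> extensional F")
  case True
  interpret group G using M by (rule pmp_action_facts)
  have *: "{x \<in> space M. shift_name G a F \<alpha> x = \<pi> \<and> \<beta> x = j} =
     {x \<in> space M. (\<forall>f\<in>F. \<alpha> (a (inv\<^bsub>G\<^esub> f) x) = \<pi> f) \<and> \<beta> x = j}"
    using True by (auto simp: shift_name_def extensional_def fun_eq_iff restrict_def)
  have 1: "{x \<in> space M. \<alpha> (a (inv\<^bsub>G\<^esub> f) x) = \<pi> f} \<in> sets M" if "f \<in> F" for f
    using that F by (intro sets_eq_const[where A = A] measurable_compose[OF pmp_action_facts(3)[OF M] \<alpha>]) auto
  note 2 = sets_eq_const[OF \<beta>, of j]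
  show ?thesis unfolding *
    by (intro sets.sets_Collect_conj sets.sets_Collect_finite_All 1 2 F(1))
next
  case False
  then have "shift_name G a F \<alpha> x \<noteq> \<pi>" for x
    by (auto simp: shift_name_def)
  then show ?thesis by simp
qed

lemma factor_map_canonical:
  fixes G :: "'g monoid" and M :: "'x measure" and N :: "'y measure"
  assumes \<phi>: "factor_map G N b M a \<phi>" and \<alpha>: "\<alpha> \<in> N \<rightarrow>\<^sub>M count_space {..<p}"
  obtains N' :: "('x \<times> ('g \<Rightarrow> nat)) measure" and b' \<phi>' \<alpha>'
  where "factor_map G N' b' M a \<phi>'" and "\<alpha>' \<in> N' \<rightarrow>\<^sub>M count_space {..<p}"
    and "\<And>F q \<beta> \<pi> j. finite F \<Longrightarrow> F \<subseteq> carrier G \<Longrightarrow> \<beta> \<in> M \<rightarrow>\<^sub>M count_space {..<q::nat} \<Longrightarrow>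
           joint_dist G N' b' F \<alpha>' (\<beta> \<circ> \<phi>') \<pi> j = joint_dist G N b F \<alpha> (\<beta> \<circ> \<phi>) \<pi> j"
proof -
  have N: "pmp_action G N b" and M: "pmp_action G M a"
    and \<phi>m[measurable]: "\<phi> \<in> N \<rightarrow>\<^sub>M M" and \<phi>d: "distr N M \<phi> = M"
    and eqv: "\<And>g. g \<in> carrier G \<Longrightarrow> AE y in N. \<phi> (b g y) = a g (\<phi> y)"
    using \<phi> by (auto simp: factor_map_def measure_preserving_map_def)
  interpret group G using M by (rule pmp_action_facts)
  interpret N: prob_space N using N by (rule pmp_action_facts)
  note Nf = pmp_action_facts[OF N] and Mf = pmp_action_facts[OF M]
  define Q where "Q = PiM (carrier G) (\<lambda>_. count_space {..<p})"
  define P where "P = M \<Otimes>\<^sub>M Q"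
  have sP: "space P = space M \<times> (carrier G \<rightarrow>\<^sub>E {..<p})"
    by (simp add: P_def Q_def space_pair_measure space_PiM)
  define \<Phi> where "\<Phi> y = (\<phi> y, \<lambda>h\<in>carrier G. \<alpha> (b (inv\<^bsub>G\<^esub> h) y))" for y
  define b' where "b' g = (\<lambda>z\<in>space P. (a g (fst z), \<lambda>h\<in>carrier G. snd z (inv\<^bsub>G\<^esub> g \<otimes>\<^bsub>G\<^esub> h)))" for g
  define N' where "N' = distr N P \<Phi>"
  define \<alpha>' :: "'x \<times> ('g \<Rightarrow> nat) \<Rightarrow> nat" where "\<alpha>' z = snd z \<one>\<^bsub>G\<^esub>" for z
  have b\<alpha>: "(\<lambda>y. \<alpha> (b g y)) \<in> N \<rightarrow>\<^sub>M count_space {..<p}" if "g \<in> carrier G" for g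
    using measurable_compose[OF Nf(3)[OF that] \<alpha>] .
  have \<Phi>m[measurable]: "\<Phi> \<in> N \<rightarrow>\<^sub>M P"
    unfolding \<Phi>_def P_def Q_def
    by (intro measurable_Pair measurable_restrict b\<alpha> \<phi>m) auto
  have snd_m: "(\<lambda>z. snd z g) \<in> P \<rightarrow>\<^sub>M count_space {..<p}" if "g \<in> carrier G" for g
    unfolding P_def Q_def
    using measurable_compose[OF measurable_snd measurable_component_singleton[OF that]] .
  have b'm: "b' g \<in> P \<rightarrow>\<^sub>M P" if g: "g \<in> carrier G" for g
  proof -
    have "(\<lambda>z. (a g (fst z), \<lambda>h\<in>carrier G. snd z (inv\<^bsub>G\<^esub> g \<otimes>\<^bsub>G\<^esub> h))) \<in> P \<rightarrow>\<^sub>M M \<Otimes>\<^sub>M Q"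
      unfolding Q_def
      by (intro measurable_Pair measurable_restrict snd_m measurable_compose[OF _ Mf(3)[OF g]])
         (use g in \<open>auto simp: P_def\<close>)
    moreover have "b' g \<in> P \<rightarrow>\<^sub>M P \<longleftrightarrow>
        (\<lambda>z. (a g (fst z), \<lambda>h\<in>carrier G. snd z (inv\<^bsub>G\<^esub> g \<otimes>\<^bsub>G\<^esub> h))) \<in> P \<rightarrow>\<^sub>M P"
      by (rule measurable_cong) (simp add: b'_def)
    ultimately show ?thesis by (simp only: P_def)
  qed
  have b'\<Phi>: "AE y in N. b' g (\<Phi> y) = \<Phi> (b g y)" if g: "g \<in> carrier G" for g
    using eqv[OF g] AE_space
  proof eventually_elim
    case (elim y)
    have "\<Phi> y \<in> space P" using measurable_space[OF \<Phi>m] elim by auto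
    moreover have "\<alpha> (b (inv\<^bsub>G\<^esub> (inv\<^bsub>G\<^esub> g \<otimes>\<^bsub>G\<^esub> h)) y) = \<alpha> (b (inv\<^bsub>G\<^esub> h) (b g y))"
      if "h \<in> carrier G" for h
      using g that elim by (simp add: inv_mult_group Nf(7))
    ultimately show ?case
      using elim g by (auto simp: b'_def \<Phi>_def fun_eq_iff)
  qed
  have N'_eqs: "sets N' = sets P" "space N' = space P" by (simp_all add: N'_def)
  interpret N': prob_space N' unfolding N'_def by (rule N.prob_space_distr) simp
  have N'_act: "pmp_action G N' b'"
    unfolding pmp_action_def
  proof (intro conjI ballI)
    show "prob_space N'" by unfold_locales
    show "group_action G (space N') b'"
    proof (rule group_actionI)
      show "group G" by unfold_locales
      show "b' g \<in> extensional (space N')" for g by (simp add: b'_def N'_eqs)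
      show cl: "b' g z \<in> space N'" if "g \<in> carrier G" "z \<in> space N'" for g z
        using measurable_space[OF b'm[OF that(1)]] that(2) by (simp add: N'_eqs)
      show "b' \<one>\<^bsub>G\<^esub> z = z" if "z \<in> space N'" for z
        using that
        by (auto simp: b'_def N'_eqs sP Mf fun_eq_iff PiE_def extensional_def split: prod.splits)
      show "b' (g \<otimes>\<^bsub>G\<^esub> h) z = b' g (b' h z)"
        if gh: "g \<in> carrier G" "h \<in> carrier G" and z: "z \<in> space N'" for g h z
      proof -
        have "fst z \<in> space M" using z by (auto simp: N'_eqs sP)
        moreover have "b' h z \<in> space P" using cl[OF gh(2) z] by (simp add: N'_eqs)
        ultimately show ?thesis
          using gh z by (auto simp: b'_def N'_eqs Mf fun_eq_iff inv_mult_group m_assoc)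
      qed
    qed
    fix g assume g: "g \<in> carrier G"
    have "distr N' N' (b' g) = distr N P (b' g \<circ> \<Phi>)"
      unfolding N'_def by (simp add: distr_distr b'm g cong: distr_cong)
    also have "\<dots> = distr N P (\<Phi> \<circ> b g)"
      using b'\<Phi>[OF g] by (intro distr_cong_AE) (auto intro!: measurable_comp[OF _ b'm] measurable_comp[OF _ \<Phi>m] Nf g)
    also have "\<dots> = distr (distr N N (b g)) P \<Phi>"
      by (simp add: distr_distr Nf(3) g)
    finally have "distr N' N' (b' g) = N'" using Nf(4)[OF g] by (simp add: N'_def)
    moreover have "b' g \<in> N' \<rightarrow>\<^sub>M N'"
      using b'm[OF g] by (simp add: N'_def)
    ultimately show "measure_preserving_map N' N' (b' g)"
      by (simp add: measure_preserving_map_def)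
  qed
  have fst_m: "fst \<in> P \<rightarrow>\<^sub>M M" by (simp add: P_def)
  have "distr N' M fst = M"
    unfolding N'_def using \<phi>d by (simp add: distr_distr fst_m comp_def \<Phi>_def)
  then have fact': "factor_map G N' b' M a fst"
    using N'_act M fst_m
    by (auto simp: factor_map_def measure_preserving_map_def b'_def N'_eqs N'_def intro!: AE_I2)
  have \<alpha>'m: "\<alpha>' \<in> N' \<rightarrow>\<^sub>M count_space {..<p}"
    unfolding \<alpha>'_def using snd_m[OF one_closed] by (simp add: N'_def)
  show thesis
  proof (rule that[OF fact' \<alpha>'m])
    fix F q \<beta> \<pi> j
    assume F: "finite F" "F \<subseteq> carrier G" and \<beta>: "\<beta> \<in> M \<rightarrow>\<^sub>M count_space {..<q::nat}"
    let ?S = "{z \<in> space N'. shift_name G b' F \<alpha>' z = \<pi> \<and> (\<beta> \<circ> fst) z = j}"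
    have "?S \<in> sets N'"
    proof (rule sets_shift_name[OF N'_act F \<alpha>'m])
      show "\<beta> \<circ> fst \<in> N' \<rightarrow>\<^sub>M count_space {..<q}"
        using measurable_comp[OF fst_m \<beta>] by (simp add: N'_def)
    qed
    then have "measure N' ?S = measure N (\<Phi> -` ?S \<inter> space N)"
      unfolding N'_def by (subst measure_distr) auto
    moreover have "shift_name G b' F \<alpha>' (\<Phi> y) = shift_name G b F \<alpha> y" if y: "y \<in> space N" for y
    proof -
      have "\<Phi> y \<in> space P" using measurable_space[OF \<Phi>m y] .
      then show ?thesis using F
        by (auto simp: shift_name_def \<alpha>'_def b'_def \<Phi>_def fun_eq_iff subset_iff)
    qed
    then have "\<Phi> -` ?S \<inter> space N =
        {y \<in> space N. shift_name G b F \<alpha> y = \<pi> \<and> (\<beta> \<circ> \<phi>) y = j}"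
      using measurable_space[OF \<Phi>m] by (auto simp: N'_eqs) (auto simp: \<Phi>_def)
    ultimately show "joint_dist G N' b' F \<alpha>' (\<beta> \<circ> fst) \<pi> j = joint_dist G N b F \<alpha> (\<beta> \<circ> \<phi>) \<pi> j"
      by (simp add: joint_dist_def)
  qed
qed

lemma ec_action_all_types:
  fixes G :: "'g monoid" and M :: "'x measure" and N :: "'y measure"
  assumes M: "ec_action G M a" and \<phi>: "factor_map G N b M a \<phi>"
  shows "ec_factor_map G N b M a \<phi>"
  unfolding ec_factor_map_def
proof (intro allI ballI impI)
  fix p q \<alpha> \<beta> S and \<epsilon> :: real
  assume \<alpha>: "\<alpha> \<in> N \<rightarrow>\<^sub>M count_space {..<p::nat}" and \<beta>: "\<beta> \<in> M \<rightarrow>\<^sub>M count_space {..<q::nat}"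
    and S: "finite S" "S \<subseteq> carrier G" and \<epsilon>: "0 < \<epsilon>"
  obtain N' :: "('x \<times> ('g \<Rightarrow> nat)) measure" and b' \<phi>' \<alpha>'
    where 1: "factor_map G N' b' M a \<phi>'" and 2: "\<alpha>' \<in> N' \<rightarrow>\<^sub>M count_space {..<p}"
      and 3: "\<And>F q \<beta> \<pi> j. finite F \<Longrightarrow> F \<subseteq> carrier G \<Longrightarrow> \<beta> \<in> M \<rightarrow>\<^sub>M count_space {..<q::nat} \<Longrightarrow>
           joint_dist G N' b' F \<alpha>' (\<beta> \<circ> \<phi>') \<pi> j = joint_dist G N b F \<alpha> (\<beta> \<circ> \<phi>) \<pi> j"
    by (rule factor_map_canonical[OF \<phi> \<alpha>]) blast
  have "ec_factor_map G N' b' M a \<phi>'" using M 1 by (simp add: ec_action_def)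
  from this[unfolded ec_factor_map_def, rule_format, OF 2 \<beta> S \<epsilon>]
  show "\<exists>\<alpha>''\<in>M \<rightarrow>\<^sub>M count_space {..<p}. \<forall>\<pi>\<in>S \<rightarrow>\<^sub>E {..<p}. \<forall>j<q.
     \<bar>joint_dist G N b S \<alpha> (\<beta> \<circ> \<phi>) \<pi> j - joint_dist G M a S \<alpha>'' \<beta> \<pi> j\<bar> < \<epsilon>"
    by (simp add: 3[OF S \<beta>])
qed

section \<open>Ultraproducts\<close>

definition ultrafilter :: "'i filter \<Rightarrow> bool" where
  "ultrafilter U \<longleftrightarrow>
     U \<noteq> bot \<and> (\<forall>P. eventually P U \<or> eventually (\<lambda>i. \<not> P i) U)"

definition ultra_class :: "'i filter \<Rightarrow> ('i \<Rightarrow> 'x) \<Rightarrow> ('i \<Rightarrow> 'x) set" where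
  "ultra_class U x = {y. \<forall>\<^sub>F i in U. y i = x i}"

text \<open>
  The internal set \<open>[A]\<^sub>U\<close>. Classes are formed in the ultrapower of the ambient type, so the
  ultraproduct of the spaces \<open>X\<^sub>i\<close> is \<open>[X]\<^sub>U\<close>.
\<close>

definition ultra_set :: "'i filter \<Rightarrow> ('i \<Rightarrow> 'x set) \<Rightarrow> ('i \<Rightarrow> 'x) set set" where
  "ultra_set U A = {ultra_class U x |x. \<forall>\<^sub>F i in U. x i \<in> A i}"

text \<open>
  The Loeb measure: the extension of \<open>[A]\<^sub>U \<mapsto> lim\<^sub>U \<mu>\<^sub>i(A\<^sub>i)\<close> to the \<open>\<sigma>\<close>-algebra generated by
  the internal sets; see \<open>emeasure_ultraproduct\<close> for its existence.
\<close>

definition ultraproduct_measure :: "'i filter \<Rightarrow> ('i \<Rightarrow> 'x measure) \<Rightarrow> ('i \<Rightarrow> 'x) set measure" where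
  "ultraproduct_measure U M =
     extend_measure (ultra_set U (\<lambda>i. space (M i))) {A. \<forall>i. A i \<in> sets (M i)}
       (ultra_set U) (\<lambda>A. Lim U (\<lambda>i. emeasure (M i) (A i)))"

definition ultraproduct_action ::
  "'i filter \<Rightarrow> ('i \<Rightarrow> 'x measure) \<Rightarrow> ('i \<Rightarrow> 'g \<Rightarrow> 'x \<Rightarrow> 'x) \<Rightarrow> 'g \<Rightarrow> ('i \<Rightarrow> 'x) set \<Rightarrow> ('i \<Rightarrow> 'x) set"
where
  "ultraproduct_action U M a g =
     (\<lambda>c \<in> ultra_set U (\<lambda>i. space (M i)). {y. \<exists>x\<in>c. \<forall>\<^sub>F i in U. y i = a i g (x i)})"

lemma ultrafilter_not_bot: "ultrafilter U \<Longrightarrow> U \<noteq> bot"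
  by (simp add: ultrafilter_def)

lemma ultrafilter_not:
  assumes U: "ultrafilter U"
  shows "eventually (\<lambda>i. \<not> P i) U \<longleftrightarrow> \<not> eventually P U"
proof
  assume 1: "eventually (\<lambda>i. \<not> P i) U"
  show "\<not> eventually P U"
  proof
    assume "eventually P U"
    with 1 have "eventually (\<lambda>_. False) U" by eventually_elim blast
    then show False using ultrafilter_not_bot[OF U] by simp
  qed
qed (use U in \<open>auto simp: ultrafilter_def\<close>)

lemma ultra_class_eq_iff: "ultra_class U x = ultra_class U y \<longleftrightarrow> (\<forall>\<^sub>F i in U. x i = y i)"
proof
  assume "ultra_class U x = ultra_class U y"
  moreover have "x \<in> ultra_class U x" by (simp add: ultra_class_def)
  ultimately show "\<forall>\<^sub>F i in U. x i = y i" by (simp add: ultra_class_def)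
next
  assume "\<forall>\<^sub>F i in U. x i = y i"
  then show "ultra_class U x = ultra_class U y"
    unfolding ultra_class_def
    by (intro Collect_cong) (auto elim: eventually_elim2)
qed

lemma ultra_class_in_iff: "ultra_class U x \<in> ultra_set U A \<longleftrightarrow> (\<forall>\<^sub>F i in U. x i \<in> A i)"
proof
  assume "ultra_class U x \<in> ultra_set U A"
  then obtain y where "\<forall>\<^sub>F i in U. x i = y i" "\<forall>\<^sub>F i in U. y i \<in> A i"
    by (auto simp: ultra_set_def ultra_class_eq_iff)
  then show "\<forall>\<^sub>F i in U. x i \<in> A i" by eventually_elim simp
qed (auto simp: ultra_set_def)

lemma ultra_setE:
  assumes "c \<in> ultra_set U A"
  obtains x where "c = ultra_class U x" "\<forall>\<^sub>F i in U. x i \<in> A i"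
  using assms by (auto simp: ultra_set_def)

lemma ultra_set_eqI:
  assumes "S \<subseteq> range (ultra_class U)" "\<And>x. ultra_class U x \<in> ultra_set U A \<longleftrightarrow> ultra_class U x \<in> S"
  shows "ultra_set U A = S"
proof (rule Set.set_eqI)
  fix c show "c \<in> ultra_set U A \<longleftrightarrow> c \<in> S"
  proof (cases "c \<in> range (ultra_class U)")
    case True then show ?thesis using assms(2) by blast
  next
    case False then show ?thesis using assms(1) by (auto simp: ultra_set_def)
  qed
qed

lemma ultra_set_range: "ultra_set U A \<subseteq> range (ultra_class U)"
  by (auto simp: ultra_set_def)

lemma ultra_set_mono:
  assumes "\<And>i. A i \<subseteq> B i"
  shows "ultra_set U A \<subseteq> ultra_set U B"
proof
  fix c assume "c \<in> ultra_set U A"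
  then obtain x where x: "c = ultra_class U x" "\<forall>\<^sub>F i in U. x i \<in> A i" by (rule ultra_setE)
  from x(2) have "\<forall>\<^sub>F i in U. x i \<in> B i" by (rule eventually_mono) (use assms in blast)
  then show "c \<in> ultra_set U B" using x(1) by (simp add: ultra_class_in_iff)
qed

lemma ultra_set_Int: "ultra_set U (\<lambda>i. A i \<inter> B i) = ultra_set U A \<inter> ultra_set U B"
  by (rule ultra_set_eqI; (rule le_infI1[OF ultra_set_range])?)
     (simp add: ultra_class_in_iff eventually_conj_iff)

lemma ultra_set_Diff:
  "ultrafilter U \<Longrightarrow> ultra_set U (\<lambda>i. A i - B i) = ultra_set U A - ultra_set U B"
  by (rule ultra_set_eqI; (rule subset_trans[OF Diff_subset ultra_set_range])?)
     (simp add: ultra_class_in_iff eventually_conj_iff ultrafilter_not)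

lemma ultra_set_Un:
  assumes "ultrafilter U"
  shows "ultra_set U (\<lambda>i. A i \<union> B i) = ultra_set U A \<union> ultra_set U B"
proof -
  have "(\<forall>\<^sub>F i in U. P i \<or> Q i) \<longleftrightarrow> (\<forall>\<^sub>F i in U. P i) \<or> (\<forall>\<^sub>F i in U. Q i)" for P Q
    using ultrafilter_not[OF assms, of "\<lambda>i. P i \<or> Q i"] ultrafilter_not[OF assms, of P]
      ultrafilter_not[OF assms, of Q] by (auto simp: eventually_conj_iff)
  then show ?thesis
    by (intro ultra_set_eqI) (simp_all add: ultra_set_range ultra_class_in_iff)
qed

lemma ultra_set_empty: "ultrafilter U \<Longrightarrow> ultra_set U (\<lambda>i. {}) = {}"
  by (auto simp: ultra_set_def ultrafilter_not_bot)

lemma ultra_set_empty_imp: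
  assumes "ultrafilter U" "ultra_set U A = {}"
  shows "\<forall>\<^sub>F i in U. A i = {}"
proof (rule ccontr)
  assume "\<not> ?thesis"
  then have "\<forall>\<^sub>F i in U. A i \<noteq> {}" using ultrafilter_not[OF assms(1)] by metis
  then have "\<forall>\<^sub>F i in U. (SOME x. x \<in> A i) \<in> A i"
    by eventually_elim (simp add: some_in_eq)
  then have "ultra_class U (\<lambda>i. SOME x. x \<in> A i) \<in> ultra_set U A"
    by (simp add: ultra_class_in_iff)
  then show False using assms by simp
qed

lemma ultrafilter_tendsto_Lim:
  fixes f :: "'i \<Rightarrow> 'b::{t2_space}"
  assumes U: "ultrafilter U" and "compact (UNIV :: 'b set)"
  shows "(f \<longlongrightarrow> Lim U f) U"
proof -
  have nb: "U \<noteq> bot" using U by (rule ultrafilter_not_bot)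
  have "\<exists>l. (f \<longlongrightarrow> l) U"
  proof -
    obtain l where l: "inf (nhds l) (filtermap f U) \<noteq> bot"
      using assms(2)[unfolded compact_filter, rule_format, of "filtermap f U"] nb
      by (auto simp: filtermap_bot_iff)
    have "(f \<longlongrightarrow> l) U"
    proof (rule topological_tendstoI, rule ccontr)
      fix S assume S: "open S" "l \<in> S" "\<not> (\<forall>\<^sub>F i in U. f i \<in> S)"
      then have 1: "\<forall>\<^sub>F i in U. f i \<notin> S" using ultrafilter_not[OF U] by metis
      have "\<forall>\<^sub>F x in nhds l. x \<in> S" using S eventually_nhds by blast
      moreover have "\<forall>\<^sub>F x in filtermap f U. x \<notin> S" using 1 by (simp add: eventually_filtermap)
      ultimately have "eventually (\<lambda>_. False) (inf (nhds l) (filtermap f U))"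
        unfolding eventually_inf by blast
      then show False using l by (simp add: trivial_limit_def)
    qed
    then show ?thesis ..
  qed
  then obtain l where "(f \<longlongrightarrow> l) U" ..
  then show ?thesis by (simp add: tendsto_Lim[OF nb])
qed

lemma ultrafilter_tendsto_ennreal:
  "ultrafilter U \<Longrightarrow> (f \<longlongrightarrow> Lim U f) U" for f :: "'i \<Rightarrow> ennreal"
  by (rule ultrafilter_tendsto_Lim[OF _ compact_UNIV])

context
  fixes U :: "'i filter" and M :: "'i \<Rightarrow> 'x measure"
  assumes U: "ultrafilter U" and M: "\<And>i. prob_space (M i)"
begin

private definition "lm A = Lim U (\<lambda>i. emeasure (M i) (A i))"

private lemma lm: "((\<lambda>i. emeasure (M i) (A i)) \<longlongrightarrow> lm A) U"
  unfolding lm_def by (rule ultrafilter_tendsto_ennreal[OF U])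

private lemma lmI: "((\<lambda>i. emeasure (M i) (A i)) \<longlongrightarrow> l) U \<Longrightarrow> lm A = l"
  using tendsto_unique[OF ultrafilter_not_bot[OF U] lm] .

private lemma lm_cong: "\<forall>\<^sub>F i in U. A i = B i \<Longrightarrow> lm A = lm B"
  by (rule lmI, rule Lim_transform_eventually[OF lm[of B]], erule eventually_mono) simp

private lemma lm_inj: assumes "ultra_set U A = ultra_set U B" shows "lm A = lm B"
proof (rule lm_cong)
  have "\<forall>\<^sub>F i in U. A i - B i = {}" "\<forall>\<^sub>F i in U. B i - A i = {}"
    by (intro ultra_set_empty_imp[OF U]; simp add: ultra_set_Diff[OF U] assms)+
  then show "\<forall>\<^sub>F i in U. A i = B i" by eventually_elim blast
qed

private abbreviation "Int_sets \<equiv> ultra_set U ` {A. \<forall>i. A i \<in> sets (M i)}"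

private lemma algebra_Int_sets: "algebra (ultra_set U (\<lambda>i. space (M i))) Int_sets"
  unfolding algebra_iff_Un
proof (intro conjI ballI)
  show "Int_sets \<subseteq> Pow (ultra_set U (\<lambda>i. space (M i)))"
    by (intro image_subsetI PowI ultra_set_mono sets.sets_into_space) simp
  show "{} \<in> Int_sets"
    by (rule image_eqI[of _ _ "\<lambda>_. {}"]) (simp_all add: ultra_set_empty[OF U])
  fix a assume "a \<in> Int_sets"
  then obtain A where A: "a = ultra_set U A" "\<forall>i. A i \<in> sets (M i)" by auto
  show "ultra_set U (\<lambda>i. space (M i)) - a \<in> Int_sets"
    by (rule image_eqI[of _ _ "\<lambda>i. space (M i) - A i"]) (use A in \<open>auto simp: ultra_set_Diff[OF U]\<close>)
  fix b assume "b \<in> Int_sets"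
  then obtain B where B: "b = ultra_set U B" "\<forall>i. B i \<in> sets (M i)" by auto
  show "a \<union> b \<in> Int_sets"
    by (rule image_eqI[of _ _ "\<lambda>i. A i \<union> B i"]) (use A B in \<open>auto simp: ultra_set_Un[OF U]\<close>)
qed

text \<open>Saturation: a decreasing sequence of internal sets of measure bounded below meets.\<close>

private lemma lm_decseq:
  assumes B: "\<And>n i. B n i \<in> sets (M i)" and dec: "\<And>m n i. m \<le> n \<Longrightarrow> B n i \<subseteq> B m i"
    and empty: "(\<Inter>n. ultra_set U (B n)) = {}"
  shows "(\<lambda>n. lm (B n)) \<longlonglongrightarrow> 0"
proof (rule ccontr)
  assume no: "\<not> ?thesis"
  have mono: "lm (B n) \<le> lm (B m)" if "m \<le> n" for m n
    by (rule tendsto_le[OF ultrafilter_not_bot[OF U] lm lm])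
       (auto intro!: always_eventually emeasure_mono dec that B)
  have "\<exists>e>0. \<forall>n. e < lm (B n)"
  proof (rule ccontr)
    assume "\<not> (\<exists>e>0. \<forall>n. e < lm (B n))"
    then have *: "\<exists>n. lm (B n) \<le> e" if "e > 0" for e using that by (meson not_less)
    have "(\<lambda>n. lm (B n)) \<longlonglongrightarrow> 0"
    proof (rule order_tendstoI)
      fix e :: ennreal assume "0 < e"
      then obtain e' where e': "0 < e'" "e' < e" using dense by blast
      from *[OF e'(1)] obtain n where "lm (B n) \<le> e'" by auto
      then have "lm (B k) < e" if "n \<le> k" for k using mono[OF that] e' by order
      then show "\<forall>\<^sub>F k in sequentially. lm (B k) < e" by (auto simp: eventually_sequentially)
    qed simp
    with no show False ..
  qed
  then obtain e where e: "e > 0" "\<And>n. e < lm (B n)" by auto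
  define E where "E n = {i. e < emeasure (M i) (B n i)}" for n
  have EU: "\<forall>\<^sub>F i in U. i \<in> E n" for n
    using order_tendstoD(1)[OF lm e(2)[of n]] by (simp add: E_def)
  have "\<exists>x. \<forall>n. i \<in> E n \<longrightarrow> x \<in> B n i" for i
  proof (cases "\<forall>n. i \<in> E n")
    case True
    interpret prob_space "M i" by (rule M)
    have "(\<lambda>n. emeasure (M i) (B n i)) \<longlonglongrightarrow> emeasure (M i) (\<Inter>n. B n i)"
      by (intro Lim_emeasure_decseq) (auto simp: decseq_def B dest: dec)
    then have "e \<le> emeasure (M i) (\<Inter>n. B n i)"
      by (rule LIMSEQ_le_const) (use True in \<open>auto simp: E_def intro: less_imp_le\<close>)
    with e(1) have "(\<Inter>n. B n i) \<noteq> {}" by auto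
    then show ?thesis by auto
  next
    case False
    then obtain k where k: "i \<notin> E k" by auto
    have Edec: "i \<in> E n \<Longrightarrow> m \<le> n \<Longrightarrow> i \<in> E m" for m n
      unfolding E_def using emeasure_mono[OF dec[of m n i] B]
      by (auto intro: less_le_trans)
    have le: "n \<le> k" if "i \<in> E n" for n using Edec[OF that] k by (meson linear)
    show ?thesis
    proof (cases "\<exists>n. i \<in> E n")
      case True
      define m where "m = (GREATEST n. i \<in> E n)"
      have m: "i \<in> E m" "\<And>n. i \<in> E n \<Longrightarrow> n \<le> m"
        unfolding m_def using True le by (metis GreatestI_ex_nat) (use le in \<open>metis Greatest_le_nat\<close>)
      then have "B m i \<noteq> {}" using e(1) by (auto simp: E_def)
      then show ?thesis using m(2) dec by blast
    qed auto
  qed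
  then obtain x where x: "\<And>i n. i \<in> E n \<Longrightarrow> x i \<in> B n i" by metis
  have "ultra_class U x \<in> ultra_set U (B n)" for n
    unfolding ultra_class_in_iff using EU[of n] by (rule eventually_mono) (rule x)
  with empty show False by auto
qed

private lemma extension_exists:
  "\<exists>\<mu>. (\<forall>A\<in>{A. \<forall>i. A i \<in> sets (M i)}. \<mu> (ultra_set U A) = lm A) \<and>
     measure_space (ultra_set U (\<lambda>i. space (M i)))
       (sigma_sets (ultra_set U (\<lambda>i. space (M i))) Int_sets) \<mu>"
proof -
  interpret algebra "ultra_set U (\<lambda>i. space (M i))" Int_sets by (rule algebra_Int_sets)
  define f where "f a = lm (SOME A. (\<forall>i. A i \<in> sets (M i)) \<and> a = ultra_set U A)" for a
  have f: "f (ultra_set U A) = lm A" if "\<forall>i. A i \<in> sets (M i)" for A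
    unfolding f_def
    by (rule someI2[of _ A]) (use that in \<open>auto intro: lm_inj\<close>)
  have lm_empty: "lm (\<lambda>_. {}) = 0" by (rule lmI) simp
  have "\<exists>\<mu>. (\<forall>s\<in>Int_sets. \<mu> s = f s) \<and>
     measure_space (ultra_set U (\<lambda>i. space (M i)))
       (sigma_sets (ultra_set U (\<lambda>i. space (M i))) Int_sets) \<mu>"
  proof (rule caratheodory_empty_continuous)
    show "positive Int_sets f"
      unfolding positive_def using f[of "\<lambda>_. {}"] by (simp add: ultra_set_empty[OF U] lm_empty)
    show "additive Int_sets f"
      unfolding additive_def
    proof (intro ballI impI)
      fix a b assume "a \<in> Int_sets" "b \<in> Int_sets" and ab: "a \<inter> b = {}"
      then obtain A B where A: "a = ultra_set U A" "\<forall>i. A i \<in> sets (M i)"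
        and B: "b = ultra_set U B" "\<forall>i. B i \<in> sets (M i)" by auto
      have "\<forall>\<^sub>F i in U. A i \<inter> B i = {}"
        using ab A B by (intro ultra_set_empty_imp[OF U]) (simp add: ultra_set_Int)
      then have "\<forall>\<^sub>F i in U. emeasure (M i) (A i) + emeasure (M i) (B i) = emeasure (M i) (A i \<union> B i)"
        by eventually_elim (use A B in \<open>simp add: plus_emeasure\<close>)
      then have "lm (\<lambda>i. A i \<union> B i) = lm A + lm B"
        by (intro lmI) (rule Lim_transform_eventually[OF tendsto_add[OF lm lm]])
      then show "f (a \<union> b) = f a + f b"
        using A B by (simp add: f ultra_set_Un[OF U, symmetric])
    qed
    show "f a \<noteq> \<infinity>" if "a \<in> Int_sets" for a
    proof -
      from that obtain A where A: "a = ultra_set U A" "\<forall>i. A i \<in> sets (M i)" by auto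
      have "lm A \<le> 1"
        by (rule tendsto_upperbound[OF lm _ ultrafilter_not_bot[OF U]])
           (auto intro!: always_eventually prob_space.emeasure_le_1[OF M])
      then show ?thesis using A by (auto simp: f top_unique)
    qed
    fix a :: "nat \<Rightarrow> ('i \<Rightarrow> 'x) set set"
    assume a: "range a \<subseteq> Int_sets" "decseq a" "(\<Inter>n. a n) = {}"
    then have "\<forall>n. \<exists>A. a n = ultra_set U A \<and> (\<forall>i. A i \<in> sets (M i))" by blast
    then obtain A where A: "\<And>n. a n = ultra_set U (A n)" "\<And>n i. A n i \<in> sets (M i)" by metis
    define B where "B n i = (\<Inter>m\<le>n. A m i)" for n i
    have B: "B n i \<in> sets (M i)" for n i unfolding B_def using A(2) by auto
    have aB: "a n = ultra_set U (B n)" for n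
    proof (induction n)
      case (Suc n)
      have "B (Suc n) = (\<lambda>i. A (Suc n) i \<inter> B n i)" by (auto simp: B_def atMost_Suc)
      then have "ultra_set U (B (Suc n)) = a (Suc n) \<inter> a n" using Suc A by (simp add: ultra_set_Int)
      also have "\<dots> = a (Suc n)" using a(2) by (auto simp: decseq_Suc_iff)
      finally show ?case ..
    qed (simp add: A B_def[abs_def])
    have "(\<lambda>n. lm (B n)) \<longlonglongrightarrow> 0"
      using a(3) by (intro lm_decseq B) (auto simp: B_def aB)
    then show "(\<lambda>n. f (a n)) \<longlonglongrightarrow> 0" using B by (simp add: aB f)
  qed
  then show ?thesis using f by auto
qed

lemma space_ultraproduct: "space (ultraproduct_measure U M) = ultra_set U (\<lambda>i. space (M i))"
  and sets_ultraproduct: "sets (ultraproduct_measure U M) =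
    sigma_sets (ultra_set U (\<lambda>i. space (M i))) (ultra_set U ` {A. \<forall>i. A i \<in> sets (M i)})"
proof -
  interpret algebra "ultra_set U (\<lambda>i. space (M i))" Int_sets by (rule algebra_Int_sets)
  show "space (ultraproduct_measure U M) = ultra_set U (\<lambda>i. space (M i))"
    unfolding ultraproduct_measure_def by (rule space_extend_measure) (rule space_closed)
  show "sets (ultraproduct_measure U M) =
    sigma_sets (ultra_set U (\<lambda>i. space (M i))) (ultra_set U ` {A. \<forall>i. A i \<in> sets (M i)})"
    unfolding ultraproduct_measure_def by (rule sets_extend_measure) (rule space_closed)
qed

lemma emeasure_ultraproduct:
  assumes "\<And>i. A i \<in> sets (M i)"
  shows "emeasure (ultraproduct_measure U M) (ultra_set U A) = Lim U (\<lambda>i. emeasure (M i) (A i))"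
proof -
  interpret algebra "ultra_set U (\<lambda>i. space (M i))" Int_sets by (rule algebra_Int_sets)
  obtain \<mu> where \<mu>: "\<And>A. (\<forall>i. A i \<in> sets (M i)) \<Longrightarrow> \<mu> (ultra_set U A) = lm A"
     "measure_space (ultra_set U (\<lambda>i. space (M i)))
       (sigma_sets (ultra_set U (\<lambda>i. space (M i))) Int_sets) \<mu>"
    using extension_exists by auto
  show ?thesis
    by (rule emeasure_extend_measure[OF ultraproduct_measure_def, where \<mu>' = \<mu>])
       (use \<mu> assms space_closed in \<open>auto simp: lm_def[symmetric] measure_space_def
          sets_ultraproduct[unfolded ultraproduct_measure_def] sets_ultraproduct\<close>)
qed

lemma tendsto_emeasure_ultraproduct:
  assumes "\<And>i. A i \<in> sets (M i)"
  shows "((\<lambda>i. emeasure (M i) (A i)) \<longlongrightarrow> emeasure (ultraproduct_measure U M) (ultra_set U A)) U"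
  using lm[of A] by (simp add: emeasure_ultraproduct[OF assms] lm_def)

lemma prob_space_ultraproduct: "prob_space (ultraproduct_measure U M)"
proof
  have "lm (\<lambda>i. space (M i)) = 1"
    by (rule lmI) (simp add: prob_space.emeasure_space_1[OF M])
  then show "emeasure (ultraproduct_measure U M) (space (ultraproduct_measure U M)) = 1"
    by (simp add: emeasure_ultraproduct space_ultraproduct lm_def)
qed

lemma measurable_ultraproductI:
  assumes "f \<in> space (ultraproduct_measure U M) \<rightarrow> space (ultraproduct_measure U M)"
    and "\<And>A. (\<And>i. A i \<in> sets (M i)) \<Longrightarrow>
      f -` ultra_set U A \<inter> space (ultraproduct_measure U M) \<in> sets (ultraproduct_measure U M)"
  shows "f \<in> ultraproduct_measure U M \<rightarrow>\<^sub>M ultraproduct_measure U M"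
proof -
  interpret algebra "ultra_set U (\<lambda>i. space (M i))" Int_sets by (rule algebra_Int_sets)
  show ?thesis
    by (rule measurable_sigma_sets[OF sets_ultraproduct space_closed])
       (use assms space_ultraproduct in auto)
qed

lemma ultraproduct_measure_eqI:
  assumes "sets N = sets (ultraproduct_measure U M)"
    and "\<And>A. (\<And>i. A i \<in> sets (M i)) \<Longrightarrow>
      emeasure N (ultra_set U A) = emeasure (ultraproduct_measure U M) (ultra_set U A)"
  shows "N = ultraproduct_measure U M"
proof -
  interpret algebra "ultra_set U (\<lambda>i. space (M i))" Int_sets by (rule algebra_Int_sets)
  interpret P: prob_space "ultraproduct_measure U M" by (rule prob_space_ultraproduct)
  show ?thesis
  proof (rule measure_eqI_generator_eq[of Int_sets "ultra_set U (\<lambda>i. space (M i))" _ _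
        "\<lambda>_. ultra_set U (\<lambda>i. space (M i))"])
    show "Int_stable Int_sets" by (auto simp: Int_stable_def)
    show "emeasure N (ultra_set U (\<lambda>i. space (M i))) \<noteq> \<infinity>" for n :: nat
      using assms(2)[of "\<lambda>i. space (M i)"] by simp
  qed (use assms space_closed sets_ultraproduct in \<open>auto\<close>)
qed

end

lemma pmp_action_ultraproduct:
  assumes U: "ultrafilter U" and a: "\<And>i. pmp_action G (M i) (a i)"
  shows "pmp_action G (ultraproduct_measure U M) (ultraproduct_action U M a)"
proof -
  note af = pmp_action_facts[OF a]
  interpret group G by (rule af)
  let ?N = "ultraproduct_measure U M" and ?b = "ultraproduct_action U M a"
  note P = af(2)
  note sp = space_ultraproduct[OF U P]
  have b: "?b g (ultra_class U x) = ultra_class U (\<lambda>i. a i g (x i))"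
    if x: "\<forall>\<^sub>F i in U. x i \<in> space (M i)" for g x
  proof -
    have "(\<exists>x'\<in>ultra_class U x. \<forall>\<^sub>F i in U. y i = a i g (x' i)) \<longleftrightarrow> (\<forall>\<^sub>F i in U. y i = a i g (x i))" for y
      unfolding ultra_class_def by (auto elim: eventually_elim2 intro: exI[of _ x])
    then show ?thesis
      using x by (simp add: ultraproduct_action_def ultra_class_in_iff) (simp add: ultra_class_def)
  qed
  have aev: "\<forall>\<^sub>F i in U. a i g (x i) \<in> space (M i)"
    if "\<forall>\<^sub>F i in U. x i \<in> space (M i)" "g \<in> carrier G" for x g
    using that(1) by eventually_elim (use that(2) af(5) in auto)
  have cl: "?b g c \<in> space ?N" if "c \<in> space ?N" "g \<in> carrier G" for c g
    using that by (auto simp: sp ultra_class_in_iff b aev elim!: ultra_setE)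
  have "group_action G (space ?N) ?b"
  proof (rule group_actionI)
    show "group G" by unfold_locales
    show "?b g \<in> extensional (space ?N)" for g by (simp add: ultraproduct_action_def sp)
    fix c assume "c \<in> space ?N"
    then obtain x where x: "c = ultra_class U x" "\<forall>\<^sub>F i in U. x i \<in> space (M i)"
      by (auto simp: sp elim: ultra_setE)
    show "?b \<one>\<^bsub>G\<^esub> c = c"
      unfolding x(1) b[OF x(2)] ultra_class_eq_iff
      using x(2) by eventually_elim (rule af(6))
    fix g h assume gh: "g \<in> carrier G" "h \<in> carrier G"
    show "?b (g \<otimes>\<^bsub>G\<^esub> h) c = ?b g (?b h c)"
      unfolding x(1) b[OF x(2)] b[OF aev[OF x(2) gh(2)]] ultra_class_eq_iff
      using x(2) by eventually_elim (rule af(7)[OF gh])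
  qed (rule cl)
  moreover have "measure_preserving_map ?N ?N (?b g)" if g: "g \<in> carrier G" for g
  proof -
    have vim: "?b g -` ultra_set U A \<inter> space ?N = ultra_set U (\<lambda>i. a i g -` A i \<inter> space (M i))" for A
    proof (rule ultra_set_eqI[symmetric])
      show "?b g -` ultra_set U A \<inter> space ?N \<subseteq> range (ultra_class U)"
        unfolding sp by (rule le_infI2[OF ultra_set_range])
      fix x
      show "ultra_class U x \<in> ultra_set U (\<lambda>i. a i g -` A i \<inter> space (M i)) \<longleftrightarrow>
          ultra_class U x \<in> ?b g -` ultra_set U A \<inter> space ?N"
        by (cases "\<forall>\<^sub>F i in U. x i \<in> space (M i)")
           (simp_all add: sp b ultra_class_in_iff eventually_conj_iff)
    qed
    have in_sets: "ultra_set U A \<in> sets ?N" if "\<And>i. A i \<in> sets (M i)" for A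
      using that by (auto simp: sets_ultraproduct[OF U P])
    have m: "a i g -` A i \<inter> space (M i) \<in> sets (M i)" if "\<And>i. A i \<in> sets (M i)" for A i
      using measurable_sets[OF af(3)[OF g] that] .
    have bm: "?b g \<in> ?N \<rightarrow>\<^sub>M ?N"
      by (rule measurable_ultraproductI[OF U P]) (use cl g m in \<open>auto simp: vim intro!: in_sets\<close>)
    have "emeasure (M i) (a i g -` A i \<inter> space (M i)) = emeasure (M i) (A i)"
      if "\<And>i. A i \<in> sets (M i)" for A i
      using emeasure_distr[OF af(3)[OF g] that, of i] af(4)[OF g, of i] by simp
    then have "distr ?N ?N (?b g) = ?N"
      by (intro ultraproduct_measure_eqI[OF U P])
         (simp_all add: emeasure_distr bm in_sets vim emeasure_ultraproduct[OF U P] m)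
    with bm show ?thesis by (simp add: measure_preserving_map_def)
  qed
  ultimately show ?thesis
    using prob_space_ultraproduct[OF U P] by (simp add: pmp_action_def)
qed

text \<open>
  The index set is the whole type \<^typ>\<open>'i\<close>, and the points of the actions have type \<^typ>\<open>'x\<close>;
  both types are arbitrary.
\<close>

definition model_companion_exists :: "'i itself \<Rightarrow> 'x itself \<Rightarrow> 'g monoid \<Rightarrow> bool" where
  "model_companion_exists (_ :: 'i itself) (_ :: 'x itself) G \<longleftrightarrow>
     (\<forall>(U :: 'i filter) (M :: 'i \<Rightarrow> 'x measure) a.
        ultrafilter U \<longrightarrow> (\<forall>i. ec_action G (M i) (a i)) \<longrightarrow>
        ec_action G (ultraproduct_measure U M) (ultraproduct_action U M a))"

section \<open>The definable cocycle property\<close>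

definition cocycle ::
  "'g monoid \<Rightarrow> 'x measure \<Rightarrow> ('g \<Rightarrow> 'x \<Rightarrow> 'x) \<Rightarrow> 'k monoid \<Rightarrow> ('g \<Rightarrow> 'x \<Rightarrow> 'k) \<Rightarrow> bool" where
  "cocycle G M a K \<sigma> \<longleftrightarrow>
     (\<forall>g\<in>carrier G. \<sigma> g \<in> M \<rightarrow>\<^sub>M count_space (carrier K)) \<and>
     (\<forall>g\<in>carrier G. \<forall>h\<in>carrier G.
        AE x in M. \<sigma> (g \<otimes>\<^bsub>G\<^esub> h) x = \<sigma> g (a h x) \<otimes>\<^bsub>K\<^esub> \<sigma> h x)"

text \<open>
  Every finite group is isomorphic to one whose carrier is a set of natural numbers, so it
  suffices to let \<open>K\<close> range over the latter.
\<close>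

definition definable_cocycle_property ::
  "'i itself \<Rightarrow> 'g monoid \<Rightarrow> ('x measure \<Rightarrow> ('g \<Rightarrow> 'x \<Rightarrow> 'x) \<Rightarrow> bool) \<Rightarrow> bool" where
  "definable_cocycle_property (_ :: 'i itself) G \<C> \<longleftrightarrow>
     (\<forall>(K :: nat monoid) (U :: 'i filter) M a \<sigma>.
        group K \<longrightarrow> finite (carrier K) \<longrightarrow> ultrafilter U \<longrightarrow> (\<forall>i. \<C> (M i) (a i)) \<longrightarrow>
        cocycle G (ultraproduct_measure U M) (ultraproduct_action U M a) K \<sigma> \<longrightarrow>
        (\<exists>\<tau>. (\<forall>i. cocycle G (M i) (a i) K (\<tau> i)) \<and>
             (\<forall>g\<in>carrier G. \<forall>k\<in>carrier K.
                AE x in ultraproduct_measure U M.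
                  \<sigma> g x = k \<longleftrightarrow> x \<in> ultra_set U (\<lambda>i. {y \<in> space (M i). \<tau> i g y = k}))))"

section \<open>The extension-MD property\<close>

definition standard_borel :: "'x measure \<Rightarrow> bool" where
  "standard_borel M \<longleftrightarrow>
     (\<exists>T. completely_metrizable_space T \<and> second_countable T \<and>
          space M = topspace T \<and> sets M = sigma_sets (topspace T) {W. openin T W})"

text \<open>
  ``Almost everywhere finite-to-one'' is a statement about points, meaningful for standard
  spaces only: on a non-measurable subset of full outer measure, with the trace measure, a
  factor map can be injective although its measure algebra is far from that of a finite
  extension. Hence \<open>N'\<close> below is required to be standard, and the notion is the intended one
  for standard \<open>M\<close>. The extension \<open>N\<close> is arbitrary; the type of its points
  is again no restriction, by \<open>factor_map_canonical\<close>.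
\<close>

definition extension_MD_action :: "'g monoid \<Rightarrow> 'x measure \<Rightarrow> ('g \<Rightarrow> 'x \<Rightarrow> 'x) \<Rightarrow> bool" where
  "extension_MD_action G M a \<longleftrightarrow>
     pmp_action G M a \<and>
     (\<forall>(N :: ('x \<times> ('g \<Rightarrow> nat)) measure) b \<phi> p q. factor_map G N b M a \<phi> \<longrightarrow>
        (\<forall>\<alpha> \<in> N \<rightarrow>\<^sub>M count_space {..<p}. \<forall>\<beta> \<in> M \<rightarrow>\<^sub>M count_space {..<q}.
         \<forall>F \<epsilon>. finite F \<longrightarrow> F \<subseteq> carrier G \<longrightarrow> 0 < \<epsilon> \<longrightarrow>
           (\<exists>(N' :: ('x \<times> ('g \<Rightarrow> nat)) measure) b' \<phi>'.
              standard_borel N' \<and> factor_map G N' b' M a \<phi>' \<and>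
              (AE x in M. finite {y \<in> space N'. \<phi>' y = x}) \<and>
              (\<exists>\<alpha>' \<in> N' \<rightarrow>\<^sub>M count_space {..<p}. \<forall>\<pi> \<in> F \<rightarrow>\<^sub>E {..<p}. \<forall>j<q.
                 \<bar>joint_dist G N b F \<alpha> (\<beta> \<circ> \<phi>) \<pi> j
                   - joint_dist G N' b' F \<alpha>' (\<beta> \<circ> \<phi>') \<pi> j\<bar> < \<epsilon>))))"

text \<open>
  Every standard Borel space has at most continuum many points, so up to isomorphism its
  points are real numbers.
\<close>

definition extension_MD_group :: "'g monoid \<Rightarrow> bool" where
  "extension_MD_group G \<longleftrightarrow>
     (\<forall>(M :: real measure) a. standard_borel M \<longrightarrow> free_pmp_action G M a \<longrightarrow>
        extension_MD_action G M a)"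

end

(*
  Let X be an ultraproduct of e.c. actions X_i, Y -> X a factor map, alpha a partition of Y and beta
  one of X. Each X_i is free, since by existential closedness it approximates its product with a
  Bernoulli shift; the approximating partitions pass to X and, together with beta, generate a free
  standard factor Z of X. The extension-MD property of Z replaces Y by a finite-to-one extension of
  Z. Over almost every point such an extension carries a measure with finitely many atoms; repeating
  each atom in proportion to its weight makes it nearly a uniform D-to-one extension, on which
  the group acts through a cocycle into Sym(D). Pulled back to X, this cocycle is an ultraproduct of
  cocycles of the X_i, and existential closedness of X_i along the skew products they define gives
  partitions of the X_i, whose ultraproduct is the required partition of X.
*)
theory Submission
  imports Defs
begin

text \<open>Three obstacles shape the argument. The ultraproduct is not standard, while the
  extension-MD property speaks of standard spaces; passing to a factor Z costs nothing, because
  existential closedness asks only for joint statistics with \<beta>, and \<beta> is measurable over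
  Z. Freeness of Z cannot be read off from freeness of the single actions, whose witnessing sets
  have no lower bound on their measure that is uniform in the index; a Bernoulli colouring with p
  colours gives collisions of measure about 1/p, a bound that survives the ultraproduct. Finally,
  the definable cocycle property concerns one fixed finite group, whereas the fibres of a
  finite-to-one extension vary in size and in the weights of their atoms, with no bound on either
  the sizes or the denominators. Rounding the weights down to multiples of 1/D makes the number of
  sheets constant; the sheets left over are kept fixed, and their share tends to 0 as D grows. Since
  statistics matter only up to \<epsilon>, this loss is harmless.\<close>

section \<open>Standard Borel spaces\<close>

text \<open>The map sends a point to its distances from a dense sequence. It moves standard spaces,
  which may live on any type, into the Polish type \<open>nat \<Rightarrow> real\<close>, where
  inner regularity and a countable basis are at hand. Completeness is what makes the image
  Borel.\<close>

lemma standard_borel_embedding: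
  fixes M :: "'x measure"
  assumes "standard_borel M" and ne: "space M \<noteq> {}"
  obtains h :: "'x \<Rightarrow> nat \<Rightarrow> real"
  where "h \<in> borel_measurable M" "inj_on h (space M)" "h ` space M \<in> sets borel"
    "\<And>A. A \<in> sets M \<Longrightarrow> \<exists>B\<in>sets borel. A = h -` B \<inter> space M"
proof -
  obtain T where T: "completely_metrizable_space T" "second_countable T"
    and MT: "space M = topspace T" "sets M = sigma_sets (topspace T) {W. openin T W}"
    using assms(1) by (auto simp: standard_borel_def)
  obtain Y d where "Metric_space Y d" and comp: "Metric_space.mcomplete Y d"
    and TY: "T = Metric_space.mtopology Y d"
    using T(1) by (auto simp: completely_metrizable_space_def)
  then interpret Metric_space Y d by simp
  have sp: "space M = Y" using MT TY by simp
  obtain C where C: "countable C" "C \<subseteq> Y" "T closure_of C = Y"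
    using second_countable_imp_separable_space[OF T(2)] TY by (auto simp: separable_space_def)
  have "C \<noteq> {}" using C(3) ne sp by auto
  define s where "s = from_nat_into C"
  have s: "s n \<in> Y" for n
    using from_nat_into[OF \<open>C \<noteq> {}\<close>] C(2) by (auto simp: s_def)
  have rs: "range s = C" unfolding s_def by (rule range_from_nat_into) fact+
  have dense: "\<exists>n. d y (s n) < r" if "y \<in> Y" "r > 0" for y r
  proof -
    have "\<exists>c\<in>C. c \<in> mball y r"
      using that C(3) TY by (auto simp: metric_closure_of)
    then obtain n where "s n \<in> mball y r" using rs by blast
    then show ?thesis by (intro exI[of _ n]) (simp add: in_mball)
  qed
  define h where "h y n = d y (s n)" for y n
  have open_sets: "W \<in> sets M" if "openin T W" for W
    using that MT(2) by auto
  have hball: "h -` {u. u n < r} \<inter> space M = mball (s n) r" for n r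
    using s by (auto simp: h_def sp commute)
  have hm: "h \<in> borel_measurable M"
  proof (rule measurable_coordinatewise_then_product)
    fix n show "(\<lambda>y. h y n) \<in> borel_measurable M"
      unfolding borel_measurable_iff_less
    proof
      fix r
      have "{y \<in> space M. h y n < r} = mball (s n) r" using hball[of n r] by auto
      then show "{y \<in> space M. h y n < r} \<in> sets M" using TY by (simp add: open_sets)
    qed
  qed
  have inj: "inj_on h (space M)"
  proof (rule inj_onI, rule ccontr)
    fix x y assume xy: "x \<in> space M" "y \<in> space M" "h x = h y" "x \<noteq> y"
    then have "d x y > 0" by (simp add: sp)
    then obtain n where n: "d x (s n) < d x y / 2" using dense[of x "d x y / 2"] xy sp by auto
    moreover have "d x (s n) = d y (s n)" using xy(3) by (metis h_def)
    moreover have "d x y \<le> d x (s n) + d y (s n)"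
      using triangle[of x "s n" y] xy s sp by (simp add: commute)
    ultimately show False by simp
  qed
  \<comment> \<open>An open set is the union of the balls with rational radius around points of the
    dense sequence that it contains, and such a ball is an inequality for one coordinate of
    \<open>h\<close>.\<close>
  have basis: "\<exists>B\<in>sets borel. W = h -` B \<inter> space M" if W: "openin T W" for W
  proof -
    define I where "I = {(n, q :: rat). mball (s n) (of_rat q) \<subseteq> W}"
    define B :: "(nat \<Rightarrow> real) set" where "B = (\<Union>(n, q)\<in>I. {u. u n < of_rat q})"
    have "countable I" by simp
    then have "B \<in> sets borel"
      unfolding B_def
      by (intro sets.countable_UN')
         (auto intro!: borel_measurable_less[unfolded space_borel, simplified])
    moreover have "W = h -` B \<inter> space M"
    proof (intro Set.set_eqI iffI)
      fix y assume y: "y \<in> W"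
      then have "y \<in> Y" "\<exists>r>0. mball y r \<subseteq> W" using W TY by (auto simp: openin_mtopology)
      then obtain r where r: "r > 0" "mball y r \<subseteq> W" by auto
      obtain n where n: "d y (s n) < r / 2" using dense[OF \<open>y \<in> Y\<close>, of "r/2"] r by auto
      obtain q where q: "d y (s n) < of_rat q" "of_rat q < r / 2" using of_rat_dense[OF n] by auto
      have "mball (s n) (of_rat q) \<subseteq> mball y r"
      proof
        fix x assume "x \<in> mball (s n) (of_rat q)"
        then have x: "x \<in> Y" "d (s n) x < of_rat q" by auto
        have "d y x \<le> d y (s n) + d (s n) x" using triangle \<open>y \<in> Y\<close> s x by auto
        then show "x \<in> mball y r" using x q \<open>y \<in> Y\<close> n by auto
      qed
      then have "(n, q) \<in> I" using r by (auto simp: I_def)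
      then show "y \<in> h -` B \<inter> space M" using q(1) \<open>y \<in> Y\<close>
        by (auto simp: B_def h_def sp intro!: bexI[of _ "(n, q)"])
    next
      fix y assume "y \<in> h -` B \<inter> space M"
      then obtain n q where nq: "(n, q) \<in> I" "y \<in> h -` {u. u n < of_rat q} \<inter> space M"
        by (auto simp: B_def)
      then show "y \<in> W" unfolding hball by (auto simp: I_def)
    qed
    ultimately show ?thesis by blast
  qed
  have gen: "\<exists>B\<in>sets borel. A = h -` B \<inter> space M" if "A \<in> sets M" for A
    using that unfolding MT(2)
  proof (induction rule: sigma_sets.induct)
    case (Basic a) then show ?case using basis by simp
  next
    case Empty then show ?case by (intro bexI[of _ "{}"]) auto
  next
    case (Compl a)
    then obtain B where "B \<in> sets borel" "a = h -` B \<inter> space M" by auto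
    then show ?case by (intro bexI[of _ "- B"]) (auto simp: MT(1))
  next
    case (Union a)
    then obtain B where "\<And>i. B i \<in> sets borel" "\<And>i. a i = h -` B i \<inter> space M" by metis
    then show ?case by (intro bexI[of _ "\<Union>i::nat. B i"]) auto
  qed
  \<comment> \<open>The two-sided inequalities say that u looks like the distances to one extra
    point, the last clause that this point lies in the closure of the sequence: points
    \<open>s (f k)\<close> with \<open>u (f k)\<close> small form a Cauchy sequence, and its limit
    is the preimage of u. Only countably many coordinates and inequalities occur, so the set is
    Borel.\<close>
  have img: "h ` space M =
      {u. (\<forall>n m. \<bar>u n - u m\<bar> \<le> d (s n) (s m) \<and> d (s n) (s m) \<le> u n + u m) \<and>
          (\<forall>k. \<exists>n. u n < inverse (real (Suc k)))}" (is "_ = ?R")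
  proof (intro Set.set_eqI iffI)
    fix u assume "u \<in> h ` space M"
    then obtain y where y: "y \<in> Y" "u = h y" by (auto simp: sp)
    have "\<bar>u n - u m\<bar> \<le> d (s n) (s m)" "d (s n) (s m) \<le> u n + u m" for n m
      using triangle[of y "s n" "s m"] triangle[of y "s m" "s n"] triangle[of "s n" y "s m"] s y
      by (auto simp: h_def commute)
    moreover have "\<exists>n. u n < inverse (real (Suc k))" for k
      using dense[OF y(1), of "inverse (real (Suc k))"] by (simp add: y h_def)
    ultimately show "u \<in> ?R" by blast
  next
    fix u assume u: "u \<in> ?R"
    then have "\<forall>k. \<exists>n. u n < inverse (real (Suc k))" by blast
    then obtain f where f: "\<And>k. u (f k) < inverse (real (Suc k))" by metis
    have tri: "d (s n) (s m) \<le> u n + u m" "\<bar>u n - u m\<bar> \<le> d (s n) (s m)" for n m using u by auto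
    have nonneg: "0 \<le> u n" for n using tri(1)[of n n] s by simp
    have u0: "(\<lambda>k. u (f k)) \<longlonglongrightarrow> 0"
      by (rule tendsto_sandwich[OF _ _ tendsto_const LIMSEQ_inverse_real_of_nat])
         (use f nonneg in \<open>auto intro!: always_eventually less_imp_le\<close>)
    have "MCauchy (\<lambda>k. s (f k))"
      unfolding MCauchy_def
    proof (intro conjI allI impI)
      fix \<epsilon> :: real assume "0 < \<epsilon>"
      then have "\<forall>\<^sub>F k in sequentially. u (f k) < \<epsilon> / 2"
        using order_tendstoD(2)[OF u0, of "\<epsilon> / 2"] by simp
      then obtain N where N: "\<And>k. k \<ge> N \<Longrightarrow> u (f k) < \<epsilon> / 2" by (auto simp: eventually_sequentially)
      show "\<exists>N. \<forall>n n'. N \<le> n \<longrightarrow> N \<le> n' \<longrightarrow> d (s (f n)) (s (f n')) < \<epsilon>"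
      proof (intro exI allI impI)
        fix n n' assume "N \<le> n" "N \<le> n'"
        then show "d (s (f n)) (s (f n')) < \<epsilon>"
          using N[of n] N[of n'] tri(1)[of "f n" "f n'"] by linarith
      qed
    qed (use s in auto)
    then obtain y where "limitin mtopology (\<lambda>k. s (f k)) y sequentially"
      using comp by (auto simp: mcomplete_def)
    then have y: "y \<in> Y" "(\<lambda>k. d (s (f k)) y) \<longlonglongrightarrow> 0"
      by (auto simp: limitin_metric_dist_null)
    have "u n = h y n" for n
    proof -
      have "(\<lambda>k. d (s n) (s (f k))) \<longlonglongrightarrow> u n"
      proof (rule tendsto_sandwich)
        show "(\<lambda>k. u n - u (f k)) \<longlonglongrightarrow> u n" using tendsto_diff[OF tendsto_const u0, of "u n"] by simp
        show "(\<lambda>k. u n + u (f k)) \<longlonglongrightarrow> u n" using tendsto_add[OF tendsto_const u0, of "u n"] by simp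
        show "\<forall>\<^sub>F k in sequentially. u n - u (f k) \<le> d (s n) (s (f k))"
          using tri(2) by (intro always_eventually) (meson abs_le_D1)
        show "\<forall>\<^sub>F k in sequentially. d (s n) (s (f k)) \<le> u n + u (f k)"
          using tri(1) by (intro always_eventually) blast
      qed
      moreover have "(\<lambda>k. d (s n) (s (f k))) \<longlonglongrightarrow> d y (s n)"
      proof (rule tendsto_sandwich)
        show "(\<lambda>k. d y (s n) - d (s (f k)) y) \<longlonglongrightarrow> d y (s n)" using tendsto_diff[OF tendsto_const y(2), of "d y (s n)"] by simp
        show "(\<lambda>k. d y (s n) + d (s (f k)) y) \<longlonglongrightarrow> d y (s n)" using tendsto_add[OF tendsto_const y(2), of "d y (s n)"] by simp
        show "\<forall>\<^sub>F k in sequentially. d y (s n) - d (s (f k)) y \<le> d (s n) (s (f k))"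
          using triangle[OF y(1) s s] by (intro always_eventually) (simp add: commute algebra_simps)
        show "\<forall>\<^sub>F k in sequentially. d (s n) (s (f k)) \<le> d y (s n) + d (s (f k)) y"
          using triangle[OF s y(1) s] by (intro always_eventually) (simp add: commute)
      qed
      ultimately show ?thesis unfolding h_def by (rule LIMSEQ_unique)
    qed
    then show "u \<in> h ` space M" using y(1) sp by blast
  qed
  have "?R \<in> sets borel"
  proof -
    have [measurable]: "(\<lambda>u::nat \<Rightarrow> real. u n) \<in> borel_measurable borel" for n
      by (rule measurable_product_coordinates)
    show ?thesis by measurable
  qed
  with img have "h ` space M \<in> sets borel" by simp
  with that[OF hm inj] gen show thesis by blast
qed

text \<open>The image of a measurable set is in general only analytic. Instead, the graph of
  \<open>f\<close> over \<open>P\<close> is viewed as a Borel set in a product of two Polish spaces;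
  compact sets exhaust it up to measure 0, and the projection of a compact set is compact, hence
  Borel.\<close>

lemma measurable_image_essential:
  fixes N :: "'y measure" and Z :: "'z measure"
  assumes N: "prob_space N" "standard_borel N" and Z: "standard_borel Z"
    and f: "f \<in> N \<rightarrow>\<^sub>M Z" and P: "P \<in> sets N"
  obtains C where "C \<in> sets Z" "C \<subseteq> f ` P" "emeasure N (P - f -` C) = 0"
proof -
  interpret N: prob_space N by fact
  have "space N \<noteq> {}" by (rule N.not_empty)
  moreover have "space Z \<noteq> {}" using N.not_empty measurable_space[OF f] by blast
  ultimately obtain h k where h: "h \<in> N \<rightarrow>\<^sub>M (borel :: (nat \<Rightarrow> real) measure)"
      "inj_on h (space N)" "h ` space N \<in> sets borel"
      "\<And>A. A \<in> sets N \<Longrightarrow> \<exists>B\<in>sets borel. A = h -` B \<inter> space N"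
    and k: "k \<in> Z \<rightarrow>\<^sub>M (borel :: (nat \<Rightarrow> real) measure)" "inj_on k (space Z)"
    by (metis standard_borel_embedding N(2) Z)
  define H where "H = the_inv_into (space N) h"
  have Hh: "H (h y) = y" if "y \<in> space N" for y
    using that h(2) by (simp add: H_def the_inv_into_f_f)
  define S where "S = restrict_space borel (h ` space N)"
  have "H \<in> S \<rightarrow>\<^sub>M N"
  proof (rule measurableI)
    fix u assume "u \<in> space S" then show "H u \<in> space N" by (auto simp: S_def Hh space_restrict_space)
  next
    fix A assume "A \<in> sets N"
    then obtain B where B: "B \<in> sets borel" "A = h -` B \<inter> space N" using h(4) by blast
    have "H -` A \<inter> space S = B \<inter> h ` space N"
      using B(2) by (auto simp: S_def Hh space_restrict_space)
    then show "H -` A \<inter> space S \<in> sets S"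
      using B(1) h(3) by (auto simp: S_def sets_restrict_space)
  qed
  then have Hm: "(\<lambda>u. k (f (H u))) \<in> borel_measurable S"
    using measurable_compose[OF measurable_compose[OF _ f] k(1)] by blast
  define P' where "P' = (\<lambda>y. (h y, k (f y))) ` P"
  obtain B where B: "B \<in> sets borel" "P = h -` B \<inter> space N" using h(4)[OF P] by blast
  have Psub: "P \<subseteq> space N" using sets.sets_into_space[OF P] .
  \<comment> \<open>On the Borel image of \<open>h\<close> the second coordinate is a Borel function
    of the first, so the graph is Borel. The value 0 outside that image merely makes the function
    total.\<close>
  have "P' = {w \<in> space (borel \<Otimes>\<^sub>M borel). fst w \<in> B \<inter> h ` space N \<and> snd w = (if fst w \<in> h ` space N then k (f (H (fst w))) else (\<lambda>_. 0))}"
    using Psub B(2) inj_onD[OF h(2)] by (force simp: P'_def Hh space_pair_measure image_iff)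
  also have "\<dots> \<in> sets (borel \<Otimes>\<^sub>M borel)"
  proof -
    have m: "(\<lambda>u. if u \<in> h ` space N then k (f (H u)) else (\<lambda>_. 0)) \<in> borel_measurable borel"
      using Hm h(3) unfolding S_def by (subst (asm) measurable_restrict_space_iff) auto
    note [measurable] = m B(1) h(3)
    show ?thesis by measurable
  qed
  finally have P': "P' \<in> sets (borel :: ((nat \<Rightarrow> real) \<times> (nat \<Rightarrow> real)) measure)" unfolding borel_prod .
  define \<Phi> where "\<Phi> y = (h y, k (f y))" for y
  have \<Phi>: "\<Phi> \<in> borel_measurable N"
    unfolding \<Phi>_def using h(1) measurable_compose[OF f k(1)] by (intro borel_measurable_Pair)
  define \<nu> where "\<nu> = distr N borel \<Phi>"
  interpret \<nu>: prob_space \<nu> unfolding \<nu>_def by (rule N.prob_space_distr) fact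
  have sn [simp]: "sets \<nu> = sets borel" by (simp add: \<nu>_def)
  define \<K> where "\<K> = {K. K \<subseteq> P' \<and> compact K}"
  have SUP: "emeasure \<nu> P' = (SUP K \<in> \<K>. emeasure \<nu> K)"
    unfolding \<K>_def by (rule inner_regular[OF sn _ P']) simp
  have "{} \<in> \<K>" by (simp add: \<K>_def)
  then have "\<K> \<noteq> {}" by blast
  \<comment> \<open>A sequence of compact sets already attains the supremum, so that its union
    misses only a null set.\<close>
  from ennreal_SUP_countable_SUP[OF this, of "emeasure \<nu>"] obtain f' :: "nat \<Rightarrow> ennreal"
    where f': "range f' \<subseteq> emeasure \<nu> ` \<K>" "emeasure \<nu> P' = (SUP n. f' n)"
    unfolding SUP by blast
  have "\<forall>n. \<exists>K\<in>\<K>. f' n = emeasure \<nu> K" using f'(1) by blast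
  then obtain K where K': "\<And>n. K n \<in> \<K>" and f'K: "\<And>n. f' n = emeasure \<nu> (K n)"
    by metis
  have K: "K n \<subseteq> P' \<and> compact (K n)" for n using K'[of n] by (simp add: \<K>_def)
  have Kl: "emeasure \<nu> P' = (SUP n. emeasure \<nu> (K n))" using f'(2) by (simp add: f'K)
  have Kb: "K n \<in> sets borel" for n using K[of n] by (auto intro: borel_compact)
  define C0 where "C0 = (\<Union>n. snd ` K n)"
  have "C0 \<in> sets borel"
    unfolding C0_def
  proof (intro sets.countable_UN image_subsetI)
    fix n
    have "compact (snd ` K n)"
      using K by (intro compact_continuous_image continuous_on_snd continuous_on_id) auto
    then show "snd ` K n \<in> sets borel" by (rule borel_compact)
  qed
  define C where "C = k -` C0 \<inter> space Z"
  have "C \<in> sets Z" unfolding C_def using k(1) \<open>C0 \<in> sets borel\<close> by measurable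
  moreover have "C \<subseteq> f ` P"
  proof
    fix z assume z: "z \<in> C"
    then obtain n w where "w \<in> K n" "k z = snd w" by (auto simp: C_def C0_def)
    then obtain y where "y \<in> P" "k z = k (f y)" using K[of n] by (auto simp: P'_def)
    moreover from this have "z = f y"
      using z Psub measurable_space[OF f] by (intro inj_onD[OF k(2)]) (auto simp: C_def)
    ultimately show "z \<in> f ` P" by blast
  qed
  moreover have "emeasure N (P - f -` C) = 0"
  proof -
    have "emeasure \<nu> P' \<le> emeasure \<nu> (\<Union>n. K n)"
      unfolding Kl
    proof (rule SUP_least, rule emeasure_mono)
      fix n show "K n \<subseteq> (\<Union>n. K n)" by blast
      show "(\<Union>n. K n) \<in> sets \<nu>" using Kb by simp
    qed
    then have le: "emeasure \<nu> P' \<le> emeasure \<nu> (\<Union>n. K n)" .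
    have Ub: "(\<Union>n. K n) \<in> sets \<nu>" using Kb by simp
    have "emeasure \<nu> (P' - (\<Union>n. K n)) = emeasure \<nu> P' - emeasure \<nu> (\<Union>n. K n)"
    proof (rule emeasure_Diff)
      show "(\<Union>n. K n) \<subseteq> P'" using K by blast
    qed (use P' Ub in simp_all)
    also have "\<dots> = 0" using le by (simp add: diff_eq_0_iff_ennreal \<nu>.emeasure_eq_measure)
    finally have 0: "emeasure \<nu> (P' - (\<Union>n. K n)) = 0" .
    have "P' - (\<Union>n. K n) \<in> sets borel" using P' Ub by auto
    then have 1: "emeasure N (\<Phi> -` (P' - (\<Union>n. K n)) \<inter> space N) = 0"
      using 0 emeasure_distr[OF \<Phi>, of "P' - (\<Union>n. K n)"] by (simp add: \<nu>_def)
    have "P - f -` C \<subseteq> \<Phi> -` (P' - (\<Union>n. K n)) \<inter> space N"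
    proof
      fix y assume y: "y \<in> P - f -` C"
      then have "f y \<in> space Z" "k (f y) \<notin> C0"
        using Psub measurable_space[OF f] by (auto simp: C_def)
      then have "\<Phi> y \<notin> K n" for n
        by (auto simp: C0_def \<Phi>_def) (metis image_eqI snd_conv)
      then show "y \<in> \<Phi> -` (P' - (\<Union>n. K n)) \<inter> space N"
        using y Psub by (auto simp: P'_def \<Phi>_def)
    qed
    moreover have "\<Phi> -` (P' - (\<Union>n. K n)) \<inter> space N \<in> sets N"
      using measurable_sets[OF \<Phi>, of "P' - (\<Union>n. K n)"] Kb P' by auto
    ultimately show ?thesis using 1 by (metis emeasure_mono le_zero_eq)
  qed
  ultimately show thesis by (rule that)
qed

lemma standard_borel_countably_generated:
  assumes "standard_borel M" and "space M \<noteq> {}"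
  obtains B :: "nat \<Rightarrow> 'x set"
  where "\<And>r. B r \<in> sets M" "\<And>A. A \<in> sets M \<Longrightarrow> A \<in> sigma_sets (space M) (range B)"
proof -
  obtain h :: "'x \<Rightarrow> nat \<Rightarrow> real" where h: "h \<in> borel_measurable M"
    "\<And>A. A \<in> sets M \<Longrightarrow> \<exists>B\<in>sets borel. A = h -` B \<inter> space M"
    using standard_borel_embedding[OF assms] by metis
  obtain \<B> :: "(nat \<Rightarrow> real) set set" where \<B>: "countable \<B>" "topological_basis \<B>"
    using ex_countable_basis by blast
  have "\<B> \<noteq> {}" using \<B>(2) unfolding topological_basis_def by (metis UNIV_not_empty Sup_empty empty_subsetI open_UNIV subset_empty)
  define B where "B n = h -` from_nat_into \<B> n \<inter> space M" for n
  have rB: "range (from_nat_into \<B>) = \<B>" by (rule range_from_nat_into) fact+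
  have borel: "sets (borel :: (nat \<Rightarrow> real) measure) = sigma_sets UNIV \<B>"
    unfolding borel_eq_countable_basis[OF \<B>] by (rule sets_measure_of) simp
  have gen: "h -` A \<inter> space M \<in> sigma_sets (space M) (range B)" if "A \<in> sigma_sets UNIV \<B>" for A
    using that
  proof (induction rule: sigma_sets.induct)
    case (Basic a)
    then obtain n where "a = from_nat_into \<B> n" using rB by blast
    then show ?case by (intro sigma_sets.Basic) (auto simp: B_def)
  next
    case (Compl a)
    have "h -` (UNIV - a) \<inter> space M = space M - (h -` a \<inter> space M)" by auto
    then show ?case using sigma_sets.Compl[OF Compl.IH] by simp
  next
    case (Union a)
    have "h -` (\<Union>i. a i) \<inter> space M = (\<Union>i. h -` a i \<inter> space M)" by auto
    then show ?case using sigma_sets.Union[OF Union.IH] by simp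
  qed (simp add: sigma_sets.Empty)
  show thesis
  proof (rule that)
    fix n
    have "from_nat_into \<B> n \<in> sets borel" unfolding borel using rB by (intro sigma_sets.Basic) auto
    then show "B n \<in> sets M" unfolding B_def using h(1) by measurable
  next
    fix A assume "A \<in> sets M"
    then obtain B' where "B' \<in> sets borel" "A = h -` B' \<inter> space M" using h(2) by blast
    then show "A \<in> sigma_sets (space M) (range B)" using gen borel by simp
  qed
qed

section \<open>Conditional measures and labels for the points of a fibre\<close>

lemma conditional_measure:
  assumes N: "prob_space N" and \<phi>: "\<phi> \<in> N \<rightarrow>\<^sub>M Z" "distr N Z \<phi> = Z" and P: "P \<in> sets N"
  obtains u :: "'z \<Rightarrow> real" where "u \<in> borel_measurable Z" "\<And>z. 0 \<le> u z" "\<And>z. u z \<le> 1"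
    "\<And>C. C \<in> sets Z \<Longrightarrow> measure N (P \<inter> \<phi> -` C) = (\<integral>z. indicator C z * u z \<partial>Z)"
proof -
  interpret N: prob_space N by fact
  interpret Z: prob_space Z using N.prob_space_distr[OF \<phi>(1)] \<phi>(2) by simp
  note [measurable] = \<phi>(1) P
  \<comment> \<open>\<open>\<nu>\<close> is the part of \<open>P\<close> pushed down to
    \<open>Z\<close>. It is dominated by \<open>Z\<close>, and \<open>u\<close> is its Radon-Nikodym
    derivative, capped so that the bounds hold at every point and not just almost
    everywhere.\<close>
  define \<nu> where "\<nu> = distr (density N (indicator P)) Z \<phi>"
  have Psub: "P \<subseteq> space N" using sets.sets_into_space[OF P] .
  have \<nu>: "emeasure \<nu> C = emeasure N (P \<inter> \<phi> -` C)" if [measurable]: "C \<in> sets Z" for C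
  proof -
    have "emeasure \<nu> C = emeasure (density N (indicator P)) (\<phi> -` C \<inter> space N)"
      unfolding \<nu>_def by (subst emeasure_distr) auto
    also have "\<dots> = (\<integral>\<^sup>+y. indicator (P \<inter> \<phi> -` C) y \<partial>N)"
      by (subst emeasure_density) (auto intro!: nn_integral_cong simp: indicator_def)
    also have "\<dots> = emeasure N (P \<inter> \<phi> -` C)"
    proof (rule nn_integral_indicator)
      have "P \<inter> (\<phi> -` C \<inter> space N) \<in> sets N" by measurable
      moreover have "P \<inter> (\<phi> -` C \<inter> space N) = P \<inter> \<phi> -` C" using Psub by auto
      ultimately show "P \<inter> \<phi> -` C \<in> sets N" by simp
    qed
    finally show ?thesis .
  qed
  have \<nu>Z: "emeasure \<nu> C \<le> emeasure Z C" if [measurable]: "C \<in> sets Z" for C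
  proof -
    have "emeasure Z C = emeasure N (\<phi> -` C \<inter> space N)"
      using emeasure_distr[OF \<phi>(1) that] \<phi>(2) by simp
    then show ?thesis unfolding \<nu>[OF that]
      using Psub by (auto intro!: emeasure_mono)
  qed
  have "absolutely_continuous Z \<nu>"
    unfolding absolutely_continuous_def
  proof
    fix C assume "C \<in> null_sets Z"
    then show "C \<in> null_sets \<nu>"
      using \<nu>Z[of C] by (auto simp: null_sets_def \<nu>_def)
  qed
  moreover have "sets \<nu> = sets Z" by (simp add: \<nu>_def)
  ultimately obtain f where f[measurable]: "f \<in> borel_measurable Z" and fd: "density Z f = \<nu>"
    using Z.Radon_Nikodym by blast
  have fi: "emeasure \<nu> C = (\<integral>\<^sup>+z. f z * indicator C z \<partial>Z)" if "C \<in> sets Z" for C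
    using emeasure_density[OF f that] fd by simp
  \<comment> \<open>If the density exceeded 1 on a set of positive measure, integrating it over
    \<open>C1\<close> would contradict the domination by \<open>Z\<close>.\<close>
  define C1 where "C1 = {z \<in> space Z. 1 < f z}"
  have C1[measurable]: "C1 \<in> sets Z" unfolding C1_def by measurable
  have "AE z in Z. f z * indicator C1 z \<le> indicator C1 z"
  proof (rule ccontr)
    assume "\<not> ?thesis"
    then have "(\<integral>\<^sup>+z. indicator C1 z \<partial>Z) < (\<integral>\<^sup>+z. f z * indicator C1 z \<partial>Z)"
    proof (intro nn_integral_less)
      show "(\<integral>\<^sup>+z. indicator C1 z \<partial>Z) \<noteq> \<infinity>" by simp
    qed (auto simp: C1_def indicator_def less_imp_le)
    then show False using \<nu>Z[OF C1] fi[OF C1] by simp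
  qed
  then have f1: "AE z in Z. f z \<le> 1"
    using AE_space
  proof eventually_elim
    case (elim z)
    then show ?case by (cases "1 < f z") (auto simp: C1_def not_less)
  qed
  define u where "u z = min 1 (enn2real (f z))" for z
  have um[measurable]: "u \<in> borel_measurable Z" unfolding u_def by measurable
  have uf: "AE z in Z. ennreal (u z) = f z"
    using f1
  proof eventually_elim
    case (elim z)
    then have fin: "f z < Orderings.top" by (auto intro: le_less_trans)
    then have "enn2real (f z) \<le> 1" using elim by (simp add: enn2real_leI)
    then show ?case using fin by (simp add: u_def)
  qed
  have u0: "0 \<le> u z" "u z \<le> 1" for z by (auto simp: u_def)
  show thesis
  proof (rule that[OF um u0])
    fix C assume C[measurable]: "C \<in> sets Z"
    have "measure N (P \<inter> \<phi> -` C) = enn2real (\<integral>\<^sup>+z. f z * indicator C z \<partial>Z)"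
      unfolding measure_def \<nu>[OF C, symmetric] fi[OF C] ..
    also have "(\<integral>\<^sup>+z. f z * indicator C z \<partial>Z) = (\<integral>\<^sup>+z. ennreal (indicator C z * u z) \<partial>Z)"
      by (rule nn_integral_cong_AE) (use uf in eventually_elim, auto simp: indicator_def)
    also have "enn2real \<dots> = (\<integral>z. indicator C z * u z \<partial>Z)"
      by (rule integral_eq_nn_integral[symmetric]) (auto simp: u0)
    finally show "measure N (P \<inter> \<phi> -` C) = (\<integral>z. indicator C z * u z \<partial>Z)" .
  qed
qed

lemma (in prob_space) integrable_unit_interval:
  fixes u :: "'a \<Rightarrow> real"
  assumes "u \<in> borel_measurable M" "\<And>z. 0 \<le> u z" "\<And>z. u z \<le> 1"
  shows "integrable M u"
  by (rule integrable_const_bound[of _ 1]) (use assms in auto)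

lemma conditional_measure_null:
  fixes u :: "'z \<Rightarrow> real"
  assumes Z: "prob_space Z" and u: "u \<in> borel_measurable Z" "\<And>z. 0 \<le> u z" "\<And>z. u z \<le> 1"
    and d: "measure N (P \<inter> \<phi> -` C) = (\<integral>z. indicator C z * u z \<partial>Z)" and C: "C \<in> sets Z"
  shows "measure N (P \<inter> \<phi> -` C) = 0 \<longleftrightarrow> (AE z in Z. z \<in> C \<longrightarrow> u z = 0)"
proof -
  interpret prob_space Z by fact
  note [measurable] = u(1) C
  have "integrable Z (\<lambda>z. indicator C z * u z)"
    by (rule integrable_unit_interval) (auto simp: u indicator_def)
  then have "measure N (P \<inter> \<phi> -` C) = 0 \<longleftrightarrow> (AE z in Z. indicator C z * u z = 0)"
    unfolding d by (rule integral_nonneg_eq_0_iff_AE) (auto simp: u)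
  also have "\<dots> \<longleftrightarrow> (AE z in Z. z \<in> C \<longrightarrow> u z = 0)" by (simp add: indicator_def)
  finally show ?thesis .
qed

text \<open>
  Over almost every point the extension has finitely many points, so the conditional measure on
  the fibre is carried by finitely many atoms, each of which is cut out of the fibre by a finite
  intersection of generators and their complements; the label records the first such
  intersection, in a fixed enumeration, that contains the point.
\<close>

lemma finite_to_one_labels:
  fixes N :: "'y measure" and Z :: "'z measure"
  assumes N: "prob_space N" "standard_borel N" and Z: "standard_borel Z"
    and \<phi>: "\<phi> \<in> N \<rightarrow>\<^sub>M Z" "distr N Z \<phi> = Z"
    and fin: "AE z in Z. finite {y \<in> space N. \<phi> y = z}"
  obtains l :: "'y \<Rightarrow> nat" where "l \<in> N \<rightarrow>\<^sub>M count_space UNIV"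
    "\<And>A. A \<in> sets N \<Longrightarrow> \<exists>C. (\<forall>k. C k \<in> sets Z) \<and> (AE y in N. y \<in> A \<longleftrightarrow> \<phi> y \<in> C (l y))"
proof -
  interpret N: prob_space N by fact
  interpret Z: prob_space Z using N.prob_space_distr[OF \<phi>(1)] \<phi>(2) by simp
  note [measurable] = \<phi>(1)
  obtain B where B[measurable]: "\<And>r::nat. B r \<in> sets N"
    and gen: "\<And>A. A \<in> sets N \<Longrightarrow> A \<in> sigma_sets (space N) (range B)"
    using standard_borel_countably_generated[OF N(2) N.not_empty] by metis
  have "\<forall>P\<in>sets N. \<exists>u. u \<in> borel_measurable Z \<and> (\<forall>z. 0 \<le> u z \<and> u z \<le> (1::real)) \<and>
    (\<forall>C\<in>sets Z. measure N (P \<inter> \<phi> -` C) = (\<integral>z. indicator C z * u z \<partial>Z))"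
  proof
    fix P assume P: "P \<in> sets N"
    show "\<exists>u. u \<in> borel_measurable Z \<and> (\<forall>z. 0 \<le> u z \<and> u z \<le> (1::real)) \<and>
      (\<forall>C\<in>sets Z. measure N (P \<inter> \<phi> -` C) = (\<integral>z. indicator C z * u z \<partial>Z))"
      by (rule conditional_measure[OF N(1) \<phi> P]) blast
  qed
  from bchoice[OF this] obtain u :: "'y set \<Rightarrow> 'z \<Rightarrow> real"
    where u_all: "\<forall>P\<in>sets N. u P \<in> borel_measurable Z \<and> (\<forall>z. 0 \<le> u P z \<and> u P z \<le> 1) \<and>
      (\<forall>C\<in>sets Z. measure N (P \<inter> \<phi> -` C) = (\<integral>z. indicator C z * u P z \<partial>Z))" ..
  have um[measurable]: "u P \<in> borel_measurable Z" and u01: "0 \<le> u P z" "u P z \<le> 1"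
    and u: "C \<in> sets Z \<Longrightarrow> measure N (P \<inter> \<phi> -` C) = (\<integral>z. indicator C z * u P z \<partial>Z)"
    if "P \<in> sets N" for P C z
    using u_all that by simp_all
  note null = conditional_measure_null[OF Z.prob_space_axioms um u01 u]
  \<comment> \<open>The part of \<open>P\<close> lying over the zero set of its own conditional
    measure is null.\<close>
  have pos: "AE y in N. y \<in> P \<longrightarrow> 0 < u P (\<phi> y)" if P: "P \<in> sets N" for P
  proof -
    define C where "C = {z \<in> space Z. u P z = 0}"
    have C: "C \<in> sets Z" unfolding C_def using P by measurable
    have "measure N (P \<inter> \<phi> -` C) = 0" using null[OF P P P P C] C P by (auto simp: C_def)
    moreover have sub: "P \<inter> \<phi> -` C = {y \<in> space N. \<not> (y \<in> P \<longrightarrow> 0 < u P (\<phi> y))}"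
      using sets.sets_into_space[OF P] measurable_space[OF \<phi>(1)] u01(1)[OF P]
      by (auto simp: C_def less_le)
    moreover have "{y \<in> space N. \<not> (y \<in> P \<longrightarrow> 0 < u P (\<phi> y))} \<in> sets N" using P by measurable
    ultimately show ?thesis
      by (subst AE_iff_measurable[OF _ refl]) (auto simp: N.emeasure_eq_measure)
  qed
  \<comment> \<open>This turns positive conditional measure into an actual point of the fibre, and
    is what links the measure theory to the pointwise hypothesis of finite fibres.\<close>
  have meets: "AE z in Z. 0 < u P z \<longrightarrow> (\<exists>y\<in>P. \<phi> y = z)" if P: "P \<in> sets N" for P
  proof -
    obtain C where C: "C \<in> sets Z" "C \<subseteq> \<phi> ` P" "emeasure N (P - \<phi> -` C) = 0"
      using measurable_image_essential[OF N Z \<phi>(1) P] .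
    have "P \<inter> \<phi> -` (space Z - C) = P - \<phi> -` C"
      using sets.sets_into_space[OF P] measurable_space[OF \<phi>(1)] by auto
    then have "measure N (P \<inter> \<phi> -` (space Z - C)) = 0" using C(3) by (simp add: measure_def)
    then have "AE z in Z. z \<in> space Z - C \<longrightarrow> u P z = 0"
      using null[OF P P P P, of "space Z - C"] C(1) P by auto
    then show ?thesis using AE_space by eventually_elim (use C(2) in auto)
  qed
  \<comment> \<open>A list codes a finite intersection of generators (\<open>True\<close>) and
    complements of generators (\<open>False\<close>). There are countably many lists, so their
    numbers can serve as labels.\<close>
  define D where "D s = space N \<inter> (\<Inter>(r, b)\<in>set s. if b then B r else space N - B r)"
    for s :: "(nat \<times> bool) list"
  have D_Nil: "D [] = space N"
    and D_in: "D ((r, True) # s) = D s \<inter> B r" and D_out: "D ((r, False) # s) = D s - B r" for r s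
    using sets.sets_into_space[OF B] by (auto simp: D_def)
  have D[measurable]: "D s \<in> sets N" for s
  proof (induction s)
    case Nil then show ?case by (simp add: D_Nil)
  next
    case (Cons rb s)
    then show ?case by (cases rb; cases "snd rb") (auto simp: D_in D_out)
  qed
  \<comment> \<open>The points over which \<open>D s\<close> is an atom of the conditional measure,
    or null: no generator cuts it into two pieces of positive weight.\<close>
  define St where "St s = {z \<in> space Z. \<forall>r. u (D s \<inter> B r) z = 0 \<or> u (D s - B r) z = 0}" for s
  have St[measurable]: "St s \<in> sets Z" for s unfolding St_def by measurable
  define S :: "nat \<Rightarrow> (nat \<times> bool) list" where "S = from_nat"
  define l where "l y = (LEAST n. y \<in> D (S n) \<and> \<phi> y \<in> St (S n))" for y
  have l[measurable]: "l \<in> N \<rightarrow>\<^sub>M count_space UNIV"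
    unfolding l_def by measurable
  have "AE z in Z. \<forall>s. 0 < u (D s) z \<longrightarrow> (\<exists>y\<in>D s. \<phi> y = z)"
    unfolding AE_all_countable using meets[OF D] by blast
  with fin have "AE z in Z. finite {y \<in> space N. \<phi> y = z} \<and> (\<forall>s. 0 < u (D s) z \<longrightarrow> (\<exists>y\<in>D s. \<phi> y = z))"
    by eventually_elim blast
  then have "AE y in N. finite {y' \<in> space N. \<phi> y' = \<phi> y} \<and> (\<forall>s. 0 < u (D s) (\<phi> y) \<longrightarrow> (\<exists>y'\<in>D s. \<phi> y' = \<phi> y))"
    by (subst (asm) \<phi>(2)[symmetric]) (rule AE_distrD[OF \<phi>(1)])
  then have stable: "AE y in N. \<exists>s. y \<in> D s \<and> \<phi> y \<in> St s"
    using AE_space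
  proof eventually_elim
    case (elim y)
    define c where "c s = card {y' \<in> D s. \<phi> y' = \<phi> y}" for s
    have fin: "finite {y' \<in> D s. \<phi> y' = \<phi> y}" for s
      by (rule finite_subset[of _ "{y' \<in> space N. \<phi> y' = \<phi> y}"])
         (use elim sets.sets_into_space[OF D] in auto)
    \<comment> \<open>Take a piece through \<open>y\<close> with the fewest points of the fibre. If
      a generator cut it into two pieces of positive weight, both would contain a point of the
      fibre, as \<open>meets\<close> showed, so the one through \<open>y\<close> would have fewer
      points still.\<close>
    obtain s where s: "y \<in> D s" and min: "\<And>t. y \<in> D t \<Longrightarrow> c s \<le> c t"
      using ex_has_least_nat[of "\<lambda>s. y \<in> D s" "[]" c] elim(2) by (auto simp: D_Nil)
    have "u (D s \<inter> B r) (\<phi> y) = 0 \<or> u (D s - B r) (\<phi> y) = 0" for r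
    proof (rule ccontr)
      assume "\<not> ?thesis"
      then have "0 < u (D ((r, True) # s)) (\<phi> y)" "0 < u (D ((r, False) # s)) (\<phi> y)"
        using u01(1)[OF D] by (auto simp: D_in D_out less_le simp flip: D_in D_out)
      then have both: "\<exists>y'\<in>D s. y' \<in> B r \<and> \<phi> y' = \<phi> y" "\<exists>y'\<in>D s. y' \<notin> B r \<and> \<phi> y' = \<phi> y"
      proof -
        assume "0 < u (D ((r, True) # s)) (\<phi> y)" "0 < u (D ((r, False) # s)) (\<phi> y)"
        then have "\<exists>y'\<in>D ((r, True) # s). \<phi> y' = \<phi> y" "\<exists>y'\<in>D ((r, False) # s). \<phi> y' = \<phi> y"
          using elim(1) by simp_all
        then show "\<exists>y'\<in>D s. y' \<in> B r \<and> \<phi> y' = \<phi> y" "\<exists>y'\<in>D s. y' \<notin> B r \<and> \<phi> y' = \<phi> y"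
          unfolding D_in D_out by blast+
      qed
      show False
      proof (cases "y \<in> B r")
        case True
        have "c ((r, True) # s) < c s"
          unfolding c_def by (rule psubset_card_mono[OF fin]) (use both in \<open>auto simp: D_in\<close>)
        then show False using min[of "(r, True) # s"] s True by (simp add: D_in)
      next
        case False
        have "c ((r, False) # s) < c s"
          unfolding c_def by (rule psubset_card_mono[OF fin]) (use both in \<open>auto simp: D_out\<close>)
        then show False using min[of "(r, False) # s"] s False by (simp add: D_out)
      qed
    qed
    then show ?case using s elim(2) measurable_space[OF \<phi>(1)] by (auto simp: St_def)
  qed
  have lD: "AE y in N. y \<in> D (S (l y)) \<and> \<phi> y \<in> St (S (l y))"
    using stable
  proof eventually_elim
    case (elim y)
    then obtain s where "y \<in> D s \<and> \<phi> y \<in> St s" by blast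
    then have "y \<in> D (S (to_nat s)) \<and> \<phi> y \<in> St (S (to_nat s))" by (simp add: S_def)
    then show ?case unfolding l_def by (rule LeastI)
  qed
  \<comment> \<open>Inside a stable piece, either \<open>B r\<close> or its complement has weight 0,
    and by \<open>pos\<close> almost no point lies on a side of weight 0. So the label and the base
    point decide membership in \<open>B r\<close>.\<close>
  have basic: "\<exists>C. (\<forall>k. C k \<in> sets Z) \<and> (AE y in N. y \<in> B r \<longleftrightarrow> \<phi> y \<in> C (l y))" for r
  proof (intro exI conjI allI)
    show "{z \<in> space Z. 0 < u (D (S k) \<inter> B r) z} \<in> sets Z" for k by measurable
    have "AE y in N. \<forall>k. (y \<in> D (S k) \<inter> B r \<longrightarrow> 0 < u (D (S k) \<inter> B r) (\<phi> y)) \<and>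
        (y \<in> D (S k) - B r \<longrightarrow> 0 < u (D (S k) - B r) (\<phi> y))"
      unfolding AE_all_countable AE_conj_iff by (intro allI conjI pos) measurable
    with lD AE_space
    show "AE y in N. y \<in> B r \<longleftrightarrow> \<phi> y \<in> {z \<in> space Z. 0 < u (D (S (l y)) \<inter> B r) z}"
    proof eventually_elim
      case (elim y)
      then have st: "u (D (S (l y)) \<inter> B r) (\<phi> y) = 0 \<or> u (D (S (l y)) - B r) (\<phi> y) = 0"
        by (auto simp: St_def)
      show ?case using elim st measurable_space[OF \<phi>(1)] by (cases "y \<in> B r") force+
    qed
  qed
  show thesis
  proof (rule that[OF l])
    fix A assume "A \<in> sets N"
    then have "A \<in> sigma_sets (space N) (range B)" by (rule gen)
    then show "\<exists>C. (\<forall>k. C k \<in> sets Z) \<and> (AE y in N. y \<in> A \<longleftrightarrow> \<phi> y \<in> C (l y))"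
    proof (induction rule: sigma_sets.induct)
      case (Basic a) then show ?case using basic by blast
    next
      case Empty then show ?case by (intro exI[of _ "\<lambda>_. {}"]) simp
    next
      case (Compl a)
      then obtain C where C: "\<forall>k. C k \<in> sets Z" "AE y in N. y \<in> a \<longleftrightarrow> \<phi> y \<in> C (l y)" by blast
      show ?case
      proof (intro exI[of _ "\<lambda>k. space Z - C k"] conjI)
        show "AE y in N. y \<in> space N - a \<longleftrightarrow> \<phi> y \<in> space Z - C (l y)"
          using C(2) AE_space by eventually_elim (use measurable_space[OF \<phi>(1)] in auto)
      qed (use C in auto)
    next
      case (Union a)
      then obtain C where C: "\<And>i k. C i k \<in> sets Z" "\<And>i. AE y in N. y \<in> a i \<longleftrightarrow> \<phi> y \<in> C i (l y)" by metis
      have "AE y in N. \<forall>i. y \<in> a i \<longleftrightarrow> \<phi> y \<in> C i (l y)" unfolding AE_all_countable using C(2) by blast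
      then show ?case
        by (intro exI[of _ "\<lambda>k. \<Union>i. C i k"]) (use C(1) in \<open>auto elim!: eventually_mono\<close>)
    qed
  qed
qed

section \<open>Permutation cocycles and their statistics\<close>

lemma sets_eq_fun:
  fixes f g :: "'a \<Rightarrow> 'b :: countable"
  assumes [measurable]: "f \<in> M \<rightarrow>\<^sub>M count_space UNIV" "g \<in> M \<rightarrow>\<^sub>M count_space UNIV"
  shows "{x \<in> space M. f x = g x} \<in> sets M"
  by measurable

lemma measurable_count_space_UNIV: "f \<in> M \<rightarrow>\<^sub>M count_space A \<Longrightarrow> f \<in> M \<rightarrow>\<^sub>M count_space UNIV"
  using measurable_compose[of f M "count_space A" "\<lambda>x. x" "count_space UNIV"] by simp

lemma shift_name_eq_iff:
  "\<pi> \<in> extensional F \<Longrightarrow> shift_name G a F \<alpha> x = \<pi> \<longleftrightarrow> (\<forall>f\<in>F. \<alpha> (a (inv\<^bsub>G\<^esub> f) x) = \<pi> f)"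
  by (auto simp: shift_name_def fun_eq_iff extensional_def restrict_def)

lemma AE_finite_ball:
  "finite F \<Longrightarrow> (\<And>f. f \<in> F \<Longrightarrow> AE x in M. P f x) \<Longrightarrow> AE x in M. \<forall>f\<in>F. P f x"
  by (rule AE_ball_countable'[OF _ countable_finite])

lemma factor_map_fst:
  assumes M: "pmp_action G M a" and N: "pmp_action G (M \<Otimes>\<^sub>M Q) b" and Q: "prob_space Q"
    and b: "\<And>g z. g \<in> carrier G \<Longrightarrow> z \<in> space (M \<Otimes>\<^sub>M Q) \<Longrightarrow> fst (b g z) = a g (fst z)"
  shows "factor_map G (M \<Otimes>\<^sub>M Q) b M a fst"
  using M N b prob_space.distr_pair_fst[OF Q, of M]
  by (auto simp: factor_map_def measure_preserving_map_def intro!: AE_I2)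

abbreviation perms :: "nat \<Rightarrow> (nat \<Rightarrow> nat) measure" where
  "perms D \<equiv> count_space {\<pi>. \<pi> permutes {..<D}}"

text \<open>This is \<open>cocycle\<close> for the symmetric group on D letters, with permutations
  kept as functions so that they can be applied to sheet numbers. The translation to a group of
  natural numbers happens in \<open>lift_permutation_cocycle\<close>.\<close>

definition permutation_cocycle ::
  "'g monoid \<Rightarrow> 'x measure \<Rightarrow> ('g \<Rightarrow> 'x \<Rightarrow> 'x) \<Rightarrow> nat \<Rightarrow> ('g \<Rightarrow> 'x \<Rightarrow> nat \<Rightarrow> nat) \<Rightarrow> bool" where
  "permutation_cocycle G M a D s \<longleftrightarrow>
     (\<forall>g\<in>carrier G. s g \<in> M \<rightarrow>\<^sub>M perms D) \<and>
     (\<forall>g\<in>carrier G. \<forall>h\<in>carrier G. AE x in M. s (g \<otimes>\<^bsub>G\<^esub> h) x = s g (a h x) \<circ> s h x)"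

text \<open>
  The joint statistics of \<open>\<beta>\<close> and of the partition \<open>(x, j) \<mapsto> A j x\<close> of the skew product of \<open>M\<close> by \<open>s\<close>
  with \<open>{..<D}\<close>, the latter carrying the uniform measure.
\<close>

definition sheet_event ::
  "'g monoid \<Rightarrow> 'x measure \<Rightarrow> ('g \<Rightarrow> 'x \<Rightarrow> 'x) \<Rightarrow> 'g set \<Rightarrow> ('g \<Rightarrow> 'x \<Rightarrow> nat \<Rightarrow> nat) \<Rightarrow>
   (nat \<Rightarrow> 'x \<Rightarrow> nat) \<Rightarrow> ('x \<Rightarrow> nat) \<Rightarrow> ('g \<Rightarrow> nat) \<Rightarrow> nat \<Rightarrow> nat \<Rightarrow> 'x set" where
  "sheet_event G M a F s A \<beta> \<pi> r j =
     {x \<in> space M. (\<forall>f\<in>F. A (s (inv\<^bsub>G\<^esub> f) x j) (a (inv\<^bsub>G\<^esub> f) x) = \<pi> f) \<and> \<beta> x = r}"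

definition sheet_stat ::
  "'g monoid \<Rightarrow> 'x measure \<Rightarrow> ('g \<Rightarrow> 'x \<Rightarrow> 'x) \<Rightarrow> 'g set \<Rightarrow> nat \<Rightarrow> ('g \<Rightarrow> 'x \<Rightarrow> nat \<Rightarrow> nat) \<Rightarrow>
   (nat \<Rightarrow> 'x \<Rightarrow> nat) \<Rightarrow> ('x \<Rightarrow> nat) \<Rightarrow> ('g \<Rightarrow> nat) \<Rightarrow> nat \<Rightarrow> real" where
  "sheet_stat G M a F D s A \<beta> \<pi> r = (\<Sum>j<D. measure M (sheet_event G M a F s A \<beta> \<pi> r j)) / D"

lemma sheet_event_measurable:
  fixes G (structure)
  assumes M: "pmp_action G M a" and F: "finite F" "F \<subseteq> carrier G"
    and s: "\<And>g. g \<in> carrier G \<Longrightarrow> s g \<in> M \<rightarrow>\<^sub>M perms D"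
    and A: "\<And>j. A j \<in> M \<rightarrow>\<^sub>M count_space P" and \<beta>: "\<beta> \<in> M \<rightarrow>\<^sub>M count_space Q"
  shows "sheet_event G M a F s A \<beta> \<pi> r j \<in> sets M"
proof -
  interpret group G by (rule pmp_action_facts[OF M])
  have "{x \<in> space M. A (s (inv f) x j) (a (inv f) x) = \<pi> f} \<in> sets M" if f: "f \<in> F" for f
  proof (rule sets_eq_const)
    have i: "inv f \<in> carrier G" using F f by auto
    show "(\<lambda>x. A (s (inv f) x j) (a (inv f) x)) \<in> M \<rightarrow>\<^sub>M count_space P"
    proof (rule measurable_compose_countable[where f = "\<lambda>k x. A k (a (inv f) x)"])
      show "(\<lambda>x. A k (a (inv f) x)) \<in> M \<rightarrow>\<^sub>M count_space P" for k
        by (rule measurable_compose[OF pmp_action_facts(3)[OF M i] A])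
      show "(\<lambda>x. s (inv f) x j) \<in> M \<rightarrow>\<^sub>M count_space UNIV"
        by (rule measurable_compose[OF s[OF i]]) simp
    qed
  qed
  then show ?thesis
    unfolding sheet_event_def
    by (intro sets.sets_Collect_conj sets.sets_Collect_finite_All F(1) sets_eq_const[OF \<beta>])
qed

section \<open>Finite-to-one extensions\<close>

lemma AE_le_of_integral_le:
  fixes f g :: "'a \<Rightarrow> real"
  assumes f: "integrable M f" and g: "integrable M g"
    and le: "\<And>C. C \<in> sets M \<Longrightarrow> (\<integral>z. indicator C z * f z \<partial>M) \<le> (\<integral>z. indicator C z * g z \<partial>M)"
  shows "AE z in M. f z \<le> g z"
proof -
  note [measurable] = f g
  define C where "C = {z \<in> space M. g z < f z}"
  have C[measurable]: "C \<in> sets M" unfolding C_def by measurable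
  have if': "integrable M (\<lambda>z. indicator C z * f z)" and ig: "integrable M (\<lambda>z. indicator C z * g z)"
    using integrable_mult_indicator[OF C f] integrable_mult_indicator[OF C g] by simp_all
  have "(\<integral>z. indicator C z * (f z - g z) \<partial>M) \<le> 0"
    using le[OF C] Bochner_Integration.integral_diff[OF if' ig] by (simp add: algebra_simps)
  moreover have "0 \<le> (\<integral>z. indicator C z * (f z - g z) \<partial>M)"
    by (rule integral_nonneg_AE) (auto simp: C_def indicator_def)
  moreover have "integrable M (\<lambda>z. indicator C z * (f z - g z))"
    using Bochner_Integration.integrable_diff[OF if' ig] by (simp add: algebra_simps)
  moreover have "AE z in M. 0 \<le> indicator C z * (f z - g z)"
    by (auto simp: C_def indicator_def intro!: AE_I2)
  ultimately have "AE z in M. indicator C z * (f z - g z) = 0"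
    using integral_nonneg_eq_0_iff_AE[of M "\<lambda>z. indicator C z * (f z - g z)"] by linarith
  then show ?thesis
    using AE_space
  proof eventually_elim
    case (elim z)
    then show ?case by (cases "g z < f z") (auto simp: C_def)
  qed
qed

text \<open>Up to null sets a point of \<open>N\<close> is the pair of its image in \<open>Z\<close>
  and its label. In these terms the extension becomes a family of weights \<open>v k z\<close> on
  labels and a cocycle \<open>c\<close> that moves labels.\<close>

locale labelled_extension =
  fixes G :: "'g monoid" (structure) and N :: "'y measure" and b and Z :: "'z measure" and a
    and \<phi> :: "'y \<Rightarrow> 'z" and l :: "'y \<Rightarrow> nat"
  assumes factor: "factor_map G N b Z a \<phi>" and countable_G: "countable (carrier G)"
    and label: "l \<in> N \<rightarrow>\<^sub>M count_space UNIV"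
    and label_generates:
      "A \<in> sets N \<Longrightarrow> \<exists>C. (\<forall>k. C k \<in> sets Z) \<and> (AE y in N. y \<in> A \<longleftrightarrow> \<phi> y \<in> C (l y))"
begin

lemma N: "pmp_action G N b" and Z: "pmp_action G Z a"
  and proj[measurable]: "\<phi> \<in> N \<rightarrow>\<^sub>M Z" and distr_proj: "distr N Z \<phi> = Z"
  and equivariant: "g \<in> carrier G \<Longrightarrow> AE y in N. \<phi> (b g y) = a g (\<phi> y)"
  using factor by (auto simp: factor_map_def measure_preserving_map_def)

sublocale G: group G using Z by (rule pmp_action_facts)
sublocale N: prob_space N using N by (rule pmp_action_facts)
sublocale Z: prob_space Z using Z by (rule pmp_action_facts)

lemmas N_facts = pmp_action_facts[OF N] and Z_facts = pmp_action_facts[OF Z]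

declare label[measurable]

lemma AE_act_N: "g \<in> carrier G \<Longrightarrow> AE y in N. P y \<Longrightarrow> AE y in N. P (b g y)"
  by (subst (asm) N_facts(4)[symmetric]) (auto intro: AE_distrD[OF N_facts(3)])

lemma AE_act_Z: "g \<in> carrier G \<Longrightarrow> AE z in Z. P z \<Longrightarrow> AE z in Z. P (a g z)"
  by (subst (asm) Z_facts(4)[symmetric]) (auto intro: AE_distrD[OF Z_facts(3)])

section \<open>Fibre weights of the labels\<close>

definition cell :: "nat \<Rightarrow> 'z set \<Rightarrow> 'y set" where
  "cell k C = {y \<in> space N. l y = k \<and> \<phi> y \<in> C}"

lemma cell_sets[measurable]: "C \<in> sets Z \<Longrightarrow> cell k C \<in> sets N"
proof -
  assume [measurable]: "C \<in> sets Z"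
  show ?thesis unfolding cell_def by measurable
qed

text \<open>Each level set of \<open>f\<close> is decided by label and base point. Off a null set
  exactly one n passes its test, and \<open>LEAST\<close> finds it measurably.\<close>

lemma function_of_label:
  fixes f :: "'y \<Rightarrow> nat"
  assumes [measurable]: "f \<in> N \<rightarrow>\<^sub>M count_space UNIV"
  shows "\<exists>F. (\<forall>k. F k \<in> Z \<rightarrow>\<^sub>M count_space UNIV) \<and> (AE y in N. f y = F (l y) (\<phi> y))"
proof -
  have "\<forall>n. \<exists>C. (\<forall>k. C k \<in> sets Z) \<and> (AE y in N. y \<in> {y \<in> space N. f y = n} \<longleftrightarrow> \<phi> y \<in> C (l y))"
    by (intro allI label_generates) measurable
  from choice[OF this] obtain C
    where C: "\<forall>n. (\<forall>k. C n k \<in> sets Z) \<and>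
      (AE y in N. y \<in> {y \<in> space N. f y = n} \<longleftrightarrow> \<phi> y \<in> C n (l y))" ..
  have Cm[measurable]: "C n k \<in> sets Z" for n k using C by simp
  have fC: "AE y in N. y \<in> {y \<in> space N. f y = n} \<longleftrightarrow> \<phi> y \<in> C n (l y)" for n using C by simp
  show ?thesis
  proof (intro exI[of _ "\<lambda>k z. LEAST n. z \<in> C n k"] conjI allI)
    show "(\<lambda>z. LEAST n. z \<in> C n k) \<in> Z \<rightarrow>\<^sub>M count_space UNIV" for k by measurable
    have "AE y in N. \<forall>n. y \<in> {y \<in> space N. f y = n} \<longleftrightarrow> \<phi> y \<in> C n (l y)"
      unfolding AE_all_countable using fC by blast
    then show "AE y in N. f y = (LEAST n. \<phi> y \<in> C n (l y))"
      using AE_space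
    proof eventually_elim
      case (elim y)
      then have "\<phi> y \<in> C n (l y) \<longleftrightarrow> f y = n" for n by blast
      then show ?case by (simp add: Least_equality)
    qed
  qed
qed

text \<open>\<open>v k\<close> is the conditional measure of the k-th label class. The densities
  \<open>u k\<close> have sum at most 1 only almost everywhere; putting them to 0 at the exceptional
  points gives bounds at every point, which later make the sets \<open>E D z\<close> finite for all
  z.\<close>

lemma weights_exist:
  "\<exists>v :: nat \<Rightarrow> 'z \<Rightarrow> real. (\<forall>k. v k \<in> borel_measurable Z) \<and> (\<forall>k z. 0 \<le> v k z) \<and>
     (\<forall>z. summable (\<lambda>k. v k z) \<and> (\<Sum>k. v k z) \<le> 1) \<and> (AE z in Z. (\<Sum>k. v k z) = 1) \<and>
     (\<forall>k. \<forall>C\<in>sets Z. measure N (cell k C) = (\<integral>z. indicator C z * v k z \<partial>Z))"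
proof -
  have "\<exists>u :: 'z \<Rightarrow> real. u \<in> borel_measurable Z \<and> (\<forall>z. 0 \<le> u z) \<and> (\<forall>z. u z \<le> 1) \<and>
    (\<forall>C\<in>sets Z. measure N (cell k C) = (\<integral>z. indicator C z * u z \<partial>Z))" for k
  proof -
    have s: "{y \<in> space N. l y = k} \<in> sets N" by measurable
    have eq: "cell k C = {y \<in> space N. l y = k} \<inter> \<phi> -` C" for C by (auto simp: cell_def)
    show ?thesis
      unfolding eq by (rule conditional_measure[OF N.prob_space_axioms proj distr_proj s]) blast
  qed
  then obtain u :: "nat \<Rightarrow> 'z \<Rightarrow> real" where um[measurable]: "\<And>k. u k \<in> borel_measurable Z"
    and u01: "\<And>k z. 0 \<le> u k z" "\<And>k z. u k z \<le> 1"
    and u: "\<And>k C. C \<in> sets Z \<Longrightarrow> measure N (cell k C) = (\<integral>z. indicator C z * u k z \<partial>Z)"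
    by metis
  have ui[simp]: "integrable Z (u k)" for k using u01 by (intro Z.integrable_unit_interval) auto
  have ui'[simp]: "integrable Z (\<lambda>z. indicator C z * u k z)" if "C \<in> sets Z" for k C
    using integrable_mult_indicator[OF that ui] by simp
  have "AE z in Z. (\<Sum>k<n. u k z) \<le> 1" for n
  proof (rule AE_le_of_integral_le)
    fix C assume C[measurable]: "C \<in> sets Z"
    have "(\<integral>z. indicator C z * (\<Sum>k<n. u k z) \<partial>Z) = (\<integral>z. (\<Sum>k<n. indicator C z * u k z) \<partial>Z)"
      by (simp only: sum_distrib_left)
    also have "\<dots> = (\<Sum>k<n. measure N (cell k C))"
      unfolding u[OF C] by (rule Bochner_Integration.integral_sum) (rule ui'[OF C])
    also have "\<dots> = measure N (\<Union>k<n. cell k C)"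
      by (rule N.finite_measure_finite_Union[symmetric]) (auto simp: disjoint_family_on_def cell_def)
    also have "\<dots> \<le> measure N (\<phi> -` C \<inter> space N)"
      by (rule N.finite_measure_mono) (auto simp: cell_def)
    also have "\<dots> = measure Z C" using measure_distr[OF proj C] distr_proj by simp
    finally show "(\<integral>z. indicator C z * (\<Sum>k<n. u k z) \<partial>Z) \<le> (\<integral>z. indicator C z * 1 \<partial>Z)" by simp
  qed auto
  then have le1: "AE z in Z. \<forall>n. (\<Sum>k<n. u k z) \<le> 1" unfolding AE_all_countable by blast
  define v where "v k z = (if \<forall>n. (\<Sum>k<n. u k z) \<le> 1 then u k z else 0)" for k z
  have vm[measurable]: "v k \<in> borel_measurable Z" for k unfolding v_def by measurable
  have v0: "0 \<le> v k z" for k z by (simp add: v_def u01)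
  have vs: "(\<Sum>k<n. v k z) \<le> 1" for n z
  proof (cases "\<forall>n. (\<Sum>k<n. u k z) \<le> 1")
    case True
    then have "v k z = u k z" for k unfolding v_def by (rule if_P)
    then show ?thesis using True by simp
  next
    case False
    then have "v k z = 0" for k unfolding v_def by (rule if_not_P)
    then show ?thesis by simp
  qed
  have v1: "v k z \<le> 1" for k z by (simp add: v_def u01)
  have summ: "summable (\<lambda>k. v k z)" for z
    by (rule summableI_nonneg_bounded[OF v0 vs])
  have vu: "AE z in Z. \<forall>k. v k z = u k z" using le1 by eventually_elim (simp add: v_def)
  have meas: "measure N (cell k C) = (\<integral>z. indicator C z * v k z \<partial>Z)" if [measurable]: "C \<in> sets Z" for k C
    unfolding u[OF that] by (rule integral_cong_AE) (use vu in \<open>auto elim!: eventually_mono\<close>)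
  have suminf1: "(\<Sum>k. v k z) \<le> 1" for z by (rule suminf_le_const[OF summ vs])
  have vi: "integrable Z (v k)" for k using v0 v1 by (intro Z.integrable_unit_interval) auto
  \<comment> \<open>The cells over all of \<open>Z\<close> partition \<open>N\<close>, so the sum of
    the weights has integral 1. Being at most 1 everywhere, it equals 1 almost everywhere.\<close>
  have "(\<lambda>k. measure N (cell k (space Z))) sums measure N (\<Union>k. cell k (space Z))"
    by (rule N.finite_measure_UNION) (auto simp: disjoint_family_on_def cell_def)
  also have "(\<Union>k. cell k (space Z)) = space N" using measurable_space[OF proj] by (auto simp: cell_def)
  finally have "(\<lambda>k. \<integral>z. v k z \<partial>Z) sums 1"
    by (simp add: meas N.prob_space cong: Bochner_Integration.integral_cong)
  then have "summable (\<lambda>k. \<integral>z. v k z \<partial>Z)" "(\<Sum>k. \<integral>z. v k z \<partial>Z) = 1" by (auto simp: sums_iff)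
  then have "(\<integral>z. (\<Sum>k. v k z) \<partial>Z) = 1"
    using integral_suminf[of Z v] vi summ v0 by simp
  moreover have si: "integrable Z (\<lambda>z. \<Sum>k. v k z)"
    by (rule Z.integrable_unit_interval) (auto simp: suminf1 suminf_nonneg[OF summ v0])
  ultimately have "(\<integral>z. 1 - (\<Sum>k. v k z) \<partial>Z) = 0" by (simp add: Z.prob_space)
  then have "AE z in Z. 1 - (\<Sum>k. v k z) = 0"
    using si suminf1 by (subst (asm) integral_nonneg_eq_0_iff_AE) auto
  then have "AE z in Z. (\<Sum>k. v k z) = 1" by eventually_elim simp
  then show ?thesis
    by (intro exI[of _ v] conjI allI ballI vm v0 summ suminf1 meas)
qed

definition v :: "nat \<Rightarrow> 'z \<Rightarrow> real" where
  "v = (SOME v. (\<forall>k. v k \<in> borel_measurable Z) \<and> (\<forall>k z. 0 \<le> v k z) \<and>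
     (\<forall>z. summable (\<lambda>k. v k z) \<and> (\<Sum>k. v k z) \<le> 1) \<and> (AE z in Z. (\<Sum>k. v k z) = 1) \<and>
     (\<forall>k. \<forall>C\<in>sets Z. measure N (cell k C) = (\<integral>z. indicator C z * v k z \<partial>Z)))"

lemma v_measurable[measurable]: "v k \<in> borel_measurable Z"
  and v_nonneg: "0 \<le> v k z" and v_summable: "summable (\<lambda>k. v k z)" and v_sum_le: "(\<Sum>k. v k z) \<le> 1"
  and v_sum: "AE z in Z. (\<Sum>k. v k z) = 1"
  and measure_cell: "C \<in> sets Z \<Longrightarrow> measure N (cell k C) = (\<integral>z. indicator C z * v k z \<partial>Z)"
  using someI_ex[OF weights_exist, folded v_def] by blast+

lemma v_le_1: "v k z \<le> 1"
proof -
  have "v k z = (\<Sum>i\<in>{k}. v i z)" by simp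
  also have "\<dots> \<le> (\<Sum>i. v i z)" by (rule sum_le_suminf[OF v_summable]) (auto simp: v_nonneg)
  finally show ?thesis using v_sum_le[of z] by simp
qed

lemma v_integrable: "integrable Z (v k)"
  by (rule Z.integrable_unit_interval) (auto simp: v_nonneg v_le_1)

text \<open>A form of Fubini's theorem for pairs of label and base point: the exceptional set
  upstairs is the union of the cells over \<open>C k\<close>, and such a cell is null exactly if its
  weight vanishes almost everywhere on \<open>C k\<close>. It turns identities on \<open>N\<close>
  into identities on \<open>Z\<close> for the labels of positive weight.\<close>

lemma AE_label_iff:
  assumes "\<And>k. {z \<in> space Z. P k z} \<in> sets Z"
  shows "(AE y in N. P (l y) (\<phi> y)) \<longleftrightarrow> (AE z in Z. \<forall>k. 0 < v k z \<longrightarrow> P k z)"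
proof -
  define C where "C k = space Z - {z \<in> space Z. P k z}" for k
  have C[measurable]: "C k \<in> sets Z" for k unfolding C_def using assms by auto
  have "(AE y in N. P (l y) (\<phi> y)) \<longleftrightarrow> (AE y in N. \<forall>k. y \<notin> cell k (C k))"
    by (rule AE_cong) (use measurable_space[OF proj] in \<open>auto simp: cell_def C_def\<close>)
  also have "\<dots> \<longleftrightarrow> (\<forall>k. measure N (cell k (C k)) = 0)"
    unfolding AE_all_countable
    by (simp add: AE_iff_null_sets[symmetric] null_sets_def N.emeasure_eq_measure)
  also have "\<dots> \<longleftrightarrow> (\<forall>k. AE z in Z. z \<in> C k \<longrightarrow> v k z = 0)"
  proof (intro all_cong1)
    fix k
    have eq: "cell k (C k) = {y \<in> space N. l y = k} \<inter> \<phi> -` C k" by (auto simp: cell_def)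
    show "measure N (cell k (C k)) = 0 \<longleftrightarrow> (AE z in Z. z \<in> C k \<longrightarrow> v k z = 0)"
      unfolding eq
      by (rule conditional_measure_null[OF Z.prob_space_axioms v_measurable v_nonneg v_le_1 _ C])
         (subst eq[symmetric], rule measure_cell[OF C])
  qed
  also have "\<dots> \<longleftrightarrow> (AE z in Z. \<forall>k. 0 < v k z \<longrightarrow> P k z)"
    unfolding AE_all_countable
    by (intro all_cong1 AE_cong) (auto simp: C_def less_le v_nonneg)
  finally show ?thesis .
qed

lemma AE_labelI:
  assumes "AE y in N. P (l y) (\<phi> y)" and "\<And>k. {z \<in> space Z. P k z} \<in> sets Z"
  shows "AE z in Z. \<forall>k. 0 < v k z \<longrightarrow> P k z"
  using AE_label_iff[of P] assms by blast

section \<open>The cocycle that moves labels\<close>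

definition c :: "'g \<Rightarrow> nat \<Rightarrow> 'z \<Rightarrow> nat" where
  "c g = (SOME F. (\<forall>k. F k \<in> Z \<rightarrow>\<^sub>M count_space UNIV) \<and> (AE y in N. l (b g y) = F (l y) (\<phi> y)))"

text \<open>\<open>c g k z\<close> is the label that \<open>g\<close> gives to a point with label k
  over z. This is meaningful only where k has positive weight, which is why the identities below
  carry that condition.\<close>

lemma c_measurable: "g \<in> carrier G \<Longrightarrow> c g k \<in> Z \<rightarrow>\<^sub>M count_space UNIV"
  and label_act: "g \<in> carrier G \<Longrightarrow> AE y in N. l (b g y) = c g (l y) (\<phi> y)"
proof -
  assume [simp]: "g \<in> carrier G"
  have "(\<lambda>y. l (b g y)) \<in> N \<rightarrow>\<^sub>M count_space UNIV"
    by (rule measurable_compose[OF N_facts(3) label]) simp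
  from someI_ex[OF function_of_label[OF this], folded c_def]
  show "c g k \<in> Z \<rightarrow>\<^sub>M count_space UNIV" "AE y in N. l (b g y) = c g (l y) (\<phi> y)" by blast+
qed

lemma c_measurable':
  assumes "g \<in> carrier G" "k \<in> Z \<rightarrow>\<^sub>M count_space UNIV" "f \<in> Z \<rightarrow>\<^sub>M Z"
  shows "(\<lambda>z. c g (k z) (f z)) \<in> Z \<rightarrow>\<^sub>M count_space UNIV"
proof (rule measurable_compose_countable[where f = "\<lambda>k z. c g k (f z)" and g = k])
  show "(\<lambda>z. c g i (f z)) \<in> Z \<rightarrow>\<^sub>M count_space UNIV" for i
    by (rule measurable_compose[OF assms(3) c_measurable[OF assms(1)]])
qed fact

lemma c_mult:
  assumes g: "g \<in> carrier G" and h: "h \<in> carrier G"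
  shows "AE z in Z. \<forall>k. 0 < v k z \<longrightarrow> c (g \<otimes> h) k z = c g (c h k z) (a h z)"
proof (rule AE_labelI[where P = "\<lambda>k z. c (g \<otimes> h) k z = c g (c h k z) (a h z)"])
  show "AE y in N. c (g \<otimes> h) (l y) (\<phi> y) = c g (c h (l y) (\<phi> y)) (a h (\<phi> y))"
    using label_act[OF G.m_closed[OF g h]] AE_act_N[OF h label_act[OF g]] label_act[OF h]
      equivariant[OF h] AE_space
  proof eventually_elim
    case (elim y)
    then show ?case by (metis N_facts(7) g h)
  qed
  fix k
  show "{z \<in> space Z. c (g \<otimes> h) k z = c g (c h k z) (a h z)} \<in> sets Z"
    by (rule sets_eq_fun[OF c_measurable[OF G.m_closed[OF g h]]
        c_measurable'[OF g c_measurable[OF h] Z_facts(3)[OF h]]])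
qed

lemma c_one: "AE z in Z. \<forall>k. 0 < v k z \<longrightarrow> c \<one> k z = k"
proof (rule AE_labelI[where P = "\<lambda>k z. c \<one> k z = k"])
  show "AE y in N. c \<one> (l y) (\<phi> y) = l y"
    using label_act[OF G.one_closed] AE_space by eventually_elim (simp add: N_facts)
  show "{z \<in> space Z. c \<one> k z = k} \<in> sets Z" for k
    by (rule sets_eq_fun[OF c_measurable[OF G.one_closed]]) simp
qed

text \<open>Let \<open>S\<close> be the set where \<open>c g k\<close> has the value
  \<open>k'\<close>. The measure-preserving map \<open>b g\<close> sends the part of cell
  \<open>k\<close> over \<open>S\<close> into cell \<open>k'\<close>, so comparing masses over
  arbitrary subsets of \<open>S\<close> compares the weights. At first this gives only an
  inequality, since several labels might be sent to the same one.\<close>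

lemma v_c_le:
  assumes g: "g \<in> carrier G"
  shows "AE z in Z. \<forall>k. v k z \<le> v (c g k z) (a g z)"
  unfolding AE_all_countable
proof
  fix k
  note [measurable] = Z_facts(3)[OF g] c_measurable[OF g] N_facts(3)[OF g]
  have "AE z in Z. indicator {z \<in> space Z. c g k z = k'} z * v k z \<le>
      indicator {z \<in> space Z. c g k z = k'} z * v k' (a g z)" for k'
  proof (rule AE_le_of_integral_le)
    define S where "S = {z \<in> space Z. c g k z = k'}"
    have S[measurable]: "S \<in> sets Z" unfolding S_def by measurable
    show "integrable Z (\<lambda>z. indicator {z \<in> space Z. c g k z = k'} z * v k z)"
      "integrable Z (\<lambda>z. indicator {z \<in> space Z. c g k z = k'} z * v k' (a g z))"
      by (rule Z.integrable_unit_interval; simp add: v_nonneg v_le_1 indicator_def)+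
    fix C assume C[measurable]: "C \<in> sets Z"
    \<comment> \<open>The translate of C \<inter> S by \<open>g\<close>, written as a preimage under
      \<open>inv g\<close> so that measurability is immediate.\<close>
    define C' where "C' = (\<lambda>z. a (inv g) z) -` (C \<inter> S) \<inter> space Z"
    have C'[measurable]: "C' \<in> sets Z"
      unfolding C'_def by (intro measurable_sets[OF Z_facts(3)]) (use g in auto)
    have C'g: "a g z \<in> C' \<longleftrightarrow> z \<in> C \<inter> S" if "z \<in> space Z" for z
      using that g by (simp add: C'_def Z_facts(5,6) flip: Z_facts(7))
    have "(\<integral>z. indicator C z * (indicator S z * v k z) \<partial>Z) = measure N (cell k (C \<inter> S))"
      by (subst measure_cell) (auto simp: indicator_inter_arith mult.assoc)
    also have "\<dots> \<le> measure N ((b g) -` cell k' C' \<inter> space N)"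
    proof (rule N.finite_measure_mono_AE)
      show "AE y in N. y \<in> cell k (C \<inter> S) \<longrightarrow> y \<in> (b g) -` cell k' C' \<inter> space N"
        using label_act[OF g] equivariant[OF g] AE_space
      proof eventually_elim
        case (elim y)
        then show ?case
          using C'g[of "\<phi> y"] measurable_space[OF proj] g by (auto simp: cell_def S_def N_facts(5))
      qed
    qed measurable
    also have "\<dots> = measure (distr N N (b g)) (cell k' C')" by (subst measure_distr) auto
    also have "\<dots> = (\<integral>z. indicator C' z * v k' z \<partial>Z)" using N_facts(4)[OF g] by (simp add: measure_cell)
    also have "\<dots> = (\<integral>z. indicator C' z * v k' z \<partial>distr Z Z (a g))" using Z_facts(4)[OF g] by simp
    also have "\<dots> = (\<integral>z. indicator C' (a g z) * v k' (a g z) \<partial>Z)" by (rule integral_distr) auto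
    also have "\<dots> = (\<integral>z. indicator C z * (indicator S z * v k' (a g z)) \<partial>Z)"
      by (rule Bochner_Integration.integral_cong) (auto simp: C'g indicator_def)
    finally show "(\<integral>z. indicator C z * (indicator {z \<in> space Z. c g k z = k'} z * v k z) \<partial>Z) \<le>
        (\<integral>z. indicator C z * (indicator {z \<in> space Z. c g k z = k'} z * v k' (a g z)) \<partial>Z)"
      by (simp add: S_def)
  qed
  then have "AE z in Z. \<forall>k'. indicator {z \<in> space Z. c g k z = k'} z * v k z \<le>
      indicator {z \<in> space Z. c g k z = k'} z * v k' (a g z)"
    unfolding AE_all_countable by blast
  then show "AE z in Z. v k z \<le> v (c g k z) (a g z)"
    using AE_space
  proof eventually_elim
    case (elim z)
    from elim(1)[rule_format, of "c g k z"] elim(2) show ?case by simp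
  qed
qed

text \<open>The weights can only grow along the action of \<open>g\<close>; applying this to \<open>g\<inverse>\<close> as well gives equality.\<close>

lemma v_c:
  assumes g: "g \<in> carrier G"
  shows "AE z in Z. \<forall>k. 0 < v k z \<longrightarrow> v (c g k z) (a g z) = v k z"
proof -
  have i: "inv g \<in> carrier G" using g by simp
  show ?thesis
    using v_c_le[OF g] AE_act_Z[OF g v_c_le[OF i]] c_mult[OF i g] c_one AE_space
  proof eventually_elim
    case (elim z)
    show ?case
    proof (intro allI impI)
      fix k assume k: "0 < v k z"
      have "v (c g k z) (a g z) \<le> v (c (inv g) (c g k z) (a g z)) (a (inv g) (a g z))"
        using elim(2) by blast
      also have "a (inv g) (a g z) = z" using g elim(5) by (simp add: Z_facts(5,6) flip: Z_facts(7))
      also have "c (inv g) (c g k z) (a g z) = k" using elim(3,4) k g by simp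
      finally show "v (c g k z) (a g z) = v k z" using elim(1)[rule_format, of k] by linarith
    qed
  qed
qed

text \<open>Collects the almost-everywhere identities into a condition on a single point, so that
  the fibrewise arguments become exact. Countability of the group allows \<open>AE_good\<close> to
  demand it along a whole orbit.\<close>

definition good :: "'z \<Rightarrow> bool" where
  "good z \<longleftrightarrow> z \<in> space Z \<and> (\<forall>k. 0 < v k z \<longrightarrow> c \<one> k z = k) \<and>
     (\<forall>g\<in>carrier G. (\<forall>k. 0 < v k z \<longrightarrow> v (c g k z) (a g z) = v k z) \<and>
        (\<forall>h\<in>carrier G. \<forall>k. 0 < v k z \<longrightarrow> c (h \<otimes> g) k z = c h (c g k z) (a g z)))"

lemma AE_good: "AE z in Z. \<forall>g\<in>carrier G. good (a g z)"
proof -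
  have "AE z in Z. \<forall>g\<in>carrier G. (\<forall>k. 0 < v k z \<longrightarrow> v (c g k z) (a g z) = v k z) \<and>
        (\<forall>h\<in>carrier G. \<forall>k. 0 < v k z \<longrightarrow> c (h \<otimes> g) k z = c h (c g k z) (a g z))"
    by (intro AE_ball_countable' AE_conjI countable_G v_c c_mult)
  with c_one AE_space have "AE z in Z. good z"
    unfolding good_def by eventually_elim blast
  then show ?thesis
    by (intro AE_ball_countable' countable_G AE_act_Z)
qed

text \<open>
  \<open>E D z\<close> lists the labels over \<open>z\<close>, each repeated in proportion to its weight, so that the
  extension is close to a uniform \<open>D\<close>-to-one one.
\<close>

definition E :: "nat \<Rightarrow> 'z \<Rightarrow> (nat \<times> nat) set" where
  "E D z = {(k, i). i < nat \<lfloor>real D * v k z\<rfloor>}"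

lemma E_iff: "(k, i) \<in> E D z \<longleftrightarrow> i < nat \<lfloor>real D * v k z\<rfloor>"
  by (simp add: E_def)

text \<open>Listed labels are therefore among those for which \<open>good\<close> provides its
  identities.\<close>

lemma E_pos: "(k, i) \<in> E D z \<Longrightarrow> 0 < v k z"
  by (rule ccontr) (use v_nonneg[of k z] in \<open>simp add: E_iff not_less\<close>)

lemma multiplicity_le: "real (nat \<lfloor>real D * v k z\<rfloor>) \<le> real D * v k z"
  using v_nonneg[of k z] by (simp add: of_nat_nat)

text \<open>A label is listed at most D times its weight, and the weights sum to at most 1. Bounding
  every finite subset yields finiteness and the cardinality bound together.\<close>

lemma finite_E: "finite (E D z)" and card_E_le: "card (E D z) \<le> D"
proof -
  have "finite (E D z) \<and> card (E D z) \<le> D"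
  proof (rule finite_if_finite_subsets_card_bdd)
    fix S assume S: "S \<subseteq> E D z" "finite S"
    have "S \<subseteq> Sigma (fst ` S) (\<lambda>k. {..<nat \<lfloor>real D * v k z\<rfloor>})" using S(1) by (force simp: E_iff)
    then have "card S \<le> card (Sigma (fst ` S) (\<lambda>k. {..<nat \<lfloor>real D * v k z\<rfloor>}))"
      using S(2) by (intro card_mono) auto
    also have "\<dots> = (\<Sum>k\<in>fst ` S. nat \<lfloor>real D * v k z\<rfloor>)" using S(2) by simp
    finally have "real (card S) \<le> (\<Sum>k\<in>fst ` S. real (nat \<lfloor>real D * v k z\<rfloor>))"
      by (metis of_nat_le_iff of_nat_sum)
    also have "\<dots> \<le> real D * (\<Sum>k\<in>fst ` S. v k z)"
      unfolding sum_distrib_left by (intro sum_mono multiplicity_le)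
    also have "(\<Sum>k\<in>fst ` S. v k z) \<le> (\<Sum>k. v k z)"
      by (rule sum_le_suminf[OF v_summable]) (use S(2) v_nonneg in auto)
    also have "real D * (\<Sum>k. v k z) \<le> real D * 1" by (intro mult_left_mono v_sum_le) simp
    finally show "card S \<le> D" by (simp add: mult_left_mono)
  qed
  then show "finite (E D z)" "card (E D z) \<le> D" by blast+
qed

lemma E_sums: "(\<lambda>k. real (nat \<lfloor>real D * v k z\<rfloor>) * of_bool (R k)) sums card {e \<in> E D z. R (fst e)}"
proof -
  let ?n = "\<lambda>k. nat \<lfloor>real D * v k z\<rfloor>"
  have "{e \<in> E D z. R (fst e)} = Sigma {k \<in> fst ` E D z. R k} (\<lambda>k. {..<?n k})"
    by (force simp: E_iff)
  then have "real (card {e \<in> E D z. R (fst e)}) = (\<Sum>k\<in>{k \<in> fst ` E D z. R k}. real (?n k))"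
    using finite_E[of D z] by simp
  also have "\<dots> = (\<Sum>k\<in>fst ` E D z. real (?n k) * of_bool (R k))"
    using finite_E[of D z] by (intro sum.mono_neutral_cong_left) auto
  finally have eq: "real (card {e \<in> E D z. R (fst e)}) = (\<Sum>k\<in>fst ` E D z. real (?n k) * of_bool (R k))" .
  show ?thesis
    unfolding eq
  proof (rule sums_finite)
    show "finite (fst ` E D z)" using finite_E by simp
    fix k assume "k \<notin> fst ` E D z"
    then have "(k, 0) \<notin> E D z" by force
    then show "real (?n k) * of_bool (R k) = 0" by (simp add: E_iff)
  qed
qed

lemma E_measurable: "E D \<in> Z \<rightarrow>\<^sub>M count_space {S. finite S}"
proof (subst measurable_count_space_eq_countable[OF countable_Collect_finite], intro conjI ballI)
  show "E D \<in> space Z \<rightarrow> {S. finite S}" using finite_E by blast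
  fix S :: "(nat \<times> nat) set" assume "S \<in> {S. finite S}"
  have "E D -` {S} \<inter> space Z = {z \<in> space Z. \<forall>k i. (k, i) \<in> S \<longleftrightarrow> i < nat \<lfloor>real D * v k z\<rfloor>}"
    by (auto simp: E_def)
  also have "\<dots> \<in> sets Z" by measurable
  finally show "E D -` {S} \<inter> space Z \<in> sets Z" .
qed

section \<open>From labels to a cocycle of permutations of D sheets\<close>

definition \<Theta> :: "'g \<Rightarrow> 'z \<Rightarrow> nat \<times> nat \<Rightarrow> nat \<times> nat" where
  "\<Theta> g z e = (c g (fst e) z, snd e)"

text \<open>Keeping the copy number is legitimate because the weight of a label, and hence its
  multiplicity, is unchanged along the action.\<close>

lemma \<Theta>_in:
  assumes "good z" "g \<in> carrier G" "e \<in> E D z"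
  shows "\<Theta> g z e \<in> E D (a g z)"
  using assms E_pos[of "fst e" "snd e" D z] by (cases e) (auto simp: \<Theta>_def E_iff good_def)

lemma \<Theta>_mult:
  assumes "good z" "g \<in> carrier G" "h \<in> carrier G" "e \<in> E D z"
  shows "\<Theta> (h \<otimes> g) z e = \<Theta> h (a g z) (\<Theta> g z e)"
  using assms E_pos[of "fst e" "snd e" D z] by (cases e) (auto simp: \<Theta>_def good_def)

lemma \<Theta>_one: "good z \<Longrightarrow> e \<in> E D z \<Longrightarrow> \<Theta> \<one> z e = e"
  using E_pos[of "fst e" "snd e" D z] by (cases e) (auto simp: \<Theta>_def good_def)

lemma act_inv:
  assumes "g \<in> carrier G" "z \<in> space Z"
  shows "a (inv g) (a g z) = z" "a g (a (inv g) z) = z"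
  using assms by (simp_all add: Z_facts(6) flip: Z_facts(7))

lemma \<Theta>_bij:
  assumes z: "good z" "good (a g z)" and g: "g \<in> carrier G"
  shows "bij_betw (\<Theta> g z) (E D z) (E D (a g z))"
proof (rule bij_betw_byWitness[where f' = "\<Theta> (inv g) (a g z)"])
  have i: "inv g \<in> carrier G" and zs: "z \<in> space Z" using g z by (auto simp: good_def)
  show "\<forall>e\<in>E D z. \<Theta> (inv g) (a g z) (\<Theta> g z e) = e"
    using z g i by (simp add: \<Theta>_one flip: \<Theta>_mult)
  show "\<forall>e\<in>E D (a g z). \<Theta> g z (\<Theta> (inv g) (a g z) e) = e"
    using \<Theta>_mult[OF z(2) i g] z g i act_inv (1)[OF g zs] by (simp add: \<Theta>_one)
  show "\<Theta> g z ` E D z \<subseteq> E D (a g z)" using \<Theta>_in z g by blast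
  show "\<Theta> (inv g) (a g z) ` E D (a g z) \<subseteq> E D z"
    using \<Theta>_in[OF z(2) i] act_inv (1)[OF g zs] by auto
qed

definition sheet_map :: "nat \<Rightarrow> 'g \<Rightarrow> 'z \<Rightarrow> nat \<Rightarrow> nat" where
  "sheet_map D g z j =
     (if j < card (E D z) then to_nat_on (E D (a g z)) (\<Theta> g z (from_nat_into (E D z) j)) else j)"

text \<open>Off the good points \<open>sheet_map\<close> may fail to be a permutation; the identity
  takes its place there, because \<open>permutation_cocycle\<close> wants values in
  \<open>perms D\<close> at every point.\<close>

definition sheet :: "nat \<Rightarrow> 'g \<Rightarrow> 'z \<Rightarrow> nat \<Rightarrow> nat" where
  "sheet D g z = (if sheet_map D g z permutes {..<D} then sheet_map D g z else id)"

lemma sheet_permutes: "sheet D g z permutes {..<D}"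
  by (simp add: sheet_def permutes_id)

lemma from_nat_into_E: "j < card (E D z) \<Longrightarrow> from_nat_into (E D z) j \<in> E D z"
  using bij_betw_from_nat_into_finite[OF finite_E, of D z] by (auto simp: bij_betw_def)

lemma sheet_map_permutes:
  assumes z: "good z" "good (a g z)" and g: "g \<in> carrier G"
  shows "sheet_map D g z permutes {..<D}"
proof (rule permutes_subset)
  have ceq: "card (E D (a g z)) = card (E D z)" using bij_betw_same_card[OF \<Theta>_bij[OF assms]] by simp
  have "bij_betw (to_nat_on (E D (a g z)) \<circ> (\<Theta> g z \<circ> from_nat_into (E D z))) {..<card (E D z)} {..<card (E D z)}"
    using to_nat_on_finite[OF finite_E, of D "a g z"] unfolding ceq
    by (intro bij_betw_trans[OF bij_betw_trans[OF bij_betw_from_nat_into_finite[OF finite_E] \<Theta>_bij[OF assms]]])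
  then have "bij_betw (sheet_map D g z) {..<card (E D z)} {..<card (E D z)}"
    by (rule bij_betw_cong[THEN iffD1, rotated]) (simp add: sheet_map_def)
  then show "sheet_map D g z permutes {..<card (E D z)}"
    by (rule bij_imp_permutes) (simp add: sheet_map_def)
  show "{..<card (E D z)} \<subseteq> {..<D}" using card_E_le[of D z] by auto
qed

lemma sheet_eq:
  assumes "good z" "good (a g z)" "g \<in> carrier G"
  shows "sheet D g z = sheet_map D g z"
  using sheet_map_permutes[OF assms] by (simp add: sheet_def)

lemma from_nat_into_sheet:
  assumes "good z" "good (a g z)" "g \<in> carrier G" "j < card (E D z)"
  shows "from_nat_into (E D (a g z)) (sheet D g z j) = \<Theta> g z (from_nat_into (E D z) j)"
    and "sheet D g z j < card (E D (a g z))"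
proof -
  have in_E: "\<Theta> g z (from_nat_into (E D z) j) \<in> E D (a g z)"
    by (intro \<Theta>_in from_nat_into_E assms)
  then show "from_nat_into (E D (a g z)) (sheet D g z j) = \<Theta> g z (from_nat_into (E D z) j)"
    unfolding sheet_eq[OF assms(1-3)] using assms(4)
    by (simp add: sheet_map_def countable_finite finite_E)
  show "sheet D g z j < card (E D (a g z))"
    unfolding sheet_eq[OF assms(1-3)] using assms(4) in_E bij_betwE[OF to_nat_on_finite[OF finite_E]]
    by (fastforce simp: sheet_map_def)
qed

lemma sheet_mult:
  assumes good: "\<forall>g\<in>carrier G. good (a g z)" and g: "g \<in> carrier G" and h: "h \<in> carrier G"
    and z: "z \<in> space Z"
  shows "sheet D (g \<otimes> h) z = sheet D g (a h z) \<circ> sheet D h z"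
proof
  fix j
  have gz: "good z" using good z Z_facts(6) by (metis G.one_closed)
  have ghz: "a (g \<otimes> h) z = a g (a h z)" using Z_facts(7) g h z by blast
  have ggh: "good (a h z)" "good (a g (a h z))" using good g h ghz by (auto simp flip: ghz)
  note eqs = sheet_eq[OF gz ggh(1) h] sheet_eq[OF ggh g]
    sheet_eq[OF gz _ G.m_closed[OF g h], unfolded ghz, OF ggh(2)]
  have ceq: "card (E D (a h z)) = card (E D z)"
    using bij_betw_same_card[OF \<Theta>_bij[OF gz ggh(1) h]] by simp
  show "sheet D (g \<otimes> h) z j = (sheet D g (a h z) \<circ> sheet D h z) j"
  proof (cases "j < card (E D z)")
    case True
    then have "sheet D (g \<otimes> h) z j =
        to_nat_on (E D (a g (a h z))) (\<Theta> g (a h z) (\<Theta> h z (from_nat_into (E D z) j)))"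
      by (simp add: eqs(3) sheet_map_def ghz \<Theta>_mult[OF gz h g from_nat_into_E])
    also have "\<dots> = sheet D g (a h z) (sheet D h z j)"
      using from_nat_into_sheet[OF gz ggh(1) h True]
      by (subst eqs(2)) (simp add: sheet_map_def)
    finally show ?thesis by simp
  next
    case False
    then show ?thesis by (simp add: eqs sheet_map_def ceq)
  qed
qed

text \<open>The sets over z and over its translate take countably many values. With both fixed, the
  only remaining dependence on z is through \<open>c g\<close>.\<close>

lemma sheet_measurable:
  assumes g: "g \<in> carrier G"
  shows "sheet D g \<in> Z \<rightarrow>\<^sub>M perms D"
proof -
  have fin: "finite {\<pi>. \<pi> permutes {..<D}}" by (rule finite_permutations) simp
  note Eg = measurable_compose[OF Z_facts(3)[OF g] E_measurable]
  have "(\<lambda>z. if j < card (E D z) then to_nat_on (E D (a g z)) (\<Theta> g z (from_nat_into (E D z) j)) else j)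
      \<in> Z \<rightarrow>\<^sub>M count_space UNIV" for j
  proof (rule measurable_compose_countable'[where g = "E D" and I = "{S. finite S}" and
        f = "\<lambda>S z. if j < card S then to_nat_on (E D (a g z)) (\<Theta> g z (from_nat_into S j)) else j"])
    fix S :: "(nat \<times> nat) set"
    have "(\<lambda>z. to_nat_on (E D (a g z)) (\<Theta> g z (from_nat_into S j))) \<in> Z \<rightarrow>\<^sub>M count_space UNIV"
    proof (rule measurable_compose_countable'[where g = "\<lambda>z. E D (a g z)" and I = "{S. finite S}" and
          f = "\<lambda>S' z. to_nat_on S' (\<Theta> g z (from_nat_into S j))"])
      fix S'
      show "(\<lambda>z. to_nat_on S' (\<Theta> g z (from_nat_into S j))) \<in> Z \<rightarrow>\<^sub>M count_space UNIV"
        unfolding \<Theta>_def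
        by (rule measurable_compose[OF c_measurable[OF g], where g = "\<lambda>k. to_nat_on S' (k, _)"]) simp
    qed (rule Eg countable_Collect_finite)+
    then show "(\<lambda>z. if j < card S then to_nat_on (E D (a g z)) (\<Theta> g z (from_nat_into S j)) else j)
      \<in> Z \<rightarrow>\<^sub>M count_space UNIV" by (cases "j < card S") simp_all
  qed (rule E_measurable countable_Collect_finite)+
  then have m: "(\<lambda>z. sheet_map D g z j) \<in> Z \<rightarrow>\<^sub>M count_space UNIV" for j
    unfolding sheet_map_def .
  have eq_iff: "sheet_map D g z = \<pi> \<longleftrightarrow> (\<forall>j\<in>{..<D}. sheet_map D g z j = \<pi> j)" if "\<pi> permutes {..<D}" for \<pi> z
  proof
    assume *: "\<forall>j\<in>{..<D}. sheet_map D g z j = \<pi> j"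
    show "sheet_map D g z = \<pi>"
    proof
      fix j show "sheet_map D g z j = \<pi> j"
        using * card_E_le[of D z] permutes_not_in[OF that, of j] by (cases "j < D") (auto simp: sheet_map_def)
    qed
  qed simp
  have s: "{z \<in> space Z. sheet_map D g z = \<pi>} \<in> sets Z" if "\<pi> permutes {..<D}" for \<pi>
  proof -
    have "{z \<in> space Z. sheet_map D g z j = \<pi> j} \<in> sets Z" for j
      by (rule sets_eq_fun[OF m]) simp
    then have "{z \<in> space Z. \<forall>j\<in>{..<D}. sheet_map D g z j = \<pi> j} \<in> sets Z"
      by (intro sets.sets_Collect_finite_All) auto
    then show ?thesis unfolding eq_iff[OF that] .
  qed
  have p: "{z \<in> space Z. sheet_map D g z permutes {..<D}} \<in> sets Z"
  proof -
    have "{z \<in> space Z. sheet_map D g z permutes {..<D}} =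
        (\<Union>\<pi>\<in>{\<pi>. \<pi> permutes {..<D}}. {z \<in> space Z. sheet_map D g z = \<pi>})" by auto
    also have "\<dots> \<in> sets Z" by (rule sets.finite_UN[OF fin]) (use s in blast)
    finally show ?thesis .
  qed
  show ?thesis
  proof (subst measurable_count_space_eq_countable[OF countable_finite[OF fin]], intro conjI ballI)
    show "sheet D g \<in> space Z \<rightarrow> {\<pi>. \<pi> permutes {..<D}}" using sheet_permutes by blast
    fix \<pi> assume \<pi>: "\<pi> \<in> {\<pi>. \<pi> permutes {..<D}}"
    have "sheet D g -` {\<pi>} \<inter> space Z = {z \<in> space Z. sheet_map D g z = \<pi>} \<union>
        (if \<pi> = id then space Z - {z \<in> space Z. sheet_map D g z permutes {..<D}} else {})"
      using \<pi> by (auto simp: sheet_def permutes_id)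
    also have "\<dots> \<in> sets Z" using s[of \<pi>] p \<pi> by auto
    finally show "sheet D g -` {\<pi>} \<inter> space Z \<in> sets Z" .
  qed
qed

section \<open>The error made by rounding the weights\<close>

lemma card_E_tendsto:
  assumes "(\<Sum>k. v k z) = 1"
  shows "(\<lambda>D. 1 - real (card (E D z)) / real D) \<longlonglongrightarrow> 0"
proof (rule LIMSEQ_I)
  fix r :: real assume r: "0 < r"
  have "(\<lambda>K. \<Sum>k<K. v k z) \<longlonglongrightarrow> 1" using summable_LIMSEQ[OF v_summable, of z] assms by simp
  then have "\<forall>\<^sub>F K in sequentially. 1 - r / 2 < (\<Sum>k<K. v k z)" using r by (intro order_tendstoD) auto
  \<comment> \<open>Finitely many labels carry more than 1 - r/2 of the weight. Rounding down loses
    at most 1 on each of these K labels, which is less than r/2 of D once D is large.\<close>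
  then obtain K where K: "1 - r / 2 < (\<Sum>k<K. v k z)" by (auto simp: eventually_sequentially)
  obtain D0 :: nat where D0: "real K / (r / 2) < real D0" using reals_Archimedean2 by blast
  show "\<exists>D0. \<forall>D\<ge>D0. norm (1 - real (card (E D z)) / real D - 0) < r"
  proof (intro exI allI impI)
    fix D assume "D0 + 1 \<le> D"
    then have D: "real K / (r / 2) < real D" "0 < real D" using D0 by auto
    have "(\<lambda>k. real (nat \<lfloor>real D * v k z\<rfloor>) * of_bool True) sums card {e \<in> E D z. True}" by (rule E_sums)
    then have sums: "(\<lambda>k. real (nat \<lfloor>real D * v k z\<rfloor>)) sums card (E D z)" by simp
    have "real D * (\<Sum>k<K. v k z) - real K = (\<Sum>k<K. real D * v k z - 1)"
      by (simp add: sum_distrib_left sum_subtractf)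
    also have "\<dots> \<le> (\<Sum>k<K. real (nat \<lfloor>real D * v k z\<rfloor>))"
      by (intro sum_mono) (use v_nonneg in linarith)
    also have "\<dots> \<le> real (card (E D z))"
      using sum_le_suminf[OF sums_summable[OF sums], of "{..<K}"] sums_unique[OF sums] by simp
    finally have "real D * (\<Sum>k<K. v k z) - real K \<le> real (card (E D z))" .
    moreover have "real D * (1 - r / 2) < real D * (\<Sum>k<K. v k z)"
      using K D(2) by (rule mult_strict_left_mono)
    moreover have "real K < real D * (r / 2)" using D(1) r by (simp add: field_simps)
    ultimately have "real D * (1 - r) < real (card (E D z))" by (simp add: algebra_simps)
    then have "1 - real (card (E D z)) / real D < r" using D(2) by (simp add: field_simps)
    moreover have "0 \<le> 1 - real (card (E D z)) / real D" using card_E_le[of D z] D(2) by (simp add: field_simps)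
    ultimately show "norm (1 - real (card (E D z)) / real D - 0) < r" by simp
  qed
qed

lemma card_E_measurable: "(\<lambda>z. real (card (E D z))) \<in> borel_measurable Z"
  by (rule measurable_compose[OF E_measurable]) simp

text \<open>The speed of convergence depends on z, so D is chosen to make the defect small on
  average, by dominated convergence.\<close>

lemma multiplicity_defect:
  assumes "0 < \<epsilon>"
  obtains D where "0 < D" "(\<integral>z. 1 - real (card (E D z)) / real D \<partial>Z) < \<epsilon>"
proof -
  note [measurable] = card_E_measurable
  have "(\<lambda>D. \<integral>z. 1 - real (card (E D z)) / real D \<partial>Z) \<longlonglongrightarrow> (\<integral>z. 0 \<partial>Z)"
  proof (rule integral_dominated_convergence[where w = "\<lambda>_. 1"])
    show "AE z in Z. (\<lambda>D. 1 - real (card (E D z)) / real D) \<longlonglongrightarrow> 0"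
      using v_sum by eventually_elim (rule card_E_tendsto)
    show "AE z in Z. norm (1 - real (card (E D z)) / real D) \<le> 1" for D
      using card_E_le[of D] by (intro AE_I2) (auto simp: divide_le_eq)
  qed auto
  then have "\<forall>\<^sub>F D in sequentially. (\<integral>z. 1 - real (card (E D z)) / real D \<partial>Z) < \<epsilon>"
    using assms by (intro order_tendstoD) auto
  with eventually_gt_at_top[of 0]
  have "\<forall>\<^sub>F D in sequentially. 0 < D \<and> (\<integral>z. 1 - real (card (E D z)) / real D \<partial>Z) < \<epsilon>"
    by eventually_elim blast
  then show thesis using that by (auto simp: eventually_sequentially)
qed

lemma sheet_count:
  assumes "0 < D" and sum: "(\<Sum>k. v k z) = 1"
    and Q: "\<And>j. j < card (E D z) \<Longrightarrow> Q j \<longleftrightarrow> R (fst (from_nat_into (E D z) j))"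
  shows "\<bar>(\<Sum>k. v k z * of_bool (R k)) - real (card {j. j < D \<and> Q j}) / real D\<bar>
    \<le> 1 - real (card (E D z)) / real D"
proof -
  define n where "n k = real (nat \<lfloor>real D * v k z\<rfloor>)" for k
  define L where "L = card {e \<in> E D z. R (fst e)}"
  have n_le: "n k / real D \<le> v k z" for k
    using multiplicity_le[of D k z] assms(1) by (simp add: n_def divide_le_eq mult.commute)
  have "(\<lambda>k. n k * of_bool (R k) / real D) sums (real L / real D)"
    unfolding n_def L_def by (rule sums_divide[OF E_sums])
  then have nR: "(\<lambda>k. (n k / real D) * of_bool (R k)) sums (real L / real D)" by simp
  have "(\<lambda>k. n k * of_bool True / real D) sums (real (card {e \<in> E D z. True}) / real D)"
    unfolding n_def by (rule sums_divide[OF E_sums])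
  then have n1: "(\<lambda>k. n k / real D) sums (real (card (E D z)) / real D)" by simp
  have vs: "summable (\<lambda>k. v k z * of_bool (R k))"
    by (rule summable_comparison_test_ev[OF _ v_summable[of z]])
       (auto intro!: always_eventually simp: v_nonneg)
  have lower: "real L / real D \<le> (\<Sum>k. v k z * of_bool (R k))"
    unfolding sums_unique[OF nR]
    by (rule suminf_le[OF _ sums_summable[OF nR] vs]) (auto simp: n_le)
  have "(\<Sum>k. v k z * of_bool (R k)) - real L / real D = (\<Sum>k. (v k z - n k / real D) * of_bool (R k))"
    unfolding sums_unique[OF nR] suminf_diff[OF vs sums_summable[OF nR]] by (simp add: left_diff_distrib)
  also have "\<dots> \<le> (\<Sum>k. v k z - n k / real D)"
  proof (rule suminf_le)
    show "summable (\<lambda>k. (v k z - n k / real D) * of_bool (R k))"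
      using summable_diff[OF vs sums_summable[OF nR]] by (simp add: left_diff_distrib)
    show "summable (\<lambda>k. v k z - n k / real D)"
      by (rule summable_diff[OF v_summable sums_summable[OF n1]])
    show "(v k z - n k / real D) * of_bool (R k) \<le> v k z - n k / real D" for k
      using n_le[of k] by (cases "R k") auto
  qed
  also have "\<dots> = 1 - real (card (E D z)) / real D"
    using suminf_diff[OF v_summable[of z] sums_summable[OF n1]] sum sums_unique[OF n1] by simp
  finally have upper: "(\<Sum>k. v k z * of_bool (R k)) - real L / real D \<le> 1 - real (card (E D z)) / real D" .
  have "bij_betw (from_nat_into (E D z)) {j \<in> {..<card (E D z)}. Q j} {e \<in> E D z. R (fst e)}"
  proof (rule bij_betw_subset[OF bij_betw_from_nat_into_finite[OF finite_E]])
    have "from_nat_into (E D z) ` {..<card (E D z)} = E D z"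
      using bij_betw_from_nat_into_finite[OF finite_E, of D z] by (simp add: bij_betw_def)
    moreover have "from_nat_into (E D z) ` {j \<in> {..<card (E D z)}. Q j} =
        {e \<in> from_nat_into (E D z) ` {..<card (E D z)}. R (fst e)}"
      using Q by auto
    ultimately show "from_nat_into (E D z) ` {j \<in> {..<card (E D z)}. Q j} = {e \<in> E D z. R (fst e)}" by simp
  qed auto
  then have L: "card {j \<in> {..<card (E D z)}. Q j} = L" unfolding L_def by (rule bij_betw_same_card)
  have "L \<le> card {j. j < D \<and> Q j}"
    unfolding L[symmetric] using card_E_le[of D z] by (intro card_mono) auto
  moreover have "card {j. j < D \<and> Q j} \<le> L + (D - card (E D z))"
  proof -
    have "card {j. j < D \<and> Q j} \<le> card ({j \<in> {..<card (E D z)}. Q j} \<union> {card (E D z)..<D})"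
      by (rule card_mono) auto
    also have "\<dots> \<le> L + (D - card (E D z))"
      using card_Un_le[of "{j \<in> {..<card (E D z)}. Q j}" "{card (E D z)..<D}"] L by simp
    finally show ?thesis .
  qed
  ultimately have "real L \<le> real (card {j. j < D \<and> Q j})"
    "real (card {j. j < D \<and> Q j}) \<le> real L + (real D - real (card (E D z)))"
    using card_E_le[of D z] by linarith+
  then have "real L / real D \<le> real (card {j. j < D \<and> Q j}) / real D"
    "real (card {j. j < D \<and> Q j}) / real D \<le> real L / real D + (1 - real (card (E D z)) / real D)"
    using assms(1) by (auto simp: divide_right_mono field_simps)
  with lower upper show ?thesis by linarith
qed

text \<open>Both statistics are integrals over \<open>Z\<close>: of \<open>T\<close>, the
  conditional weight of the event in the fibre, and of \<open>S\<close>, the proportion of sheets in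
  it. Pointwise they differ by at most the rounding defect, whatever \<pi> and r are, so one D
  serves all of them.\<close>

lemma sheets_approximate:
  assumes \<alpha>: "\<alpha> \<in> N \<rightarrow>\<^sub>M count_space {..<p::nat}" and \<beta>: "\<beta> \<in> Z \<rightarrow>\<^sub>M count_space Q"
    and F: "finite F" "F \<subseteq> carrier G" and \<epsilon>: "0 < \<epsilon>"
  obtains D A where "0 < D" "\<And>j. A j \<in> Z \<rightarrow>\<^sub>M count_space {..<p}"
    "\<And>\<pi> r. \<pi> \<in> extensional F \<Longrightarrow>
      \<bar>joint_dist G N b F \<alpha> (\<beta> \<circ> \<phi>) \<pi> r - sheet_stat G Z a F D (sheet D) A \<beta> \<pi> r\<bar> < \<epsilon>"
proof -
  have iF: "inv f \<in> carrier G" if "f \<in> F" for f using F that by auto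
  obtain y0 where y0: "y0 \<in> space N" using N.not_empty by blast
  have p: "0 < p" using measurable_space[OF \<alpha> y0] by auto
  from function_of_label[OF measurable_count_space_UNIV[OF \<alpha>]] obtain B where B: "\<And>k. B k \<in> Z \<rightarrow>\<^sub>M count_space UNIV"
    and \<alpha>B: "AE y in N. \<alpha> y = B (l y) (\<phi> y)" by blast
  \<comment> \<open>Away from the pairs of label and base point that occur in \<open>N\<close>,
    \<open>B\<close> may leave \<open>{..<p}\<close>; 0 is an admissible default because p is
    positive.\<close>
  define A0 where "A0 k z = (if B k z < p then B k z else 0)" for k z
  have A0m: "A0 k \<in> Z \<rightarrow>\<^sub>M count_space {..<p}" for k
    unfolding A0_def by (rule measurable_compose[OF B]) (use p in auto)
  have \<alpha>A0: "AE y in N. \<alpha> y = A0 (l y) (\<phi> y)"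
    using \<alpha>B AE_space
  proof eventually_elim
    case (elim y)
    then show ?case using measurable_space[OF \<alpha> elim(2)] by (simp add: A0_def)
  qed
  obtain D where D: "0 < D" and defect: "(\<integral>z. 1 - real (card (E D z)) / real D \<partial>Z) < \<epsilon>"
    using multiplicity_defect[OF \<epsilon>] .
  define A where "A j z = (if j < card (E D z) then A0 (fst (from_nat_into (E D z) j)) z else 0)" for j z
  have Am: "A j \<in> Z \<rightarrow>\<^sub>M count_space {..<p}" for j
    unfolding A_def
  proof (rule measurable_compose_countable'[where g = "E D" and I = "{S. finite S}" and
        f = "\<lambda>S z. if j < card S then A0 (fst (from_nat_into S j)) z else 0"])
    show "(\<lambda>z. if j < card S then A0 (fst (from_nat_into S j)) z else 0) \<in> Z \<rightarrow>\<^sub>M count_space {..<p}" for S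
      using A0m p by (cases "j < card S") simp_all
  qed (rule E_measurable countable_Collect_finite)+
  show thesis
  proof (rule that[OF D Am])
    fix \<pi> :: "'g \<Rightarrow> nat" and r assume \<pi>: "\<pi> \<in> extensional F"
    define C where "C = {z \<in> space Z. \<beta> z = r}"
    have C: "C \<in> sets Z" unfolding C_def by (rule sets_eq_const[OF \<beta>])
    have Csub: "C \<subseteq> space Z" by (auto simp: C_def)
    \<comment> \<open>\<open>R\<close> is the name event read off from a label, \<open>Q\<close> the
      same event read off from a sheet number. On used sheets over good orbits they agree through
      \<open>from_nat_into_sheet\<close>.\<close>
    define R where "R k z \<longleftrightarrow> (\<forall>f\<in>F. A0 (c (inv f) k z) (a (inv f) z) = \<pi> f)" for k z
    define Q where "Q z j \<longleftrightarrow> (\<forall>f\<in>F. A (sheet D (inv f) z j) (a (inv f) z) = \<pi> f)" for z j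
    have event: "sheet_event G Z a F (sheet D) A \<beta> \<pi> r j = {z \<in> C. Q z j}" for j
      by (auto simp: sheet_event_def C_def Q_def)
    have Rm: "{z \<in> C. R k z} \<in> sets Z" for k
    proof -
      have "{z \<in> space Z. A0 (c (inv f) k z) (a (inv f) z) = \<pi> f} \<in> sets Z" if f: "f \<in> F" for f
      proof (rule sets_eq_const)
        show "(\<lambda>z. A0 (c (inv f) k z) (a (inv f) z)) \<in> Z \<rightarrow>\<^sub>M count_space {..<p}"
          by (rule measurable_compose_countable[where f = "\<lambda>k z. A0 k (a (inv f) z)"])
             (rule measurable_compose[OF Z_facts(3)[OF iF[OF f]] A0m] c_measurable[OF iF[OF f]])+
      qed
      then have "{z \<in> space Z. R k z} \<in> sets Z"
        unfolding R_def by (intro sets.sets_Collect_finite_All F(1))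
      then have "C \<inter> {z \<in> space Z. R k z} \<in> sets Z" using C by blast
      moreover have "C \<inter> {z \<in> space Z. R k z} = {z \<in> C. R k z}" using Csub by auto
      ultimately show ?thesis by simp
    qed
    have Qm: "{z \<in> C. Q z j} \<in> sets Z" for j
      unfolding event[symmetric] by (rule sheet_event_measurable[OF Z F sheet_measurable Am \<beta>])
    let ?S = "{y \<in> space N. shift_name G b F \<alpha> y = \<pi> \<and> (\<beta> \<circ> \<phi>) y = r}"
    define T where "T z = (\<Sum>k. indicator {z \<in> C. R k z} z * v k z)" for z
    define S where "S z = (\<Sum>j<D. indicator {z \<in> C. Q z j} z) / real D" for z
    have "AE y in N. \<forall>f\<in>F. \<alpha> (b (inv f) y) = A0 (c (inv f) (l y) (\<phi> y)) (a (inv f) (\<phi> y))"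
    proof (rule AE_finite_ball[OF F(1)])
      fix f assume f: "f \<in> F"
      show "AE y in N. \<alpha> (b (inv f) y) = A0 (c (inv f) (l y) (\<phi> y)) (a (inv f) (\<phi> y))"
        using AE_act_N[OF iF[OF f] \<alpha>A0] label_act[OF iF[OF f]] equivariant[OF iF[OF f]]
        by eventually_elim simp
    qed
    then have nameR: "AE y in N. shift_name G b F \<alpha> y = \<pi> \<longleftrightarrow> R (l y) (\<phi> y)"
      unfolding shift_name_eq_iff[OF \<pi>] R_def by eventually_elim simp
    have Sm: "?S \<in> sets N" by (rule sets_shift_name[OF N F \<alpha> measurable_comp[OF proj \<beta>]])
    have "measure N ?S = measure N (\<Union>k. cell k {z \<in> C. R k z})"
    proof (rule measure_eq_AE[OF _ Sm])
      show "AE y in N. y \<in> ?S \<longleftrightarrow> y \<in> (\<Union>k. cell k {z \<in> C. R k z})"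
        using nameR AE_space
        by eventually_elim (use measurable_space[OF proj] in \<open>auto simp: cell_def C_def\<close>)
      show "(\<Union>k. cell k {z \<in> C. R k z}) \<in> sets N" using Rm by (intro sets.countable_UN) (auto intro: cell_sets)
    qed
    moreover have "(\<lambda>k. measure N (cell k {z \<in> C. R k z})) sums measure N (\<Union>k. cell k {z \<in> C. R k z})"
    proof (rule N.finite_measure_UNION)
      show "range (\<lambda>k. cell k {z \<in> C. R k z}) \<subseteq> sets N" using cell_sets[OF Rm] by blast
    qed (auto simp: disjoint_family_on_def cell_def)
    ultimately have sums: "(\<lambda>k. \<integral>z. indicator {z \<in> C. R k z} z * v k z \<partial>Z) sums measure N ?S"
      by (simp add: measure_cell[OF Rm])
    have int: "integrable Z (\<lambda>z. indicator {z \<in> C. R k z} z * v k z)" for k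
      using integrable_mult_indicator[OF Rm v_integrable] by simp
    have summ: "summable (\<lambda>k. indicator {z \<in> C. R k z} z * v k z)" for z
      by (rule summable_comparison_test_ev[OF _ v_summable[of z]])
         (auto intro!: always_eventually simp: v_nonneg indicator_def)
    have T: "measure N ?S = (\<integral>z. T z \<partial>Z)" and Ti: "integrable Z T"
    proof -
      have "norm (indicator {z \<in> C. R k z} z * v k z) = indicator {z \<in> C. R k z} z * v k z" for k z
        by (simp add: v_nonneg)
      then have *: "AE z in Z. summable (\<lambda>k. norm (indicator {z \<in> C. R k z} z * v k z))"
        "summable (\<lambda>k. \<integral>z. norm (indicator {z \<in> C. R k z} z * v k z) \<partial>Z)"
        using summ sums_summable[OF sums] by simp_all
      show "measure N ?S = (\<integral>z. T z \<partial>Z)"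
        unfolding T_def integral_suminf[OF int *] by (rule sums_unique[OF sums])
      show "integrable Z T" unfolding T_def by (rule integrable_suminf[OF int *])
    qed
    have Qi: "integrable Z (\<lambda>z. indicator {z \<in> C. Q z j} z :: real)" for j
      by (rule integrable_real_indicator[OF Qm]) (simp add: Z.emeasure_eq_measure)
    have Si: "integrable Z S"
      unfolding S_def by (intro integrable_divide Bochner_Integration.integrable_sum Qi)
    have "(\<integral>z. S z \<partial>Z) = (\<integral>z. (\<Sum>j<D. indicator {z \<in> C. Q z j} z) \<partial>Z) / real D"
      unfolding S_def by simp
    also have "(\<integral>z. (\<Sum>j<D. indicator {z \<in> C. Q z j} z) \<partial>Z) =
        (\<Sum>j<D. \<integral>z. (indicator {z \<in> C. Q z j} z :: real) \<partial>Z)"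
      by (rule Bochner_Integration.integral_sum) (rule Qi)
    also have "\<dots> = (\<Sum>j<D. measure Z {z \<in> C. Q z j})"
      by (intro sum.cong refl) (simp add: Qm)
    finally have S: "(\<Sum>j<D. measure Z {z \<in> C. Q z j}) / real D = (\<integral>z. S z \<partial>Z)" ..
    have Ei: "integrable Z (\<lambda>z. 1 - real (card (E D z)) / real D)"
      by (rule Z.integrable_unit_interval)
         (use card_E_le[of D] D card_E_measurable in \<open>auto simp: divide_le_eq\<close>)
    have diff: "AE z in Z. \<bar>T z - S z\<bar> \<le> 1 - real (card (E D z)) / real D"
      using AE_good v_sum AE_space
    proof eventually_elim
      case (elim z)
      have gz: "good z" using elim(1,3) Z_facts(6) by (metis G.one_closed)
      show ?case
      proof (cases "z \<in> C")
        case True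
        have "Q z j \<longleftrightarrow> R (fst (from_nat_into (E D z) j)) z" if j: "j < card (E D z)" for j
        proof -
          have "A (sheet D (inv f) z j) (a (inv f) z) =
              A0 (c (inv f) (fst (from_nat_into (E D z) j)) z) (a (inv f) z)" if f: "f \<in> F" for f
          proof -
            have "good (a (inv f) z)" using elim(1) iF[OF f] by blast
            note * = from_nat_into_sheet[OF gz this iF[OF f] j]
            show ?thesis using *(2) by (simp add: A_def *(1)) (simp add: \<Theta>_def)
          qed
          then show ?thesis by (simp add: Q_def R_def)
        qed
        then have "\<bar>(\<Sum>k. v k z * of_bool (R k z)) - real (card {j. j < D \<and> Q z j}) / real D\<bar>
          \<le> 1 - real (card (E D z)) / real D"
          by (rule sheet_count[OF D elim(2), where Q = "Q z" and R = "\<lambda>k. R k z"])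
        moreover have "T z = (\<Sum>k. v k z * of_bool (R k z))"
          unfolding T_def using True by (intro suminf_cong) (simp add: indicator_def)
        moreover have "S z = real (card {j. j < D \<and> Q z j}) / real D"
        proof -
          have "(\<Sum>j<D. indicator {z \<in> C. Q z j} z :: real) = (\<Sum>j<D. of_bool (Q z j))"
            using True by (intro sum.cong) (auto simp: indicator_def)
          also have "\<dots> = real (card {j. j < D \<and> Q z j})"
            by (simp add: sum_of_bool_eq) (auto intro!: arg_cong[where f = card])
          finally show ?thesis by (simp add: S_def)
        qed
        ultimately show ?thesis by simp
      next
        case False
        then have "T z = 0" "S z = 0" by (simp_all add: T_def S_def)
        then show ?thesis using card_E_le[of D z] D by (simp add: divide_le_eq)
      qed
    qed
    have "\<bar>(\<integral>z. T z \<partial>Z) - (\<integral>z. S z \<partial>Z)\<bar> = \<bar>\<integral>z. T z - S z \<partial>Z\<bar>"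
      using Ti Si by simp
    also have "\<dots> \<le> (\<integral>z. \<bar>T z - S z\<bar> \<partial>Z)" by (rule integral_abs_bound)
    also have "\<dots> \<le> (\<integral>z. 1 - real (card (E D z)) / real D \<partial>Z)"
      using Ti Si Ei diff by (intro integral_mono_AE) auto
    finally show "\<bar>joint_dist G N b F \<alpha> (\<beta> \<circ> \<phi>) \<pi> r - sheet_stat G Z a F D (sheet D) A \<beta> \<pi> r\<bar> < \<epsilon>"
      using defect unfolding joint_dist_def sheet_stat_def event S T by linarith
  qed
qed

end

text \<open>From here on the finite-to-one extension is represented by a cocycle and by colourings
  on \<open>Z\<close>, data that can be pulled back to any extension of \<open>Z\<close>.\<close>

lemma finite_to_one_sheets:
  fixes G :: "'g monoid" (structure) and Z :: "'z measure" and N :: "'y measure"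
  assumes G: "countable (carrier G)" and \<phi>: "factor_map G N b Z a \<phi>"
    and sb: "standard_borel N" "standard_borel Z"
    and fin: "AE z in Z. finite {y \<in> space N. \<phi> y = z}"
    and \<alpha>: "\<alpha> \<in> N \<rightarrow>\<^sub>M count_space {..<p::nat}" and \<beta>: "\<beta> \<in> Z \<rightarrow>\<^sub>M count_space Q"
    and F: "finite F" "F \<subseteq> carrier G" and \<epsilon>: "0 < \<epsilon>"
  obtains D s A where "0 < D" "permutation_cocycle G Z a D s" "\<And>j. A j \<in> Z \<rightarrow>\<^sub>M count_space {..<p}"
    "\<And>\<pi> r. \<pi> \<in> extensional F \<Longrightarrow>
      \<bar>joint_dist G N b F \<alpha> (\<beta> \<circ> \<phi>) \<pi> r - sheet_stat G Z a F D s A \<beta> \<pi> r\<bar> < \<epsilon>"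
proof -
  have N: "prob_space N" and m: "\<phi> \<in> N \<rightarrow>\<^sub>M Z" "distr N Z \<phi> = Z"
    using \<phi> by (auto simp: factor_map_def pmp_action_def measure_preserving_map_def)
  show thesis
  proof (rule finite_to_one_labels[OF N sb m fin])
    fix l :: "'y \<Rightarrow> nat"
    assume l: "l \<in> N \<rightarrow>\<^sub>M count_space UNIV"
      "\<And>A. A \<in> sets N \<Longrightarrow> \<exists>C. (\<forall>k. C k \<in> sets Z) \<and> (AE y in N. y \<in> A \<longleftrightarrow> \<phi> y \<in> C (l y))"
    interpret labelled_extension G N b Z a \<phi> l
      by unfold_locales (rule \<phi> G l; assumption)+
    have mult: "AE z in Z. sheet D (g \<otimes> h) z = sheet D g (a h z) \<circ> sheet D h z"
      if "g \<in> carrier G" "h \<in> carrier G" for D g h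
      using AE_good AE_space by eventually_elim (rule sheet_mult[OF _ that])
    then have "permutation_cocycle G Z a D (sheet D)" for D
      using sheet_measurable by (simp add: permutation_cocycle_def)
    then show thesis
      by (rule sheets_approximate[OF \<alpha> \<beta> F \<epsilon>, OF that[rotated]]) assumption+
  qed
qed

section \<open>Functions on ultraproducts\<close>

lemma ultrafilter_finite_cases:
  assumes U: "ultrafilter U" and K: "finite K" and ev: "\<forall>\<^sub>F i in U. \<exists>k\<in>K. P k i"
  shows "\<exists>k\<in>K. \<forall>\<^sub>F i in U. P k i"
proof (rule ccontr)
  assume "\<not> ?thesis"
  then have "\<forall>k\<in>K. \<forall>\<^sub>F i in U. \<not> P k i" using ultrafilter_not[OF U] by blast
  then have "\<forall>\<^sub>F i in U. \<forall>k\<in>K. \<not> P k i" using K by (simp add: eventually_ball_finite_distrib)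
  with ev have "\<forall>\<^sub>F i in U. False" by eventually_elim blast
  then show False using ultrafilter_not_bot[OF U] by simp
qed

text \<open>The limit along \<open>U\<close> of functions with values in a common finite set:
  exactly one value is taken for U-almost all i, whichever representative of the class is
  used.\<close>

definition ultra_fun :: "'i filter \<Rightarrow> ('i \<Rightarrow> 'x \<Rightarrow> 'b) \<Rightarrow> ('i \<Rightarrow> 'x) set \<Rightarrow> 'b" where
  "ultra_fun U \<gamma> c = (THE k. \<exists>x\<in>c. \<forall>\<^sub>F i in U. \<gamma> i (x i) = k)"

locale ultraproduct_of_actions =
  fixes U :: "'i filter" and G :: "'g monoid" (structure) and M :: "'i \<Rightarrow> 'x measure"
    and a :: "'i \<Rightarrow> 'g \<Rightarrow> 'x \<Rightarrow> 'x"
  assumes U: "ultrafilter U" and act: "\<And>i. pmp_action G (M i) (a i)"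
begin

abbreviation "X \<equiv> ultraproduct_measure U M"
abbreviation "ua \<equiv> ultraproduct_action U M a"

lemmas act_facts = pmp_action_facts[OF act]

lemma ultra_act: "pmp_action G X ua"
  by (rule pmp_action_ultraproduct[OF U act])

sublocale G: group G by (rule act_facts(1))
sublocale X: prob_space X by (rule prob_space_ultraproduct[OF U act_facts(2)])

lemma prob_space_factor: "prob_space (M i)"
  by (rule act_facts(2))

lemma space_X: "space X = ultra_set U (\<lambda>i. space (M i))"
  by (rule space_ultraproduct[OF U prob_space_factor])

text \<open>A representative may leave the spaces at indices negligible for \<open>U\<close>.
  Correcting it there spares all later arguments an eventual side condition.\<close>

lemma representative:
  assumes "c \<in> space X"
  obtains x where "c = ultra_class U x" "\<And>i. x i \<in> space (M i)"
proof -
  obtain y where y: "c = ultra_class U y" "\<forall>\<^sub>F i in U. y i \<in> space (M i)"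
    using assms unfolding space_X by (rule ultra_setE)
  define x where "x i = (if y i \<in> space (M i) then y i else (SOME z. z \<in> space (M i)))" for i
  have "x i \<in> space (M i)" for i
    using prob_space.not_empty[OF prob_space_factor] by (auto simp: x_def some_in_eq)
  moreover have "c = ultra_class U x"
    unfolding y(1) ultra_class_eq_iff using y(2) by eventually_elim (simp add: x_def)
  ultimately show thesis using that by blast
qed

lemma act_class:
  assumes x: "\<And>i. x i \<in> space (M i)" and g: "g \<in> carrier G"
  shows "ua g (ultra_class U x) = ultra_class U (\<lambda>i. a i g (x i))"
proof -
  have "(\<exists>x'\<in>ultra_class U x. \<forall>\<^sub>F i in U. y i = a i g (x' i)) \<longleftrightarrow> (\<forall>\<^sub>F i in U. y i = a i g (x i))" for y
    unfolding ultra_class_def by (auto elim: eventually_elim2 intro: exI[of _ x])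
  then show ?thesis
    using x by (simp add: ultraproduct_action_def ultra_class_in_iff) (simp add: ultra_class_def)
qed

lemma internal_sets: "(\<And>i. S i \<in> sets (M i)) \<Longrightarrow> ultra_set U S \<in> sets X"
  by (auto simp: sets_ultraproduct[OF U prob_space_factor])

lemma tendsto_internal:
  assumes "\<And>i. S i \<in> sets (M i)"
  shows "((\<lambda>i. measure (M i) (S i)) \<longlongrightarrow> measure X (ultra_set U S)) U"
proof -
  have eq: "emeasure (M i) (S i) = ennreal (measure (M i) (S i))" for i
    using prob_space.finite_measure[OF prob_space_factor] by (rule finite_measure.emeasure_eq_measure)
  show ?thesis
    using tendsto_emeasure_ultraproduct[OF U, of M S, OF prob_space_factor assms]
    unfolding eq X.emeasure_eq_measure by (rule tendsto_ennrealD) simp_all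
qed

text \<open>A form of the theorem of Los: a property of classes that the coordinates decide for
  U-almost all i defines an internal set, whose measure is then a limit of measures.\<close>

lemma internal_Collect:
  assumes "\<And>x. (\<And>i. x i \<in> space (M i)) \<Longrightarrow> \<forall>\<^sub>F i in U. \<Phi> i (x i) \<longleftrightarrow> \<Psi> (ultra_class U x)"
  shows "{c \<in> space X. \<Psi> c} = ultra_set U (\<lambda>i. {y \<in> space (M i). \<Phi> i y})"
proof -
  have *: "ultra_class U x \<in> ultra_set U (\<lambda>i. {y \<in> space (M i). \<Phi> i y}) \<longleftrightarrow> \<Psi> (ultra_class U x)"
    if x: "\<And>i. x i \<in> space (M i)" for x
  proof -
    have "(\<forall>\<^sub>F i in U. \<Phi> i (x i)) \<longleftrightarrow> (\<forall>\<^sub>F i in U. \<Psi> (ultra_class U x))"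
      by (rule eventually_subst) (rule assms[OF x])
    then show ?thesis using x ultrafilter_not_bot[OF U] by (simp add: ultra_class_in_iff)
  qed
  have sub: "ultra_set U (\<lambda>i. {y \<in> space (M i). \<Phi> i y}) \<subseteq> space X"
    unfolding space_X by (rule ultra_set_mono) auto
  show ?thesis
  proof (intro Set.set_eqI iffI)
    fix c assume c: "c \<in> {c \<in> space X. \<Psi> c}"
    then obtain x where x: "c = ultra_class U x" "\<And>i. x i \<in> space (M i)" using representative by blast
    show "c \<in> ultra_set U (\<lambda>i. {y \<in> space (M i). \<Phi> i y})" using c unfolding x(1) *[OF x(2)] by simp
  next
    fix c assume c: "c \<in> ultra_set U (\<lambda>i. {y \<in> space (M i). \<Phi> i y})"
    then have "c \<in> space X" using sub by blast
    then obtain x where x: "c = ultra_class U x" "\<And>i. x i \<in> space (M i)" using representative by blast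
    show "c \<in> {c \<in> space X. \<Psi> c}" using c *[OF x(2)] \<open>c \<in> space X\<close> by (simp add: x(1))
  qed
qed

lemma ultra_fun_class:
  assumes K: "finite K" and \<gamma>: "\<And>i. \<gamma> i \<in> space (M i) \<rightarrow> K" and x: "\<And>i. x i \<in> space (M i)"
  shows "\<forall>\<^sub>F i in U. \<gamma> i (x i) = ultra_fun U \<gamma> (ultra_class U x)"
    and "ultra_fun U \<gamma> (ultra_class U x) \<in> K"
proof -
  have "\<forall>\<^sub>F i in U. \<exists>k\<in>K. \<gamma> i (x i) = k"
    using \<gamma> x by (intro always_eventually) (auto dest: funcset_mem)
  from ultrafilter_finite_cases[OF U K this]
  obtain k where k: "k \<in> K" "\<forall>\<^sub>F i in U. \<gamma> i (x i) = k" ..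
  have "ultra_fun U \<gamma> (ultra_class U x) = k"
    unfolding ultra_fun_def
  proof (rule the_equality)
    show "\<exists>x'\<in>ultra_class U x. \<forall>\<^sub>F i in U. \<gamma> i (x' i) = k"
      using k(2) by (intro bexI[of _ x]) (simp_all add: ultra_class_def)
    fix k' assume "\<exists>x'\<in>ultra_class U x. \<forall>\<^sub>F i in U. \<gamma> i (x' i) = k'"
    then obtain x' where "\<forall>\<^sub>F i in U. x' i = x i" "\<forall>\<^sub>F i in U. \<gamma> i (x' i) = k'"
      by (auto simp: ultra_class_def)
    with k(2) have "\<forall>\<^sub>F i in U. k' = k" by eventually_elim simp
    then show "k' = k" using ultrafilter_not_bot[OF U] by simp
  qed
  with k show "\<forall>\<^sub>F i in U. \<gamma> i (x i) = ultra_fun U \<gamma> (ultra_class U x)"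
    "ultra_fun U \<gamma> (ultra_class U x) \<in> K" by simp_all
qed

lemma ultra_fun_vimage:
  assumes K: "finite K" and \<gamma>: "\<And>i. \<gamma> i \<in> space (M i) \<rightarrow> K"
  shows "{c \<in> space X. ultra_fun U \<gamma> c = k} = ultra_set U (\<lambda>i. {y \<in> space (M i). \<gamma> i y = k})"
proof (rule internal_Collect)
  fix x assume x: "\<And>i. x i \<in> space (M i)"
  show "\<forall>\<^sub>F i in U. (\<gamma> i (x i) = k) = (ultra_fun U \<gamma> (ultra_class U x) = k)"
    using ultra_fun_class(1)[OF K \<gamma>, of x, OF x] by eventually_elim simp
qed

lemma ultra_fun_measurable:
  assumes K: "finite K" and \<gamma>: "\<And>i. \<gamma> i \<in> M i \<rightarrow>\<^sub>M count_space K"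
  shows "ultra_fun U \<gamma> \<in> X \<rightarrow>\<^sub>M count_space K"
proof (subst measurable_count_space_eq_countable[OF countable_finite[OF K]], intro conjI ballI)
  have \<gamma>K: "\<gamma> i \<in> space (M i) \<rightarrow> K" for i using measurable_space[OF \<gamma>] by auto
  show "ultra_fun U \<gamma> \<in> space X \<rightarrow> K"
  proof
    fix c assume "c \<in> space X"
    then obtain x where x: "c = ultra_class U x" "\<And>i. x i \<in> space (M i)" using representative by blast
    show "ultra_fun U \<gamma> c \<in> K" unfolding x(1) by (rule ultra_fun_class(2)[OF K \<gamma>K x(2)])
  qed
  fix k
  have "ultra_fun U \<gamma> -` {k} \<inter> space X = {c \<in> space X. ultra_fun U \<gamma> c = k}" by auto
  also have "\<dots> \<in> sets X"
    unfolding ultra_fun_vimage[OF K \<gamma>K] by (intro internal_sets sets_eq_const[OF \<gamma>])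
  finally show "ultra_fun U \<gamma> -` {k} \<inter> space X \<in> sets X" .
qed

section \<open>Approximation of measurable data by internal data\<close>

lemma ultra_set_UN: "ultra_set U (\<lambda>i. \<Union>n<m. S n i) = (\<Union>n<m. ultra_set U (S n))" for m :: nat
proof (induction m)
  case 0 then show ?case by (simp add: ultra_set_empty[OF U])
next
  case (Suc m)
  have "(\<lambda>i. \<Union>n<Suc m. S n i) = (\<lambda>i. S m i \<union> (\<Union>n<m. S n i))" by (auto simp: lessThan_Suc)
  then show ?case using Suc by (simp add: ultra_set_Un[OF U] lessThan_Suc)
qed

text \<open>Induction over the generated \<sigma>-algebra. In a countable union, finitely many
  members leave out less than \<delta>/2, their approximations share the other \<delta>/2, and a
  finite union of internal sets is internal.\<close>

lemma internal_approx_set: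
  assumes "B \<in> sets X" and "0 < \<delta>"
  shows "\<exists>S. (\<forall>i. S i \<in> sets (M i)) \<and> measure X (sym_diff (ultra_set U S) B) < \<delta>"
proof -
  let ?I = "ultra_set U ` {A. \<forall>i. A i \<in> sets (M i)}"
  have sets: "sets X = sigma_sets (space X) ?I"
    using sets_ultraproduct[OF U, of M, OF prob_space_factor] by (simp add: space_X)
  have "B \<in> sigma_sets (space X) ?I" using assms(1) by (simp add: sets)
  then show ?thesis
    using assms(2)
  proof (induction arbitrary: \<delta> rule: sigma_sets.induct)
    case (Basic B)
    then show ?case by auto
  next
    case Empty
    then show ?case by (intro exI[of _ "\<lambda>_. {}"]) (simp add: ultra_set_empty[OF U])
  next
    case (Compl B)
    then obtain S where S: "\<forall>i. S i \<in> sets (M i)" "measure X (sym_diff (ultra_set U S) B) < \<delta>" by blast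
    have B: "B \<subseteq> space X" using Compl.hyps sets sets.sets_into_space by blast
    have SX: "ultra_set U S \<subseteq> space X"
      using sets.sets_into_space[OF internal_sets, of S] S(1) by blast
    have "sym_diff (ultra_set U (\<lambda>i. space (M i) - S i)) (space X - B) = sym_diff (ultra_set U S) B"
      using B SX by (auto simp: ultra_set_Diff[OF U] space_X)
    then show ?case using S by (intro exI[of _ "\<lambda>i. space (M i) - S i"]) auto
  next
    case (Union B)
    have Bm: "B n \<in> sets X" for n using Union.hyps by (simp add: sets)
    have "(\<lambda>m. measure X (\<Union>n<m. B n)) \<longlonglongrightarrow> measure X (\<Union>m. \<Union>n<m. B n)"
    proof (rule X.finite_Lim_measure_incseq)
      show "incseq (\<lambda>m. \<Union>n<m. B n)" by (rule incseq_SucI) (auto simp: lessThan_Suc)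
    qed (use Bm in auto)
    moreover have "(\<Union>m. \<Union>n<m. B n) = (\<Union>n. B n)" by auto
    ultimately have "\<forall>\<^sub>F m in sequentially. measure X (\<Union>n. B n) - \<delta> / 2 < measure X (\<Union>n<m. B n)"
      using Union.prems by (intro order_tendstoD) auto
    then obtain m where m: "measure X (\<Union>n. B n) - \<delta> / 2 < measure X (\<Union>n<m. B n)"
      by (auto simp: eventually_sequentially)
    have tail: "measure X ((\<Union>n. B n) - (\<Union>n<m. B n)) < \<delta> / 2"
      using m Bm by (subst X.finite_measure_Diff) auto
    \<comment> \<open>\<open>Suc m\<close> in place of m avoids division by 0 when m = 0; the m
      errors still total at most \<delta>/2.\<close>
    have pos: "0 < \<delta> / (2 * real (Suc m))" using Union.prems by simp
    have "\<forall>n. \<exists>S. (\<forall>i. S i \<in> sets (M i)) \<and> measure X (sym_diff (ultra_set U S) (B n)) < \<delta> / (2 * real (Suc m))"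
      using Union.IH pos by blast
    from choice[OF this] obtain S where
      S: "\<And>n i. S n i \<in> sets (M i)"
      and Sd: "\<And>n. measure X (sym_diff (ultra_set U (S n)) (B n)) < \<delta> / (2 * real (Suc m))" by blast
    have Sm: "ultra_set U (S n) \<in> sets X" for n by (rule internal_sets[OF S])
    define V where "V = (\<Union>n<m. sym_diff (ultra_set U (S n)) (B n))"
    have Vm: "V \<in> sets X" unfolding V_def using Bm Sm by auto
    have "measure X V \<le> (\<Sum>n<m. measure X (sym_diff (ultra_set U (S n)) (B n)))"
      unfolding V_def by (rule X.finite_measure_subadditive_finite) (use Bm Sm in auto)
    also have "\<dots> \<le> (\<Sum>n<m. \<delta> / (2 * real (Suc m)))" by (intro sum_mono less_imp_le Sd)
    also have "\<dots> \<le> \<delta> / 2" using Union.prems by (simp add: field_simps)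
    finally have V: "measure X V \<le> \<delta> / 2" .
    have "measure X (sym_diff (ultra_set U (\<lambda>i. \<Union>n<m. S n i)) (\<Union>n. B n)) \<le>
        measure X (V \<union> ((\<Union>n. B n) - (\<Union>n<m. B n)))"
    proof (rule X.finite_measure_mono)
      show "sym_diff (ultra_set U (\<lambda>i. \<Union>n<m. S n i)) (\<Union>n. B n) \<subseteq> V \<union> ((\<Union>n. B n) - (\<Union>n<m. B n))"
        unfolding ultra_set_UN V_def by blast
      show "V \<union> ((\<Union>n. B n) - (\<Union>n<m. B n)) \<in> sets X" using Vm Bm by auto
    qed
    also have "\<dots> \<le> measure X V + measure X ((\<Union>n. B n) - (\<Union>n<m. B n))"
      by (rule measure_Un_le) (use Vm Bm in auto)
    also have "\<dots> < \<delta>" using V tail by simp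
    finally show ?case using S by (intro exI[of _ "\<lambda>i. \<Union>n<m. S n i"]) auto
  qed
qed

lemma internal_approx:
  assumes f: "f \<in> X \<rightarrow>\<^sub>M count_space {..<p::nat}" and \<delta>: "0 < \<delta>"
  obtains \<gamma> where "\<And>i. \<gamma> i \<in> M i \<rightarrow>\<^sub>M count_space {..<p}"
    "measure X {c \<in> space X. ultra_fun U \<gamma> c \<noteq> f c} < \<delta>"
proof -
  obtain c0 where "c0 \<in> space X" using X.not_empty by blast
  then have p: "0 < p" using measurable_space[OF f] by fastforce
  have fk: "{c \<in> space X. f c = k} \<in> sets X" for k by (rule sets_eq_const[OF f])
  have "\<forall>k. \<exists>S. (\<forall>i. S i \<in> sets (M i)) \<and> measure X (sym_diff (ultra_set U S) {c \<in> space X. f c = k}) < \<delta> / p"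
    using internal_approx_set[OF fk] \<delta> p by simp
  from choice[OF this] obtain S where S: "\<And>k i. S k i \<in> sets (M i)"
    and Sd: "\<And>k. measure X (sym_diff (ultra_set U (S k)) {c \<in> space X. f c = k}) < \<delta> / p" by blast
  \<comment> \<open>The sets \<open>S k i\<close> may overlap and may fail to cover; the first one
    containing the point wins, and p - 1 catches the rest. Off \<open>V\<close> the point lies in
    exactly the right one, eventually in i, so the limit agrees with \<open>f\<close>.\<close>
  define \<gamma> where "\<gamma> i y = (LEAST k. y \<in> S k i \<or> k = p - 1)" for i y
  have \<gamma>_le: "\<gamma> i y \<le> p - 1" for i y unfolding \<gamma>_def by (rule Least_le) simp
  have \<gamma>m: "\<gamma> i \<in> M i \<rightarrow>\<^sub>M count_space {..<p}" for i
  proof (subst measurable_count_space_eq_countable, simp, intro conjI ballI)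
    have "\<gamma> i y < p" for y using \<gamma>_le[of i y] p by linarith
    then show "\<gamma> i \<in> space (M i) \<rightarrow> {..<p}" by blast
    fix k
    note [measurable] = S
    have "\<gamma> i \<in> M i \<rightarrow>\<^sub>M count_space UNIV" unfolding \<gamma>_def by measurable
    then show "\<gamma> i -` {k} \<inter> space (M i) \<in> sets (M i)" by (rule measurable_sets) simp
  qed
  have \<gamma>p: "\<gamma> i \<in> space (M i) \<rightarrow> {..<p}" for i using measurable_space[OF \<gamma>m] by auto
  define V where "V = (\<Union>k<p. sym_diff (ultra_set U (S k)) {c \<in> space X. f c = k})"
  have Sm: "ultra_set U (S k) \<in> sets X" for k by (rule internal_sets[OF S])
  have Vm: "V \<in> sets X" unfolding V_def using Sm fk by (intro sets.finite_UN) auto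
  have "measure X V \<le> (\<Sum>k<p. measure X (sym_diff (ultra_set U (S k)) {c \<in> space X. f c = k}))"
    unfolding V_def
  proof (rule X.finite_measure_subadditive_finite)
    show "(\<lambda>k. sym_diff (ultra_set U (S k)) {c \<in> space X. f c = k}) ` {..<p} \<subseteq> sets X"
      using Sm fk by blast
  qed simp
  also have "\<dots> < (\<Sum>k<p. \<delta> / p)" by (rule sum_strict_mono) (use p Sd in auto)
  finally have V: "measure X V < \<delta>" using p by simp
  have "{c \<in> space X. ultra_fun U \<gamma> c \<noteq> f c} \<subseteq> V"
  proof (rule ccontr)
    assume "\<not> ?thesis"
    then obtain c where c: "c \<in> space X" "ultra_fun U \<gamma> c \<noteq> f c" "c \<notin> V" by blast
    obtain x where x: "c = ultra_class U x" "\<And>i. x i \<in> space (M i)" using representative[OF c(1)] by blast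
    have fc: "f c < p" using measurable_space[OF f c(1)] by simp
    have iff: "c \<in> ultra_set U (S k) \<longleftrightarrow> f c = k" if "k < p" for k
    proof -
      have "c \<notin> sym_diff (ultra_set U (S k)) {c \<in> space X. f c = k}"
        using c(3) that unfolding V_def by blast
      then show ?thesis using c(1) by blast
    qed
    have "\<forall>\<^sub>F i in U. x i \<in> S k i \<longleftrightarrow> f c = k" if k: "k < p" for k
    proof (cases "f c = k")
      case True
      then have "\<forall>\<^sub>F i in U. x i \<in> S k i" using iff[OF k] by (simp add: x(1) ultra_class_in_iff)
      then show ?thesis using True by simp
    next
      case False
      then have "\<forall>\<^sub>F i in U. x i \<notin> S k i"
        using iff[OF k] by (simp add: x(1) ultra_class_in_iff ultrafilter_not[OF U])
      then show ?thesis using False by simp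
    qed
    then have "\<forall>\<^sub>F i in U. \<forall>k\<in>{..<p}. x i \<in> S k i \<longleftrightarrow> f c = k"
      by (simp add: eventually_ball_finite_distrib)
    then have "\<forall>\<^sub>F i in U. \<gamma> i (x i) = f c"
    proof eventually_elim
      case (elim i)
      show ?case
        unfolding \<gamma>_def
      proof (rule Least_equality)
        show "x i \<in> S (f c) i \<or> f c = p - 1" using elim fc by simp
        fix k assume k: "x i \<in> S k i \<or> k = p - 1"
        show "f c \<le> k"
        proof (rule ccontr)
          assume "\<not> f c \<le> k"
          then show False using k elim fc by auto
        qed
      qed
    qed
    moreover have "\<forall>\<^sub>F i in U. \<gamma> i (x i) = ultra_fun U \<gamma> c"
      unfolding x(1) by (rule ultra_fun_class(1)[OF finite_lessThan \<gamma>p x(2)])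
    ultimately have "\<forall>\<^sub>F i in U. ultra_fun U \<gamma> c = f c" by eventually_elim simp
    then show False using c(2) ultrafilter_not_bot[OF U] by simp
  qed
  then have "measure X {c \<in> space X. ultra_fun U \<gamma> c \<noteq> f c} \<le> measure X V"
    using Vm by (rule X.finite_measure_mono)
  with V show thesis using that[OF \<gamma>m] by simp
qed

end

section \<open>Skew products\<close>

text \<open>
  A cocycle satisfies its identity only almost everywhere, whereas an action must be one
  everywhere; making it trivial off an invariant conull set repairs this.
\<close>

lemma strict_permutation_cocycle:
  fixes G (structure) and s :: "'g \<Rightarrow> 'x \<Rightarrow> nat \<Rightarrow> nat"
  assumes M: "pmp_action G M a" and G: "countable (carrier G)"
    and s: "permutation_cocycle G M a D s"
  obtains s' :: "'g \<Rightarrow> 'x \<Rightarrow> nat \<Rightarrow> nat"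
  where "\<And>g. g \<in> carrier G \<Longrightarrow> s' g \<in> M \<rightarrow>\<^sub>M perms D"
    "\<And>g h x. g \<in> carrier G \<Longrightarrow> h \<in> carrier G \<Longrightarrow> x \<in> space M \<Longrightarrow> s' (g \<otimes> h) x = s' g (a h x) \<circ> s' h x"
    "\<And>g. g \<in> carrier G \<Longrightarrow> AE x in M. s' g x = s g x"
proof -
  note Mf = pmp_action_facts[OF M]
  interpret group G by (rule Mf)
  have "AE x in M. \<forall>g\<in>carrier G. \<forall>h\<in>carrier G. s (g \<otimes> h) x = s g (a h x) \<circ> s h x"
    using s by (intro AE_ball_countable' G) (simp add: permutation_cocycle_def)
  then obtain B where B: "B \<in> null_sets M"
    "\<And>x. x \<in> space M \<Longrightarrow> x \<notin> B \<Longrightarrow> \<forall>g\<in>carrier G. \<forall>h\<in>carrier G. s (g \<otimes> h) x = s g (a h x) \<circ> s h x"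
    unfolding eventually_ae_filter by blast
  \<comment> \<open>\<open>B\<close> may fail to be invariant, so the whole orbit is asked to avoid
    it. Countability of the group keeps \<open>V\<close> measurable and conull.\<close>
  define V where "V = {x \<in> space M. \<forall>k\<in>carrier G. a k x \<notin> B}"
  have V: "V \<in> sets M"
  proof -
    have "{x \<in> space M. a k x \<notin> B} \<in> sets M" if "k \<in> carrier G" for k
    proof -
      have "{x \<in> space M. a k x \<notin> B} = space M - (a k -` B \<inter> space M)" by auto
      also have "\<dots> \<in> sets M"
        using measurable_sets[OF Mf(3)[OF that], of B] B(1) by auto
      finally show ?thesis .
    qed
    then show ?thesis unfolding V_def by (intro sets.sets_Collect_countable_All' G)
  qed
  have "AE x in M. \<forall>k\<in>carrier G. a k x \<notin> B"
  proof (rule AE_ball_countable'[OF _ G])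
    fix k assume k: "k \<in> carrier G"
    have "AE x in distr M M (a k). x \<notin> B"
      unfolding Mf(4)[OF k] using B(1) by (rule AE_not_in)
    then show "AE x in M. a k x \<notin> B" by (rule AE_distrD[OF Mf(3)[OF k]])
  qed
  then have V_AE: "AE x in M. x \<in> V" using AE_space by eventually_elim (simp add: V_def)
  have V_inv: "a h x \<in> V \<longleftrightarrow> x \<in> V" if h: "h \<in> carrier G" and x: "x \<in> space M" for h x
  proof
    assume "x \<in> V"
    then show "a h x \<in> V" using h x by (simp add: V_def Mf(5) flip: Mf(7))
  next
    assume hx: "a h x \<in> V"
    have "a k x \<notin> B" if k: "k \<in> carrier G" for k
    proof -
      have "a k x = a (k \<otimes> inv h) (a h x)"
        using k h x by (simp add: m_assoc flip: Mf(7))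
      also have "\<dots> \<notin> B" using hx k h by (simp add: V_def)
      finally show ?thesis .
    qed
    then show "x \<in> V" using x by (simp add: V_def)
  qed
  define s' where "s' g x = (if x \<in> V then s g x else id)" for g x
  show thesis
  proof (rule that[of s'])
    fix g assume g: "g \<in> carrier G"
    show "s' g \<in> M \<rightarrow>\<^sub>M perms D"
      unfolding s'_def
      by (intro measurable_If measurable_const) (use s g V permutes_id in \<open>auto simp: permutation_cocycle_def\<close>)
    show "AE x in M. s' g x = s g x" using V_AE by eventually_elim (simp add: s'_def)
  next
    fix g h x assume gh: "g \<in> carrier G" "h \<in> carrier G" and x: "x \<in> space M"
    show "s' (g \<otimes> h) x = s' g (a h x) \<circ> s' h x"
    proof (cases "x \<in> V")
      case True
      then have "a \<one> x \<notin> B" by (simp add: V_def)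
      then have "x \<notin> B" using Mf(6)[OF x] by simp
      then show ?thesis using True B(2)[OF x] gh V_inv[OF gh(2) x] by (simp add: s'_def)
    qed (simp add: s'_def V_inv[OF gh(2) x])
  qed
qed

lemma emeasure_pair_uniform_count:
  fixes M :: "'x measure"
  assumes M: "prob_space M" and D: "0 < D" and A: "A \<in> sets (M \<Otimes>\<^sub>M uniform_count_measure {..<D})"
  shows "emeasure (M \<Otimes>\<^sub>M uniform_count_measure {..<D}) A =
    (\<Sum>j<D. emeasure M {x \<in> space M. (x, j) \<in> A}) / of_nat D"
proof -
  let ?u = "uniform_count_measure {..<D}"
  interpret M: prob_space M by fact
  interpret u: prob_space ?u by (rule prob_space_uniform_count_measure) (use D in auto)
  interpret pair_sigma_finite M ?u by unfold_locales
  have Asub: "A \<subseteq> space M \<times> {..<D}"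
    using sets.sets_into_space[OF A] by (simp add: space_pair_measure space_uniform_count_measure)
  have "emeasure (M \<Otimes>\<^sub>M ?u) A = (\<integral>\<^sup>+j. emeasure M ((\<lambda>x. (x, j)) -` A) \<partial>?u)"
    by (rule emeasure_pair_measure_alt2[OF A])
  also have "\<dots> = (\<integral>\<^sup>+j. emeasure M {x \<in> space M. (x, j) \<in> A} \<partial>?u)"
    by (intro nn_integral_cong arg_cong[where f = "emeasure M"]) (use Asub in auto)
  also have "\<dots> = (\<Sum>j<D. emeasure M {x \<in> space M. (x, j) \<in> A} / of_nat D)"
    unfolding uniform_count_measure_def
    by (subst nn_integral_point_measure_finite)
       (simp_all add: divide_ennreal_def inverse_ennreal D mult.commute ennreal_of_nat_eq_real_of_nat
          inverse_eq_divide)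
  also have "\<dots> = (\<Sum>j<D. emeasure M {x \<in> space M. (x, j) \<in> A}) / of_nat D"
    by (simp add: divide_ennreal_def sum_distrib_right)
  finally show ?thesis .
qed

text \<open>Uniform measure on the sheets is preserved because each \<open>s' g x\<close> is a
  permutation: in a double sum over pairs of sheets, the row sums give the mass of a preimage and
  the column sums that of the set itself. The action is built from the strict cocycle
  \<open>s'\<close>; its statistics are those of \<open>s\<close>, from which it differs on null
  sets only.\<close>

lemma skew_product:
  fixes G :: "'g monoid" (structure) and M :: "'x measure" and s :: "'g \<Rightarrow> 'x \<Rightarrow> nat \<Rightarrow> nat"
    and A :: "nat \<Rightarrow> 'x \<Rightarrow> nat"
  assumes M: "pmp_action G M a" and G: "countable (carrier G)" and D: "0 < D"
    and s: "permutation_cocycle G M a D s"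
    and A: "\<And>j. A j \<in> M \<rightarrow>\<^sub>M count_space {..<p}"
  obtains N :: "('x \<times> nat) measure" and b \<alpha>
  where "factor_map G N b M a fst" "\<alpha> \<in> N \<rightarrow>\<^sub>M count_space {..<p}"
    "\<And>F q \<beta> \<pi> r. finite F \<Longrightarrow> F \<subseteq> carrier G \<Longrightarrow> \<beta> \<in> M \<rightarrow>\<^sub>M count_space {..<q::nat} \<Longrightarrow> \<pi> \<in> extensional F \<Longrightarrow>
      joint_dist G N b F \<alpha> (\<beta> \<circ> fst) \<pi> r = sheet_stat G M a F D s A \<beta> \<pi> r"
proof -
  have sm: "s g \<in> M \<rightarrow>\<^sub>M perms D" if "g \<in> carrier G" for g
    using s that by (simp add: permutation_cocycle_def)
  note Mf = pmp_action_facts[OF M]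
  interpret group G by (rule Mf)
  interpret M: prob_space M by (rule Mf)
  obtain s' :: "'g \<Rightarrow> 'x \<Rightarrow> nat \<Rightarrow> nat"
    where s': "\<And>g. g \<in> carrier G \<Longrightarrow> s' g \<in> M \<rightarrow>\<^sub>M perms D"
    and mult': "\<And>g h x. g \<in> carrier G \<Longrightarrow> h \<in> carrier G \<Longrightarrow> x \<in> space M \<Longrightarrow>
      s' (g \<otimes> h) x = s' g (a h x) \<circ> s' h x"
    and s's: "\<And>g. g \<in> carrier G \<Longrightarrow> AE x in M. s' g x = s g x"
    by (rule strict_permutation_cocycle[OF M G s]) (assumption | rule that)+
  have perm: "s' g x permutes {..<D}" if "g \<in> carrier G" "x \<in> space M" for g x
    using measurable_space[OF s'[OF that(1)] that(2)] by simp
  have lt: "s' g x j < D" if "g \<in> carrier G" "x \<in> space M" "j < D" for g x j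
    using permutes_in_image[OF perm[OF that(1,2)], of j] that(3) by simp
  have s'm: "(\<lambda>x. s' g x j) \<in> M \<rightarrow>\<^sub>M count_space UNIV" if "g \<in> carrier G" for g j
    by (rule measurable_compose[OF s'[OF that]]) simp
  \<comment> \<open>The cocycle identity makes this permutation idempotent, hence the
    identity.\<close>
  have one: "s' \<one> x j = j" if "x \<in> space M" for x j
  proof -
    have "s' \<one> x (s' \<one> x j) = s' \<one> x j"
      using mult'[OF one_closed one_closed that] Mf(6)[OF that] by (metis comp_apply l_one one_closed)
    then show ?thesis using permutes_inj[OF perm[OF one_closed that]] by (simp add: inj_eq)
  qed
  let ?u = "uniform_count_measure {..<D}"
  interpret u: prob_space ?u by (rule prob_space_uniform_count_measure) (use D in auto)
  interpret P: pair_prob_space M ?u ..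
  define N where "N = M \<Otimes>\<^sub>M ?u"
  have sN: "space N = space M \<times> {..<D}"
    by (simp add: N_def space_pair_measure space_uniform_count_measure)
  define b where "b g = (\<lambda>z\<in>space N. (a g (fst z), s' g (fst z) (snd z)))" for g
  define \<alpha> where "\<alpha> z = A (snd z) (fst z)" for z
  have fst_m: "fst \<in> N \<rightarrow>\<^sub>M M" by (simp add: N_def)
  have snd_m: "snd \<in> N \<rightarrow>\<^sub>M count_space UNIV"
  proof -
    have snd_u: "snd \<in> N \<rightarrow>\<^sub>M ?u" by (simp add: N_def)
    show ?thesis
    proof (rule measurableI)
      fix S :: "nat set"
      have "snd -` S \<inter> space N = snd -` (S \<inter> {..<D}) \<inter> space N" by (auto simp: sN)
      also have "\<dots> \<in> sets N"
        by (rule measurable_sets[OF snd_u]) (simp add: sets_uniform_count_measure)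
      finally show "snd -` S \<inter> space N \<in> sets N" .
    qed simp
  qed
  have \<alpha>m: "\<alpha> \<in> N \<rightarrow>\<^sub>M count_space {..<p}"
    unfolding \<alpha>_def
    by (rule measurable_compose_countable[OF measurable_compose[OF fst_m A] snd_m])
  have bm: "b g \<in> N \<rightarrow>\<^sub>M N" if g: "g \<in> carrier G" for g
  proof -
    have m2: "(\<lambda>z. s' g (fst z) (snd z)) \<in> N \<rightarrow>\<^sub>M count_space UNIV"
      by (rule measurable_compose_countable[OF measurable_compose[OF fst_m s'm[OF g]] snd_m])
    have "(\<lambda>z. s' g (fst z) (snd z)) \<in> N \<rightarrow>\<^sub>M ?u"
    proof (rule measurableI)
      show "s' g (fst z) (snd z) \<in> space ?u" if "z \<in> space N" for z
        using that lt[OF g] by (auto simp: sN space_uniform_count_measure)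
      show "(\<lambda>z. s' g (fst z) (snd z)) -` S \<inter> space N \<in> sets N" for S
        using measurable_sets[OF m2, of S] by simp
    qed
    then have "(\<lambda>z. (a g (fst z), s' g (fst z) (snd z))) \<in> N \<rightarrow>\<^sub>M M \<Otimes>\<^sub>M ?u"
      by (intro measurable_Pair measurable_compose[OF fst_m Mf(3)[OF g]])
    moreover have "b g \<in> N \<rightarrow>\<^sub>M N \<longleftrightarrow> (\<lambda>z. (a g (fst z), s' g (fst z) (snd z))) \<in> N \<rightarrow>\<^sub>M N"
      by (rule measurable_cong) (simp add: b_def)
    ultimately show ?thesis by (simp add: N_def)
  qed
  have formula: "emeasure N S = (\<Sum>j<D. emeasure M {x \<in> space M. (x, j) \<in> S}) / of_nat D" if "S \<in> sets N" for S
    using that unfolding N_def by (rule emeasure_pair_uniform_count[OF M.prob_space_axioms D])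
  have slice: "{x \<in> space M. (x, j) \<in> S} \<in> sets M" if S: "S \<in> sets N" and j: "j < D" for S j
  proof -
    have "{x \<in> space M. (x, j) \<in> S} = (\<lambda>x. (x, j)) -` S \<inter> space M" by auto
    also have "\<dots> \<in> sets M"
      by (rule measurable_sets[OF _ S]) (use j in \<open>simp add: N_def space_uniform_count_measure\<close>)
    finally show ?thesis .
  qed
  have pres: "distr N N (b g) = N" if g: "g \<in> carrier G" for g
  proof (rule measure_eqI)
    fix S assume "S \<in> sets (distr N N (b g))"
    then have S: "S \<in> sets N" by simp
    note sec = slice[OF S]
    have bS: "b g -` S \<inter> space N \<in> sets N" by (rule measurable_sets[OF bm[OF g] S])
    \<comment> \<open>The points over which \<open>g\<close> moves sheet j to sheet k and ends in
      \<open>S\<close>. For fixed j these sets partition a section of the preimage of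
      \<open>S\<close>; for fixed k they partition the preimage, under \<open>a g\<close>, of a
      section of \<open>S\<close>.\<close>
    define W where "W j k = {x \<in> space M. s' g x j = k \<and> (a g x, k) \<in> S}" for j k
    have Wm: "W j k \<in> sets M" if "k < D" for j k
    proof -
      have "W j k = {x \<in> space M. s' g x j = k} \<inter> (a g -` {x \<in> space M. (x, k) \<in> S} \<inter> space M)"
        using Mf(5)[OF g] by (auto simp: W_def)
      also have "\<dots> \<in> sets M"
        by (intro sets.Int measurable_sets[OF Mf(3)[OF g]] sec that sets_eq_const[OF s'm[OF g]])
      finally show ?thesis .
    qed
    have row: "(\<Sum>k<D. emeasure M (W j k)) = emeasure M {x \<in> space M. (x, j) \<in> b g -` S \<inter> space N}"
      if "j < D" for j
    proof -
      have "(\<Sum>k<D. emeasure M (W j k)) = emeasure M (\<Union>k<D. W j k)"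
        by (rule sum_emeasure) (use Wm in \<open>auto simp: disjoint_family_on_def W_def\<close>)
      also have "(\<Union>k<D. W j k) = {x \<in> space M. (x, j) \<in> b g -` S \<inter> space N}"
        using that lt[OF g] by (auto simp: W_def b_def sN)
      finally show ?thesis .
    qed
    have col: "(\<Sum>j<D. emeasure M (W j k)) = emeasure M {x \<in> space M. (x, k) \<in> S}" if k: "k < D" for k
    proof -
      have "(\<Sum>j<D. emeasure M (W j k)) = emeasure M (\<Union>j<D. W j k)"
      proof (rule sum_emeasure)
        show "disjoint_family_on (\<lambda>j. W j k) {..<D}"
          unfolding disjoint_family_on_def
        proof (intro ballI impI)
          fix i j :: nat assume "i \<noteq> j"
          have "s' g x i \<noteq> s' g x j" if "x \<in> space M" for x
            using inj_eq[OF permutes_inj[OF perm[OF g that]]] \<open>i \<noteq> j\<close> by simp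
          then show "W i k \<inter> W j k = {}" by (force simp: W_def)
        qed
      qed (use Wm k in auto)
      also have "(\<Union>j<D. W j k) = a g -` {x \<in> space M. (x, k) \<in> S} \<inter> space M"
      proof (intro Set.set_eqI iffI)
        fix x assume "x \<in> a g -` {x \<in> space M. (x, k) \<in> S} \<inter> space M"
        then have x: "x \<in> space M" "(a g x, k) \<in> S" by auto
        obtain j where j: "s' g x j = k" using permutes_surj[OF perm[OF g x(1)]] by (metis surjD)
        then have "j < D" using permutes_in_image[OF perm[OF g x(1)], of j] k by simp
        then show "x \<in> (\<Union>j<D. W j k)" using x j by (auto simp: W_def)
      qed (use Mf(5)[OF g] in \<open>auto simp: W_def\<close>)
      also have "emeasure M \<dots> = emeasure (distr M M (a g)) {x \<in> space M. (x, k) \<in> S}"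
        by (rule emeasure_distr[symmetric]) (intro Mf(3) g sec k)+
      also have "\<dots> = emeasure M {x \<in> space M. (x, k) \<in> S}" unfolding Mf(4)[OF g] ..
      finally show ?thesis .
    qed
    have "emeasure (distr N N (b g)) S = emeasure N (b g -` S \<inter> space N)"
      by (rule emeasure_distr[OF bm[OF g] S])
    also have "\<dots> = (\<Sum>j<D. \<Sum>k<D. emeasure M (W j k)) / of_nat D"
      unfolding formula[OF bS] by (simp add: row)
    also have "(\<Sum>j<D. \<Sum>k<D. emeasure M (W j k)) = (\<Sum>k<D. \<Sum>j<D. emeasure M (W j k))" by (rule sum.swap)
    also have "\<dots> / of_nat D = emeasure N S" unfolding formula[OF S] by (simp add: col)
    finally show "emeasure (distr N N (b g)) S = emeasure N S" .
  qed simp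
  have pmp: "pmp_action G N b"
    unfolding pmp_action_def measure_preserving_map_def
  proof (intro conjI ballI)
    show "prob_space N" unfolding N_def by unfold_locales
    show "group_action G (space N) b"
    proof (rule group_actionI)
      show "group G" by unfold_locales
      show "b g \<in> extensional (space N)" for g by (simp add: b_def)
      show cl: "b g z \<in> space N" if "g \<in> carrier G" "z \<in> space N" for g z
        using measurable_space[OF bm[OF that(1)] that(2)] .
      show "b \<one> z = z" if "z \<in> space N" for z
        using that by (auto simp: b_def sN Mf(6) one)
      fix g h z assume gh: "g \<in> carrier G" "h \<in> carrier G" and z: "z \<in> space N"
      have x: "fst z \<in> space M" using z by (auto simp: sN)
      have "b g (b h z) = (a g (a h (fst z)), s' g (a h (fst z)) (s' h (fst z) (snd z)))"
        using cl[OF gh(2) z] z by (simp add: b_def)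
      then show "b (g \<otimes> h) z = b g (b h z)"
        using z by (simp add: b_def Mf(7)[OF gh x] mult'[OF gh x])
    qed
  qed (use bm pres in auto)
  have fm: "factor_map G N b M a fst"
    unfolding N_def
    by (rule factor_map_fst[OF M pmp[unfolded N_def] u.prob_space_axioms]) (simp add: b_def N_def)
  show thesis
  proof (rule that[OF fm \<alpha>m])
    fix F q \<beta> and \<pi> :: "'g \<Rightarrow> nat" and r
    assume F: "finite F" "F \<subseteq> carrier G" and \<beta>: "\<beta> \<in> M \<rightarrow>\<^sub>M count_space {..<q::nat}" and \<pi>: "\<pi> \<in> extensional F"
    have iF: "inv f \<in> carrier G" if "f \<in> F" for f using F that by auto
    let ?S = "{z \<in> space N. shift_name G b F \<alpha> z = \<pi> \<and> (\<beta> \<circ> fst) z = r}"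
    have S: "?S \<in> sets N"
      by (rule sets_shift_name[OF pmp F \<alpha>m measurable_comp[OF fst_m \<beta>]])
    have eq: "measure M {x \<in> space M. (x, j) \<in> ?S} = measure M (sheet_event G M a F s A \<beta> \<pi> r j)"
      if j: "j < D" for j
    proof (rule measure_eq_AE)
      show "{x \<in> space M. (x, j) \<in> ?S} \<in> sets M" by (rule slice[OF S j])
      show "sheet_event G M a F s A \<beta> \<pi> r j \<in> sets M" by (rule sheet_event_measurable[OF M F sm A \<beta>])
      have "AE x in M. \<forall>f\<in>F. s' (inv f) x = s (inv f) x"
        by (intro AE_finite_ball F(1) s's iF)
      then show "AE x in M. x \<in> {x \<in> space M. (x, j) \<in> ?S} \<longleftrightarrow> x \<in> sheet_event G M a F s A \<beta> \<pi> r j"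
        by eventually_elim (use j in \<open>auto simp: shift_name_eq_iff[OF \<pi>] sheet_event_def sN \<alpha>_def b_def\<close>)
    qed
    have "joint_dist G N b F \<alpha> (\<beta> \<circ> fst) \<pi> r = enn2real ((\<Sum>j<D. emeasure M {x \<in> space M. (x, j) \<in> ?S}) / of_nat D)"
      unfolding joint_dist_def measure_def formula[OF S] ..
    also have "\<dots> = (\<Sum>j<D. measure M {x \<in> space M. (x, j) \<in> ?S}) / D"
    proof -
      have "(\<Sum>j<D. emeasure M {x \<in> space M. (x, j) \<in> ?S}) / of_nat D =
          ennreal (\<Sum>j<D. measure M {x \<in> space M. (x, j) \<in> ?S}) / ennreal (real D)"
        unfolding M.emeasure_eq_measure by (subst sum_ennreal) (simp_all add: ennreal_of_nat_eq_real_of_nat)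
      also have "\<dots> = ennreal ((\<Sum>j<D. measure M {x \<in> space M. (x, j) \<in> ?S}) / real D)"
        using D by (intro divide_ennreal sum_nonneg) auto
      finally show ?thesis by (simp add: sum_nonneg)
    qed
    also have "(\<Sum>j<D. measure M {x \<in> space M. (x, j) \<in> ?S}) =
        (\<Sum>j<D. measure M (sheet_event G M a F s A \<beta> \<pi> r j))"
      by (rule sum.cong[OF refl], rule eq) simp
    finally show "joint_dist G N b F \<alpha> (\<beta> \<circ> fst) \<pi> r = sheet_stat G M a F D s A \<beta> \<pi> r"
      unfolding sheet_stat_def .
  qed
qed

section \<open>Bernoulli extensions and freeness\<close>

text \<open>In the product with the full shift on p symbols, the colour of a point and that of its
  translate by \<open>inv g\<close> are the coordinates at the neutral element and at
  \<open>g\<close>. For distinct elements these are independent of each other and of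
  \<open>M\<close>, whence the factor 1/p for each.\<close>

lemma bernoulli_extension:
  fixes G :: "'g monoid" (structure) and M :: "'x measure"
  assumes M: "pmp_action G M a" and p: "0 < p"
  obtains N :: "('x \<times> ('g \<Rightarrow> nat)) measure" and b \<alpha>
  where "factor_map G N b M a fst" "\<alpha> \<in> N \<rightarrow>\<^sub>M count_space {..<p::nat}"
    "\<And>g A i. g \<in> carrier G \<Longrightarrow> g \<noteq> \<one> \<Longrightarrow> A \<in> sets M \<Longrightarrow> i < p \<Longrightarrow>
      measure N {z \<in> space N. fst z \<in> A \<and> \<alpha> z = i \<and> \<alpha> (b (inv g) z) = i} = measure M A / p\<^sup>2"
proof -
  note Mf = pmp_action_facts[OF M]
  interpret group G by (rule Mf)
  interpret M: prob_space M by (rule Mf)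
  let ?u = "uniform_count_measure {..<p}"
  interpret u: prob_space ?u by (rule prob_space_uniform_count_measure) (use p in auto)
  interpret Q: product_prob_space "\<lambda>_. ?u" "carrier G" ..
  define Q where "Q = PiM (carrier G) (\<lambda>_. ?u)"
  interpret Qp: prob_space Q unfolding Q_def by (rule Q.prob_space_axioms)
  interpret P: pair_prob_space M Q ..
  define N where "N = M \<Otimes>\<^sub>M Q"
  have sQ: "space Q = carrier G \<rightarrow>\<^sub>E {..<p}" by (simp add: Q_def space_PiM space_uniform_count_measure)
  have sN: "space N = space M \<times> (carrier G \<rightarrow>\<^sub>E {..<p})" by (simp add: N_def space_pair_measure sQ)
  define sh where "sh g \<omega> = (\<lambda>h\<in>carrier G. \<omega> (inv g \<otimes> h))" for g and \<omega> :: "'g \<Rightarrow> nat"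
  define b where "b g = (\<lambda>z\<in>space N. (a g (fst z), sh g (snd z)))" for g
  define \<alpha> :: "'x \<times> ('g \<Rightarrow> nat) \<Rightarrow> nat" where "\<alpha> z = snd z \<one>" for z
  have coord: "(\<lambda>\<omega>. \<omega> h) \<in> Q \<rightarrow>\<^sub>M ?u" if "h \<in> carrier G" for h
    unfolding Q_def by (rule measurable_component_singleton[OF that])
  have shm: "sh g \<in> Q \<rightarrow>\<^sub>M Q" if "g \<in> carrier G" for g
    using that unfolding sh_def by (subst (2) Q_def) (intro measurable_restrict coord m_closed inv_closed)
  have sh_distr: "distr Q Q (sh g) = Q" if g: "g \<in> carrier G" for g
    unfolding sh_def Q_def
    by (rule distr_PiM_reindex) (use g u.prob_space_axioms in \<open>auto simp: inj_on_def\<close>)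
  have pair: "(\<lambda>(x, \<omega>). (a g x, sh g \<omega>)) \<in> N \<rightarrow>\<^sub>M N" if g: "g \<in> carrier G" for g
    unfolding N_def case_prod_beta
    by (intro measurable_Pair measurable_compose[OF measurable_fst Mf(3)[OF g]]
        measurable_compose[OF measurable_snd shm[OF g]])
  have b_eq: "b g z = (\<lambda>(x, \<omega>). (a g x, sh g \<omega>)) z" if "z \<in> space N" for g z
    using that by (simp add: b_def case_prod_beta)
  have bm: "b g \<in> N \<rightarrow>\<^sub>M N" if g: "g \<in> carrier G" for g
    using pair[OF g] by (rule measurable_cong[THEN iffD2, rotated]) (rule b_eq)
  have bd: "distr N N (b g) = N" if g: "g \<in> carrier G" for g
  proof -
    have "distr N N (b g) = distr N N (\<lambda>(x, \<omega>). (a g x, sh g \<omega>))"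
      by (rule distr_cong) (simp_all add: b_eq)
    also have "\<dots> = distr M M (a g) \<Otimes>\<^sub>M distr Q Q (sh g)"
      unfolding N_def
      by (rule pair_measure_distr[symmetric]) (intro Mf(3) shm g | unfold sh_distr[OF g], unfold_locales)+
    also have "\<dots> = N" by (simp add: Mf(4)[OF g] sh_distr[OF g] N_def)
    finally show ?thesis .
  qed
  have pmp: "pmp_action G N b"
    unfolding pmp_action_def measure_preserving_map_def
  proof (intro conjI ballI)
    show "prob_space N" unfolding N_def by unfold_locales
    show "group_action G (space N) b"
    proof (rule group_actionI)
      show "group G" by unfold_locales
      show "b g \<in> extensional (space N)" for g by (simp add: b_def)
      show cl: "b g z \<in> space N" if "g \<in> carrier G" "z \<in> space N" for g z
        using measurable_space[OF bm[OF that(1)] that(2)] .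
      show "b \<one> z = z" if "z \<in> space N" for z
        using that by (auto simp: b_def sh_def sN Mf(6) fun_eq_iff PiE_def extensional_def)
      fix g h z assume gh: "g \<in> carrier G" "h \<in> carrier G" and z: "z \<in> space N"
      have x: "fst z \<in> space M" using z by (auto simp: sN)
      have "b g (b h z) = (a g (a h (fst z)), sh g (sh h (snd z)))"
        using cl[OF gh(2) z] z by (simp add: b_def)
      moreover have "sh g (sh h (snd z)) = sh (g \<otimes> h) (snd z)"
        using gh by (auto simp: sh_def fun_eq_iff inv_mult_group m_assoc)
      ultimately show "b (g \<otimes> h) z = b g (b h z)"
        using z by (simp add: b_def Mf(7)[OF gh x])
    qed
  qed (use bm bd in auto)
  have fm: "factor_map G N b M a fst"
    unfolding N_def
    by (rule factor_map_fst[OF M pmp[unfolded N_def] Qp.prob_space_axioms]) (simp add: b_def N_def)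
  have \<alpha>m: "\<alpha> \<in> N \<rightarrow>\<^sub>M count_space {..<p}"
  proof -
    have "\<alpha> \<in> N \<rightarrow>\<^sub>M ?u"
      unfolding \<alpha>_def N_def by (rule measurable_compose[OF measurable_snd coord[OF one_closed]])
    then show ?thesis
      unfolding measurable_cong_sets[OF refl sets_uniform_count_measure_count_space] .
  qed
  show thesis
  proof (rule that[OF fm \<alpha>m])
    fix g A i assume g: "g \<in> carrier G" "g \<noteq> \<one>" and A: "A \<in> sets M" and i: "i < p"
    have Asub: "A \<subseteq> space M" using sets.sets_into_space[OF A] .
    let ?J = "{\<one>, g}"
    have "{z \<in> space N. fst z \<in> A \<and> \<alpha> z = i \<and> \<alpha> (b (inv g) z) = i} =
        A \<times> prod_emb (carrier G) (\<lambda>_. ?u) ?J (Pi\<^sub>E ?J (\<lambda>_. {i}))"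
    proof -
      have "\<omega> \<in> prod_emb (carrier G) (\<lambda>_. ?u) ?J (Pi\<^sub>E ?J (\<lambda>_. {i})) \<longleftrightarrow>
          \<omega> \<in> carrier G \<rightarrow>\<^sub>E {..<p} \<and> \<omega> \<one> = i \<and> \<omega> g = i" for \<omega>
        by (auto simp: prod_emb_iff restrict_PiE_iff space_uniform_count_measure PiE_iff
            dest: fun_cong[of _ _ "\<one>"] fun_cong[of _ _ g])
      moreover have "\<alpha> (b (inv g) z) = snd z g" if "z \<in> space N" for z
        using that g by (simp add: \<alpha>_def b_def sh_def)
      ultimately show ?thesis using Asub by (auto simp: sN \<alpha>_def)
    qed
    moreover have "measure N (A \<times> prod_emb (carrier G) (\<lambda>_. ?u) ?J (Pi\<^sub>E ?J (\<lambda>_. {i}))) =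
        measure M A * measure Q (prod_emb (carrier G) (\<lambda>_. ?u) ?J (Pi\<^sub>E ?J (\<lambda>_. {i})))"
    proof -
      have "prod_emb (carrier G) (\<lambda>_. ?u) ?J (Pi\<^sub>E ?J (\<lambda>_. {i})) \<in> sets Q"
        unfolding Q_def by (rule sets_PiM_I) (use g i in \<open>auto simp: sets_uniform_count_measure\<close>)
      then show ?thesis
        unfolding N_def by (simp add: measure_def Qp.emeasure_pair_measure_Times A enn2real_mult)
    qed
    moreover have "measure Q (prod_emb (carrier G) (\<lambda>_. ?u) ?J (Pi\<^sub>E ?J (\<lambda>_. {i}))) = measure ?u {i} * measure ?u {i}"
    proof -
      have "emeasure Q (prod_emb (carrier G) (\<lambda>_. ?u) ?J (Pi\<^sub>E ?J (\<lambda>_. {i}))) = (\<Prod>j\<in>?J. emeasure ?u {i})"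
        unfolding Q_def by (rule Q.emeasure_PiM_emb) (use g i in \<open>auto simp: sets_uniform_count_measure\<close>)
      then show ?thesis using g(2) by (simp add: measure_def enn2real_mult)
    qed
    moreover have "measure ?u {i} = 1 / p"
      using i by (subst measure_uniform_count_measure) auto
    ultimately show "measure N {z \<in> space N. fst z \<in> A \<and> \<alpha> z = i \<and> \<alpha> (b (inv g) z) = i} = measure M A / p\<^sup>2"
      using g(2) by (simp add: power2_eq_square)
  qed
qed

text \<open>Existential closedness copies the Bernoulli colouring to \<open>M\<close>, jointly with
  the indicator of \<open>A\<close> in the role of \<beta>. The bound depends on p alone and not on
  the action, which is what ultraproducts need.\<close>

lemma ec_action_separates:
  fixes G :: "'g monoid" (structure) and M :: "'x measure"
  assumes ec: "ec_action G M a" and g: "g \<in> carrier G" "g \<noteq> \<one>" and A: "A \<in> sets M"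
    and p: "0 < p" and \<delta>: "0 < \<delta>"
  obtains \<gamma> where "\<gamma> \<in> M \<rightarrow>\<^sub>M count_space {..<p::nat}"
    "measure M {x \<in> A. \<gamma> x = \<gamma> (a (inv g) x)} < measure M A / p + \<delta>"
proof -
  have M: "pmp_action G M a" using ec by (simp add: ec_action_def)
  note Mf = pmp_action_facts[OF M]
  interpret group G by (rule Mf)
  interpret M: prob_space M by (rule Mf)
  have Asub: "A \<subseteq> space M" using sets.sets_into_space[OF A] .
  obtain N :: "('x \<times> ('g \<Rightarrow> nat)) measure" and b \<alpha>
    where N: "factor_map G N b M a fst" and \<alpha>: "\<alpha> \<in> N \<rightarrow>\<^sub>M count_space {..<p}"
    and stat: "\<And>g A i. g \<in> carrier G \<Longrightarrow> g \<noteq> \<one> \<Longrightarrow> A \<in> sets M \<Longrightarrow> i < p \<Longrightarrow>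
      measure N {z \<in> space N. fst z \<in> A \<and> \<alpha> z = i \<and> \<alpha> (b (inv g) z) = i} = measure M A / p\<^sup>2"
    by (rule bernoulli_extension[OF M p]) (assumption | rule that)+
  have Nb: "pmp_action G N b" using N by (simp add: factor_map_def)
  define \<beta> :: "'x \<Rightarrow> nat" where "\<beta> x = (if x \<in> A then 1 else 0)" for x
  have \<beta>: "\<beta> \<in> M \<rightarrow>\<^sub>M count_space {..<2}"
  proof -
    have "{x \<in> space M. x \<in> A} = A" using Asub by auto
    then show ?thesis unfolding \<beta>_def using A by (intro measurable_If) auto
  qed
  let ?F = "{\<one>, g}"
  define \<pi> :: "nat \<Rightarrow> 'g \<Rightarrow> nat" where "\<pi> i = (\<lambda>f\<in>?F. i)" for i
  have "ec_factor_map G N b M a fst" using ec N by (simp add: ec_action_def)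
  \<comment> \<open>There is one monochromatic event for each of the p colours, so a tolerance of
    \<delta>/p for each adds up to \<delta>.\<close>
  from this[unfolded ec_factor_map_def, rule_format, OF \<alpha> \<beta>, of ?F "\<delta> / p"]
  obtain \<gamma> where \<gamma>: "\<gamma> \<in> M \<rightarrow>\<^sub>M count_space {..<p}"
    and close: "\<And>\<pi> j. \<pi> \<in> ?F \<rightarrow>\<^sub>E {..<p} \<Longrightarrow> j < 2 \<Longrightarrow>
      \<bar>joint_dist G N b ?F \<alpha> (\<beta> \<circ> fst) \<pi> j - joint_dist G M a ?F \<gamma> \<beta> \<pi> j\<bar> < \<delta> / p"
    using g p \<delta> by auto
  have jN: "joint_dist G N b ?F \<alpha> (\<beta> \<circ> fst) (\<pi> i) 1 = measure M A / p\<^sup>2" if "i < p" for i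
  proof -
    have "{z \<in> space N. shift_name G b ?F \<alpha> z = \<pi> i \<and> (\<beta> \<circ> fst) z = 1} =
        {z \<in> space N. fst z \<in> A \<and> \<alpha> z = i \<and> \<alpha> (b (inv g) z) = i}"
      using g by (auto simp: shift_name_def \<pi>_def \<beta>_def fun_eq_iff restrict_def pmp_action_facts(6)[OF Nb])
    then show ?thesis by (simp add: joint_dist_def stat[OF g A that])
  qed
  let ?S = "\<lambda>i. {x \<in> space M. shift_name G a ?F \<gamma> x = \<pi> i \<and> \<beta> x = 1}"
  have Sm: "?S i \<in> sets M" for i
    by (rule sets_shift_name[OF M _ _ \<gamma> \<beta>]) (use g in auto)
  have "{x \<in> A. \<gamma> x = \<gamma> (a (inv g) x)} \<subseteq> (\<Union>i<p. ?S i)"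
  proof
    fix x assume x: "x \<in> {x \<in> A. \<gamma> x = \<gamma> (a (inv g) x)}"
    then have xM: "x \<in> space M" using Asub by blast
    have "shift_name G a ?F \<gamma> x = \<pi> (\<gamma> x)"
      using x xM by (auto simp: shift_name_def \<pi>_def Mf(6) fun_eq_iff)
    moreover have "\<gamma> x < p" using measurable_space[OF \<gamma> xM] by simp
    ultimately show "x \<in> (\<Union>i<p. ?S i)" using x xM by (auto simp: \<beta>_def)
  qed
  then have "measure M {x \<in> A. \<gamma> x = \<gamma> (a (inv g) x)} \<le> measure M (\<Union>i<p. ?S i)"
    by (rule M.finite_measure_mono) (use Sm in auto)
  also have "\<dots> \<le> (\<Sum>i<p. measure M (?S i))"
    by (rule M.finite_measure_subadditive_finite) (use Sm in auto)
  also have "\<dots> < (\<Sum>i<p. measure M A / p\<^sup>2 + \<delta> / p)"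
  proof (rule sum_strict_mono)
    fix i assume "i \<in> {..<p}"
    then have i: "i < p" by simp
    have "\<pi> i \<in> ?F \<rightarrow>\<^sub>E {..<p}" using i by (auto simp: \<pi>_def)
    from close[OF this, of 1] show "measure M (?S i) < measure M A / p\<^sup>2 + \<delta> / p"
      unfolding jN[OF i] by (simp add: joint_dist_def)
  qed (use p in auto)
  also have "\<dots> = measure M A / p + \<delta>" using p by (simp add: power2_eq_square field_simps)
  finally show thesis using that[OF \<gamma>] by blast
qed

text \<open>The points of \<open>A\<close> with colour i whose translate by \<open>inv g\<close> has
  another colour form a set disjoint from its image under \<open>g\<close>. Countably many such sets
  cover \<open>A\<close> up to the collisions bounded in \<open>less\<close>, so one of them has
  positive measure.\<close>

lemma separated_piece:
  fixes G (structure) and a :: "'g \<Rightarrow> 'x \<Rightarrow> 'x" and \<gamma> :: "'x \<Rightarrow> nat"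
  assumes M: "pmp_action G M a" and g: "g \<in> carrier G" and A: "A \<in> sets M"
    and \<gamma>: "\<gamma> \<in> M \<rightarrow>\<^sub>M count_space I"
    and less: "measure M {x \<in> A. \<gamma> x = \<gamma> (a (inv g) x)} < measure M A"
  shows "\<exists>B\<in>sets M. B \<subseteq> A \<and> 0 < measure M B \<and> measure M (B \<inter> a g ` B) = 0"
proof -
  note Mf = pmp_action_facts[OF M]
  interpret group G by (rule Mf)
  interpret M: prob_space M by (rule Mf)
  have Asub: "A \<subseteq> space M" using sets.sets_into_space[OF A] .
  define B where "B i = {x \<in> A. \<gamma> x = i \<and> \<gamma> (a (inv g) x) \<noteq> i}" for i
  have \<gamma>g: "(\<lambda>x. \<gamma> (a (inv g) x)) \<in> M \<rightarrow>\<^sub>M count_space I"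
    by (rule measurable_compose[OF Mf(3) \<gamma>]) (use g in simp)
  have Bm: "B i \<in> sets M" for i
  proof -
    have "B i = A \<inter> {x \<in> space M. \<gamma> x = i} - {x \<in> space M. \<gamma> (a (inv g) x) = i}"
      using Asub by (auto simp: B_def)
    then show ?thesis using A sets_eq_const[OF \<gamma>] sets_eq_const[OF \<gamma>g] by auto
  qed
  have "\<exists>i. 0 < measure M (B i)"
  proof (rule ccontr)
    assume "\<not> ?thesis"
    then have "B i \<in> null_sets M" for i
      using Bm[of i] by (auto simp: null_sets_def M.emeasure_eq_measure not_less intro: antisym)
    then have null: "(\<Union>i. B i) \<in> null_sets M" by auto
    have eq: "{x \<in> A. \<gamma> x = \<gamma> (a (inv g) x)} = A - (\<Union>i. B i)" by (auto simp: B_def)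
    show False using less unfolding eq measure_Diff_null_set[OF A null] by simp
  qed
  then obtain i where i: "0 < measure M (B i)" ..
  have "B i \<inter> a g ` B i = {}"
  proof (rule ccontr)
    assume "\<not> ?thesis"
    then obtain x where x: "x \<in> B i" "a g x \<in> B i" by blast
    then have "x \<in> space M" using Asub by (auto simp: B_def)
    then have "a (inv g) (a g x) = x" using g by (simp add: Mf(6) flip: Mf(7))
    then show False using x by (simp add: B_def)
  qed
  then show ?thesis using i Bm by (intro bexI[of _ "B i"]) (auto simp: B_def)
qed

lemma ec_imp_free:
  fixes G (structure)
  assumes ec: "ec_action G M a"
  shows "free_pmp_action G M a"
  unfolding free_pmp_action_def
proof (intro conjI ballI impI)
  show M: "pmp_action G M a" using ec by (simp add: ec_action_def)
  fix g A assume g: "g \<in> carrier G" "g \<noteq> \<one>" and A: "A \<in> sets M" "0 < measure M A"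
  \<comment> \<open>Two colours and a slack of 1/4 suffice, as 1/2 + 1/4 < 1.\<close>
  obtain \<gamma> where "\<gamma> \<in> M \<rightarrow>\<^sub>M count_space {..<2::nat}"
    "measure M {x \<in> A. \<gamma> x = \<gamma> (a (inv g) x)} < measure M A / real 2 + measure M A / 4"
    by (rule ec_action_separates[OF ec g A(1), of 2 "measure M A / 4"]) (use A(2) in auto)
  then show "\<exists>B\<in>sets M. B \<subseteq> A \<and> 0 < measure M B \<and> measure M (B \<inter> a g ` B) = 0"
    using A(2) by (intro separated_piece[OF M g(1) A(1)]) auto
qed

section \<open>Standard factors\<close>

text \<open>A matter of cardinality only, since the Borel structure will be transported along the
  injection. Real numbers are wanted as points because \<open>extension_MD_group\<close> is stated
  for them.\<close>

lemma inj_sequences_to_real: "\<exists>e :: (nat \<Rightarrow> real) \<Rightarrow> real. inj e"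
proof -
  obtain \<rho> :: "nat set \<Rightarrow> real" where \<rho>: "bij \<rho>"
    using nat_sets_eqpoll_reals by (auto simp: eqpoll_def)
  define S where "S u = {prod_encode (n, m) |n m. m \<in> inv_into UNIV \<rho> (u n)}" for u :: "nat \<Rightarrow> real"
  have "inj S"
  proof (rule injI)
    fix u w assume "S u = S w"
    then have "prod_encode (n, m) \<in> S u \<longleftrightarrow> prod_encode (n, m) \<in> S w" for n m by simp
    then have "inv_into UNIV \<rho> (u n) = inv_into UNIV \<rho> (w n)" for n by (auto simp: S_def)
    then have "u n = w n" for n using \<rho> by (metis bij_inv_eq_iff)
    then show "u = w" by blast
  qed
  then have "inj (\<rho> \<circ> S)" by (rule inj_compose[OF bij_is_inj[OF \<rho>]])
  then show ?thesis by blast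
qed

text \<open>The pullback topology makes the range homeomorphic to the original Polish space, and its
  open sets generate the transported \<sigma>-algebra.\<close>

lemma standard_borel_vimage:
  fixes e :: "'b :: {second_countable_topology, complete_space} \<Rightarrow> 'c"
  assumes e: "inj e" and M: "sets M = sets (vimage_algebra (range e) (inv_into UNIV e) borel)"
  shows "standard_borel M"
proof -
  let ?T = "pullback_topology (range e) (inv_into UNIV e) euclidean"
  have top: "topspace ?T = range e" by (simp add: topspace_pullback_topology)
  have hom: "homeomorphic_maps euclidean ?T e (inv_into UNIV e)"
    unfolding homeomorphic_maps_def
  proof (intro conjI ballI)
    have "inv_into UNIV e \<circ> e = id" using e by simp
    then show "continuous_map euclidean ?T e"
      by (intro continuous_map_pullback') (auto simp: id_def)
    show "continuous_map ?T euclidean (inv_into UNIV e)"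
      using continuous_map_pullback[of euclidean euclidean id "range e" "inv_into UNIV e"] by simp
  qed (use e top f_inv_into_f in \<open>auto simp: f_inv_into_f\<close>)
  then have hs: "(euclidean :: 'b topology) homeomorphic_space ?T" by (auto simp: homeomorphic_space_def)
  have "completely_metrizable_space ?T"
    by (rule iffD1[OF homeomorphic_completely_metrizable_space[OF hs] completely_metrizable_space_euclidean])
  moreover have "second_countable ?T"
  proof -
    obtain \<B> :: "'b set set" where \<B>: "countable \<B>" "topological_basis \<B>" using ex_countable_basis by blast
    have "second_countable (euclidean :: 'b topology)"
      unfolding second_countable_def
    proof (intro exI[of _ \<B>] conjI allI impI ballI)
      show "openin euclidean V" if "V \<in> \<B>" for V using topological_basis_open[OF \<B>(2) that] by simp
      fix W :: "'b set" and x assume "openin euclidean W \<and> x \<in> W"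
      then have "open W" "x \<in> W" by simp_all
      then show "\<exists>V\<in>\<B>. x \<in> V \<and> V \<subseteq> W"
        by (rule topological_basisE[OF \<B>(2)]) blast
    qed (rule \<B>(1))
    then show ?thesis using homeomorphic_space_second_countability[OF hs] by simp
  qed
  moreover have "sets M = sigma_sets (topspace ?T) {W. openin ?T W}"
  proof -
    have "vimage_algebra (range e) (inv_into UNIV e) (borel :: 'b measure) =
        sigma (range e) {inv_into UNIV e -` A \<inter> range e |A. A \<in> {S. open S}}"
      unfolding borel_def by (rule vimage_algebra_sigma) auto
    moreover have "{inv_into UNIV e -` A \<inter> range e |A. A \<in> {S. open S}} = {W. openin ?T W}"
      by (auto simp: openin_pullback_topology)
    moreover have "{W. openin ?T W} \<subseteq> Pow (range e)" using openin_subset[of ?T] top by auto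
    ultimately show ?thesis unfolding M top by (metis sets_measure_of)
  qed
  moreover have "space M = topspace ?T"
    using sets_eq_imp_space_eq[OF M] by (simp add: top)
  ultimately show ?thesis unfolding standard_borel_def by blast
qed

text \<open>The factor is the shift on sequences indexed by \<open>\<Gamma> \<times> \<nat>\<close>, transported to the reals by an injection.\<close>

lemma standard_factor:
  fixes G :: "'g monoid" (structure) and X :: "'y measure" and f :: "nat \<Rightarrow> 'y \<Rightarrow> nat"
  assumes X: "pmp_action G X a" and G: "countable (carrier G)"
    and f: "\<And>k. f k \<in> X \<rightarrow>\<^sub>M count_space UNIV"
  obtains Z :: "real measure" and aZ \<psi> h
  where "standard_borel Z" "factor_map G X a Z aZ \<psi>" "\<And>k. h k \<in> Z \<rightarrow>\<^sub>M count_space (UNIV :: nat set)"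
    "\<And>k x. x \<in> space X \<Longrightarrow> h k (\<psi> x) = f k x"
proof -
  note Xf = pmp_action_facts[OF X]
  interpret group G by (rule Xf)
  interpret X: prob_space X by (rule Xf)
  obtain e :: "(nat \<Rightarrow> real) \<Rightarrow> real" where e: "inj e" using inj_sequences_to_real ..
  define S where "S = carrier G \<times> (UNIV :: nat set)"
  define idx where "idx = to_nat_on S"
  define en where "en = from_nat_into S"
  \<comment> \<open>The component \<open>nat\<close> makes the index set infinite even for a finite
    group, so \<open>idx\<close> and \<open>en\<close> are inverse bijections with all of
    \<open>nat\<close>.\<close>
  have "infinite S" unfolding S_def by (auto simp: finite_cartesian_product_iff)
  moreover have cS: "countable S" unfolding S_def using G by auto
  ultimately have idx_en: "idx (en n) = n" and en_idx: "s \<in> S \<Longrightarrow> en (idx s) = s" and enS: "en n \<in> S" for n s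
    unfolding idx_def en_def by (auto intro!: from_nat_into)
  have enG: "fst (en n) \<in> carrier G" for n using enS[of n] by (auto simp: S_def)
  \<comment> \<open>The itinerary of x: the coordinate with index (h, k) is \<open>f k\<close> at
    the translate of x by the inverse of h. Translating x shifts the sequence, exactly and at every
    point.\<close>
  define \<psi>0 :: "'y \<Rightarrow> nat \<Rightarrow> real" where "\<psi>0 x n = real (f (snd (en n)) (a (inv fst (en n)) x))" for x n
  define a0 :: "'g \<Rightarrow> (nat \<Rightarrow> real) \<Rightarrow> nat \<Rightarrow> real"
    where "a0 g u n = u (idx (inv g \<otimes> fst (en n), snd (en n)))" for g u n
  have \<psi>0m: "\<psi>0 \<in> borel_measurable X"
  proof (rule measurable_coordinatewise_then_product)
    fix n
    have "(\<lambda>x. f (snd (en n)) (a (inv fst (en n)) x)) \<in> X \<rightarrow>\<^sub>M count_space UNIV"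
      by (rule measurable_compose[OF Xf(3) f]) (use enG in simp)
    then show "(\<lambda>x. \<psi>0 x n) \<in> borel_measurable X" unfolding \<psi>0_def by measurable
  qed
  have a0m: "a0 g \<in> borel_measurable borel" for g
  proof (rule measurable_coordinatewise_then_product)
    show "(\<lambda>u. a0 g u n) \<in> borel_measurable borel" for n
      unfolding a0_def by (rule measurable_product_coordinates)
  qed
  have a0_mult: "a0 (g \<otimes> h) u = a0 g (a0 h u)" if "g \<in> carrier G" "h \<in> carrier G" for g h u
    using that enG by (auto simp: a0_def fun_eq_iff en_idx S_def inv_mult_group m_assoc)
  have a0_one: "a0 \<one> u = u" for u
    using enG by (auto simp: a0_def fun_eq_iff idx_en)
  have \<psi>0_eq: "\<psi>0 (a g x) = a0 g (\<psi>0 x)" if g: "g \<in> carrier G" and x: "x \<in> space X" for g x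
  proof
    fix n
    have "(inv g \<otimes> fst (en n), snd (en n)) \<in> S" using g enG by (simp add: S_def)
    then have "a0 g (\<psi>0 x) n = real (f (snd (en n)) (a (inv (inv g \<otimes> fst (en n))) x))"
      by (simp add: a0_def \<psi>0_def en_idx)
    also have "\<dots> = \<psi>0 (a g x) n"
      using g x enG by (simp add: \<psi>0_def inv_mult_group Xf(7))
    finally show "\<psi>0 (a g x) n = a0 g (\<psi>0 x) n" ..
  qed
  define V where "V = vimage_algebra (range e) (inv_into UNIV e) (borel :: (nat \<Rightarrow> real) measure)"
  define \<psi> where "\<psi> x = e (\<psi>0 x)" for x
  define Z where "Z = distr X V \<psi>"
  define aZ where "aZ g = (\<lambda>z\<in>range e. e (a0 g (inv_into UNIV e z)))" for g
  have sV: "space V = range e" by (simp add: V_def)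
  have sets_Z: "sets Z = sets V" and sZ: "space Z = range e" by (simp_all add: Z_def sV)
  have inv_m: "inv_into UNIV e \<in> V \<rightarrow>\<^sub>M borel" unfolding V_def by (rule measurable_vimage_algebra1) simp
  have \<psi>m: "\<psi> \<in> X \<rightarrow>\<^sub>M V"
    unfolding V_def by (rule measurable_vimage_algebra2) (use e \<psi>0m in \<open>auto simp: \<psi>_def\<close>)
  have aZm: "aZ g \<in> V \<rightarrow>\<^sub>M V" for g
  proof -
    have "(\<lambda>z. e (a0 g (inv_into UNIV e z))) \<in> V \<rightarrow>\<^sub>M vimage_algebra (range e) (inv_into UNIV e) borel"
      by (rule measurable_vimage_algebra2) (use e measurable_compose[OF inv_m a0m] in auto)
    then show ?thesis
      unfolding V_def[symmetric] by (rule measurable_cong[THEN iffD1, rotated]) (simp add: aZ_def sV)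
  qed
  have aZ_\<psi>: "aZ g (\<psi> x) = \<psi> (a g x)" if "g \<in> carrier G" "x \<in> space X" for g x
    using \<psi>0_eq[OF that] e by (simp add: aZ_def \<psi>_def)
  have pmp: "pmp_action G Z aZ"
    unfolding pmp_action_def measure_preserving_map_def
  proof (intro conjI ballI)
    show "prob_space Z" unfolding Z_def by (rule X.prob_space_distr[OF \<psi>m])
    show "group_action G (space Z) aZ"
    proof (rule group_actionI)
      show "group G" by unfold_locales
      show "aZ g \<in> extensional (space Z)" for g by (simp add: aZ_def sZ)
      show "aZ g z \<in> space Z" if "z \<in> space Z" for g z using that by (auto simp: aZ_def sZ)
      show "aZ \<one> z = z" if "z \<in> space Z" for z
        using that e by (auto simp: aZ_def sZ a0_one)
      show "aZ (g \<otimes> h) z = aZ g (aZ h z)" if "g \<in> carrier G" "h \<in> carrier G" "z \<in> space Z" for g h z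
        using that e by (auto simp: aZ_def sZ a0_mult)
    qed
    fix g assume g: "g \<in> carrier G"
    show "aZ g \<in> Z \<rightarrow>\<^sub>M Z" using aZm by (simp add: Z_def)
    have "distr Z Z (aZ g) = distr X V (aZ g \<circ> \<psi>)"
      unfolding Z_def by (simp add: distr_distr aZm \<psi>m cong: distr_cong)
    also have "\<dots> = distr X V (\<psi> \<circ> a g)"
      by (rule distr_cong) (auto simp: aZ_\<psi>[OF g])
    also have "\<dots> = distr (distr X X (a g)) V \<psi>" by (simp add: distr_distr Xf(3)[OF g] \<psi>m)
    also have "\<dots> = Z" unfolding Xf(4)[OF g] Z_def ..
    finally show "distr Z Z (aZ g) = Z" .
  qed
  have fm: "factor_map G X a Z aZ \<psi>"
    unfolding factor_map_def measure_preserving_map_def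
  proof (intro conjI ballI X pmp)
    show "\<psi> \<in> X \<rightarrow>\<^sub>M Z" using \<psi>m by (simp add: Z_def)
    show "distr X Z \<psi> = Z" by (simp add: Z_def cong: distr_cong)
    show "AE x in X. \<psi> (a g x) = aZ g (\<psi> x)" if "g \<in> carrier G" for g
      by (rule AE_I2) (simp add: aZ_\<psi>[OF that])
  qed
  have sb: "standard_borel Z" by (rule standard_borel_vimage[OF e]) (simp add: sets_Z V_def)
  define h where "h k z = nat \<lfloor>inv_into UNIV e z (idx (\<one>, k))\<rfloor>" for k z
  show thesis
  proof (rule that[OF sb fm])
    fix k
    have "(\<lambda>z. inv_into UNIV e z (idx (\<one>, k))) \<in> borel_measurable V"
      using measurable_compose[OF inv_m measurable_product_coordinates] by simp
    then show "h k \<in> Z \<rightarrow>\<^sub>M count_space UNIV"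
      unfolding h_def Z_def by simp
    fix x assume "x \<in> space X"
    then show "h k (\<psi> x) = f k x" using e by (simp add: h_def \<psi>_def \<psi>0_def en_idx S_def Xf(6))
  qed
qed

text \<open>For a set \<open>A\<close> of positive measure, \<epsilon> is taken to be that measure;
  then the collisions cannot fill \<open>A\<close>, and \<open>separated_piece\<close> applies. It
  matters that the separating functions are measurable over \<open>Z\<close>.\<close>

lemma free_factor:
  fixes G :: "'g monoid" (structure)
  assumes \<psi>: "factor_map G X a Z aZ \<psi>"
    and sep: "\<And>g \<epsilon>. g \<in> carrier G \<Longrightarrow> g \<noteq> \<one> \<Longrightarrow> 0 < \<epsilon> \<Longrightarrow>
      \<exists>\<gamma> \<in> Z \<rightarrow>\<^sub>M count_space (UNIV :: nat set).
        measure X {x \<in> space X. \<gamma> (\<psi> x) = \<gamma> (\<psi> (a (inv g) x))} < \<epsilon>"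
  shows "free_pmp_action G Z aZ"
  unfolding free_pmp_action_def
proof (intro conjI ballI impI)
  have X: "pmp_action G X a" and Z: "pmp_action G Z aZ" and \<psi>m: "\<psi> \<in> X \<rightarrow>\<^sub>M Z" "distr X Z \<psi> = Z"
    and eqv: "\<And>g. g \<in> carrier G \<Longrightarrow> AE x in X. \<psi> (a g x) = aZ g (\<psi> x)"
    using \<psi> by (auto simp: factor_map_def measure_preserving_map_def)
  show "pmp_action G Z aZ" by (rule Z)
  interpret group G by (rule pmp_action_facts[OF Z])
  interpret X: prob_space X by (rule pmp_action_facts[OF X])
  interpret Z: prob_space Z by (rule pmp_action_facts[OF Z])
  fix g A assume g: "g \<in> carrier G" "g \<noteq> \<one>" and A: "A \<in> sets Z" "0 < measure Z A"
  have i: "inv g \<in> carrier G" using g by simp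
  obtain \<gamma> where \<gamma>: "\<gamma> \<in> Z \<rightarrow>\<^sub>M count_space (UNIV :: nat set)"
    and small: "measure X {x \<in> space X. \<gamma> (\<psi> x) = \<gamma> (\<psi> (a (inv g) x))} < measure Z A"
    using sep[OF g A(2)] by blast
  have \<gamma>g: "(\<lambda>z. \<gamma> (aZ (inv g) z)) \<in> Z \<rightarrow>\<^sub>M count_space UNIV"
    by (rule measurable_compose[OF pmp_action_facts(3)[OF Z i] \<gamma>])
  have S: "{z \<in> space Z. \<gamma> z = \<gamma> (aZ (inv g) z)} \<in> sets Z" by (rule sets_eq_fun[OF \<gamma> \<gamma>g])
  have \<gamma>\<psi>: "(\<lambda>x. \<gamma> (\<psi> x)) \<in> X \<rightarrow>\<^sub>M count_space UNIV" by (rule measurable_compose[OF \<psi>m(1) \<gamma>])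
  have "measure Z {z \<in> A. \<gamma> z = \<gamma> (aZ (inv g) z)} \<le> measure Z {z \<in> space Z. \<gamma> z = \<gamma> (aZ (inv g) z)}"
    using sets.sets_into_space[OF A(1)] by (intro Z.finite_measure_mono S) auto
  also have "\<dots> = measure X (\<psi> -` {z \<in> space Z. \<gamma> z = \<gamma> (aZ (inv g) z)} \<inter> space X)"
    using measure_distr[OF \<psi>m(1) S] \<psi>m(2) by simp
  also have "\<dots> = measure X {x \<in> space X. \<gamma> (\<psi> x) = \<gamma> (\<psi> (a (inv g) x))}"
  proof (rule measure_eq_AE)
    show "AE x in X. x \<in> \<psi> -` {z \<in> space Z. \<gamma> z = \<gamma> (aZ (inv g) z)} \<inter> space X \<longleftrightarrow>
        x \<in> {x \<in> space X. \<gamma> (\<psi> x) = \<gamma> (\<psi> (a (inv g) x))}"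
      using eqv[OF i] AE_space
      by eventually_elim (use measurable_space[OF \<psi>m(1)] in auto)
    show "\<psi> -` {z \<in> space Z. \<gamma> z = \<gamma> (aZ (inv g) z)} \<inter> space X \<in> sets X"
      by (rule measurable_sets[OF \<psi>m(1) S])
    show "{x \<in> space X. \<gamma> (\<psi> x) = \<gamma> (\<psi> (a (inv g) x))} \<in> sets X"
      by (rule sets_eq_fun[OF \<gamma>\<psi> measurable_compose[OF pmp_action_facts(3)[OF X i] \<gamma>\<psi>]])
  qed
  finally have "measure Z {z \<in> A. \<gamma> z = \<gamma> (aZ (inv g) z)} < measure Z A" using small by simp
  then show "\<exists>B\<in>sets Z. B \<subseteq> A \<and> 0 < measure Z B \<and> measure Z (B \<inter> aZ g ` B) = 0"
    by (rule separated_piece[OF Z g(1) A(1) \<gamma>])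
qed

section \<open>Approximation and transfer of statistics\<close>

lemma (in finite_measure) measure_diff_le_AE:
  assumes E: "E \<in> sets M" "E' \<in> sets M" and W: "W \<in> sets M"
    and AE: "AE x in M. x \<notin> W \<longrightarrow> (x \<in> E \<longleftrightarrow> x \<in> E')"
  shows "\<bar>measure M E - measure M E'\<bar> \<le> measure M W"
proof -
  have "measure M B \<le> measure M C + measure M W"
    if "B \<in> sets M" "C \<in> sets M" "AE x in M. x \<notin> W \<longrightarrow> (x \<in> B \<longleftrightarrow> x \<in> C)" for B C
  proof -
    have "measure M B \<le> measure M (C \<union> W)"
    proof (rule finite_measure_mono_AE)
      show "AE x in M. x \<in> B \<longrightarrow> x \<in> C \<union> W" using that(3) by eventually_elim blast
    qed (use that W in auto)
    also have "\<dots> \<le> measure M C + measure M W" by (rule measure_Un_le) (use that W in auto)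
    finally show ?thesis .
  qed
  from this[OF E AE] this[OF E(2,1)] AE show ?thesis by (simp add: eq_commute abs_le_iff)
qed

text \<open>The event for sheet j changes only where \<beta> changes, or where some colouring
  changes at the translate by \<open>inv f\<close>, on the sheet below D that j has reached. This is
  one set and \<open>card F * D\<close> translated sets, each of measure at most \<delta>. Their
  union \<open>W0\<close> serves all j, so averaging over the sheets keeps the bound.\<close>

lemma sheet_stat_perturb:
  fixes G (structure)
  assumes M: "pmp_action G M a" and F: "finite F" "F \<subseteq> carrier G" and D: "0 < D"
    and s: "\<And>g. g \<in> carrier G \<Longrightarrow> s g \<in> M \<rightarrow>\<^sub>M perms D"
      "\<And>g. g \<in> carrier G \<Longrightarrow> s' g \<in> M \<rightarrow>\<^sub>M perms D"
    and A: "\<And>j. A j \<in> M \<rightarrow>\<^sub>M count_space {..<p::nat}" "\<And>j. A' j \<in> M \<rightarrow>\<^sub>M count_space {..<p}"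
    and \<beta>: "\<beta> \<in> M \<rightarrow>\<^sub>M count_space {..<q::nat}" "\<beta>' \<in> M \<rightarrow>\<^sub>M count_space {..<q}"
    and ss: "\<And>g. g \<in> carrier G \<Longrightarrow> AE x in M. s g x = s' g x"
    and AA: "\<And>j. measure M {x \<in> space M. A j x \<noteq> A' j x} \<le> \<delta>"
    and \<beta>\<beta>: "measure M {x \<in> space M. \<beta> x \<noteq> \<beta>' x} \<le> \<delta>"
  shows "\<bar>sheet_stat G M a F D s A \<beta> \<pi> r - sheet_stat G M a F D s' A' \<beta>' \<pi> r\<bar> \<le> (1 + real (card F * D)) * \<delta>"
proof -
  note Mf = pmp_action_facts[OF M]
  interpret group G by (rule Mf)
  interpret M: prob_space M by (rule Mf)
  have iF: "inv f \<in> carrier G" if "f \<in> F" for f using F that by auto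
  have ne: "{x \<in> space M. f x \<noteq> g x} \<in> sets M"
    if "f \<in> M \<rightarrow>\<^sub>M count_space {..<k}" "g \<in> M \<rightarrow>\<^sub>M count_space {..<k}" for f g and k :: nat
    using sets_eq_fun[OF measurable_count_space_UNIV[OF that(1)] measurable_count_space_UNIV[OF that(2)]]
    by (rule sets.sets_Collect_neg)
  define W where "W f j = a (inv f) -` {x \<in> space M. A j x \<noteq> A' j x} \<inter> space M" for f j
  have Wm: "W f j \<in> sets M" if "f \<in> F" for f j
    unfolding W_def by (rule measurable_sets[OF Mf(3)[OF iF[OF that]] ne[OF A]])
  have W: "measure M (W f j) \<le> \<delta>" if "f \<in> F" for f j
    using AA[of j] measure_distr[OF Mf(3)[OF iF[OF that]] ne[OF A]] Mf(4)[OF iF[OF that]]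
    by (simp add: W_def)
  define W0 where "W0 = {x \<in> space M. \<beta> x \<noteq> \<beta>' x} \<union> (\<Union>(f, j)\<in>F \<times> {..<D}. W f j)"
  have Um: "(\<Union>(f, j)\<in>F \<times> {..<D}. W f j) \<in> sets M"
    using F(1) Wm by (intro sets.finite_UN) auto
  have W0m: "W0 \<in> sets M" unfolding W0_def using Um ne[OF \<beta>] by (rule sets.Un[rotated])
  have "measure M W0 \<le> measure M {x \<in> space M. \<beta> x \<noteq> \<beta>' x} + measure M (\<Union>(f, j)\<in>F \<times> {..<D}. W f j)"
    unfolding W0_def by (rule measure_Un_le[OF ne[OF \<beta>] Um])
  also have "measure M (\<Union>(f, j)\<in>F \<times> {..<D}. W f j) \<le> (\<Sum>z\<in>F \<times> {..<D}. measure M (case z of (f, j) \<Rightarrow> W f j))"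
    by (rule M.finite_measure_subadditive_finite) (use F(1) Wm in auto)
  also have "\<dots> \<le> (\<Sum>z\<in>F \<times> {..<D}. \<delta>)" by (rule sum_mono) (use W in auto)
  also have "\<dots> = real (card F * D) * \<delta>" by (simp add: card_cartesian_product)
  finally have W0: "measure M W0 \<le> (1 + real (card F * D)) * \<delta>" using \<beta>\<beta> by (simp add: algebra_simps)
  let ?E = "\<lambda>s A \<beta>. sheet_event G M a F s A \<beta> \<pi> r"
  have each: "\<bar>measure M (?E s A \<beta> j) - measure M (?E s' A' \<beta>' j)\<bar> \<le> (1 + real (card F * D)) * \<delta>" if j: "j < D" for j
  proof (rule order_trans[OF M.measure_diff_le_AE W0])
    show "?E s A \<beta> j \<in> sets M" by (rule sheet_event_measurable[OF M F s(1) A(1) \<beta>(1)])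
    show "?E s' A' \<beta>' j \<in> sets M" by (rule sheet_event_measurable[OF M F s(2) A(2) \<beta>(2)])
    show "W0 \<in> sets M" by (rule W0m)
    have "AE x in M. \<forall>f\<in>F. s (inv f) x = s' (inv f) x"
      by (intro AE_finite_ball F(1) ss iF)
    then show "AE x in M. x \<notin> W0 \<longrightarrow> (x \<in> ?E s A \<beta> j \<longleftrightarrow> x \<in> ?E s' A' \<beta>' j)"
      using AE_space
    proof eventually_elim
      case (elim x)
      show ?case
      proof
        assume x: "x \<notin> W0"
        have "A (s (inv f) x j) (a (inv f) x) = A' (s' (inv f) x j) (a (inv f) x)" if f: "f \<in> F" for f
        proof -
          have "s' (inv f) x permutes {..<D}" using measurable_space[OF s(2)[OF iF[OF f]] elim(2)] by simp
          then have "s' (inv f) x j < D" using permutes_in_image[of _ "{..<D}" j] j by auto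
          then have "x \<notin> W f (s' (inv f) x j)" using x f by (auto simp: W0_def)
          then show ?thesis using elim f Mf(5)[OF iF[OF f] elim(2)] by (simp add: W_def)
        qed
        moreover have "\<beta> x = \<beta>' x" using x elim(2) by (auto simp: W0_def)
        ultimately show "x \<in> ?E s A \<beta> j \<longleftrightarrow> x \<in> ?E s' A' \<beta>' j"
          by (simp add: sheet_event_def)
      qed
    qed
  qed
  have "\<bar>(\<Sum>j<D. measure M (?E s A \<beta> j)) - (\<Sum>j<D. measure M (?E s' A' \<beta>' j))\<bar> \<le>
      (\<Sum>j<D. \<bar>measure M (?E s A \<beta> j) - measure M (?E s' A' \<beta>' j)\<bar>)"
    unfolding sum_subtractf[symmetric] by (rule sum_abs)
  also have "\<dots> \<le> (\<Sum>j<D. (1 + real (card F * D)) * \<delta>)" by (rule sum_mono) (use each in simp)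
  also have "\<dots> = D * ((1 + real (card F * D)) * \<delta>)" by simp
  finally have "\<bar>(\<Sum>j<D. measure M (?E s A \<beta> j)) - (\<Sum>j<D. measure M (?E s' A' \<beta>' j))\<bar> / D \<le> (1 + real (card F * D)) * \<delta>"
    using D by (simp add: divide_le_eq mult.commute)
  then show ?thesis unfolding sheet_stat_def by (simp add: diff_divide_distrib[symmetric])
qed

lemma joint_dist_perturb:
  assumes M: "pmp_action G M a" and F: "finite F" "F \<subseteq> carrier G"
    and \<alpha>: "\<alpha> \<in> M \<rightarrow>\<^sub>M count_space {..<p::nat}"
    and \<beta>: "\<beta> \<in> M \<rightarrow>\<^sub>M count_space {..<q::nat}" "\<beta>' \<in> M \<rightarrow>\<^sub>M count_space {..<q}"
    and \<beta>\<beta>: "measure M {x \<in> space M. \<beta> x \<noteq> \<beta>' x} \<le> \<delta>"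
  shows "\<bar>joint_dist G M a F \<alpha> \<beta> \<pi> r - joint_dist G M a F \<alpha> \<beta>' \<pi> r\<bar> \<le> \<delta>"
proof -
  interpret M: prob_space M by (rule pmp_action_facts[OF M])
  show ?thesis
    unfolding joint_dist_def
  proof (rule order_trans[OF M.measure_diff_le_AE \<beta>\<beta>])
    show "{x \<in> space M. \<beta> x \<noteq> \<beta>' x} \<in> sets M"
      using sets_eq_fun[OF measurable_count_space_UNIV[OF \<beta>(1)] measurable_count_space_UNIV[OF \<beta>(2)]]
      by (rule sets.sets_Collect_neg)
  qed (use sets_shift_name[OF M F \<alpha>] \<beta> in \<open>auto intro!: AE_I2\<close>)
qed

lemma sheet_stat_pullback:
  fixes G (structure)
  assumes \<psi>: "factor_map G X a Z aZ \<psi>" and F: "finite F" "F \<subseteq> carrier G"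
    and s: "\<And>g. g \<in> carrier G \<Longrightarrow> s g \<in> Z \<rightarrow>\<^sub>M perms D"
    and A: "\<And>j. A j \<in> Z \<rightarrow>\<^sub>M count_space P" and \<beta>: "\<beta> \<in> Z \<rightarrow>\<^sub>M count_space Q"
  shows "sheet_stat G X a F D (\<lambda>g x. s g (\<psi> x)) (\<lambda>j x. A j (\<psi> x)) (\<beta> \<circ> \<psi>) \<pi> r = sheet_stat G Z aZ F D s A \<beta> \<pi> r"
proof -
  have X: "pmp_action G X a" and Z: "pmp_action G Z aZ" and \<psi>m: "\<psi> \<in> X \<rightarrow>\<^sub>M Z" "distr X Z \<psi> = Z"
    and eqv: "\<And>g. g \<in> carrier G \<Longrightarrow> AE x in X. \<psi> (a g x) = aZ g (\<psi> x)"
    using \<psi> by (auto simp: factor_map_def measure_preserving_map_def)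
  interpret group G by (rule pmp_action_facts[OF Z])
  have iF: "inv f \<in> carrier G" if "f \<in> F" for f using F that by auto
  have "measure X (sheet_event G X a F (\<lambda>g x. s g (\<psi> x)) (\<lambda>j x. A j (\<psi> x)) (\<beta> \<circ> \<psi>) \<pi> r j) =
      measure Z (sheet_event G Z aZ F s A \<beta> \<pi> r j)" (is "measure X ?E = measure Z ?E'") for j
  proof -
    have E': "?E' \<in> sets Z" by (rule sheet_event_measurable[OF Z F s A \<beta>])
    have "?E \<in> sets X"
      by (rule sheet_event_measurable[OF X F measurable_compose[OF \<psi>m(1) s]
          measurable_compose[OF \<psi>m(1) A] measurable_comp[OF \<psi>m(1) \<beta>]])
    then have "measure X ?E = measure X (\<psi> -` ?E' \<inter> space X)"
    proof (rule measure_eq_AE[rotated])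
      show "\<psi> -` ?E' \<inter> space X \<in> sets X" by (rule measurable_sets[OF \<psi>m(1) E'])
      have "AE x in X. \<forall>f\<in>F. \<psi> (a (inv f) x) = aZ (inv f) (\<psi> x)"
        by (intro AE_finite_ball F(1) eqv iF)
      then show "AE x in X. x \<in> ?E \<longleftrightarrow> x \<in> \<psi> -` ?E' \<inter> space X"
        using AE_space
        by eventually_elim (use measurable_space[OF \<psi>m(1)] in \<open>auto simp: sheet_event_def\<close>)
    qed
    also have "\<dots> = measure Z ?E'" using measure_distr[OF \<psi>m(1) E'] \<psi>m(2) by simp
    finally show ?thesis .
  qed
  then show ?thesis unfolding sheet_stat_def by simp
qed

lemma factor_map_comp:
  assumes \<phi>: "factor_map G N b X a \<phi>" and \<psi>: "factor_map G X a Z aZ \<psi>"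
  shows "factor_map G N b Z aZ (\<psi> \<circ> \<phi>)"
proof -
  have m: "\<phi> \<in> N \<rightarrow>\<^sub>M X" "distr N X \<phi> = X" "\<psi> \<in> X \<rightarrow>\<^sub>M Z" "distr X Z \<psi> = Z"
    and e: "\<And>g. g \<in> carrier G \<Longrightarrow> AE y in N. \<phi> (b g y) = a g (\<phi> y)"
      "\<And>g. g \<in> carrier G \<Longrightarrow> AE x in X. \<psi> (a g x) = aZ g (\<psi> x)"
    using \<phi> \<psi> by (auto simp: factor_map_def measure_preserving_map_def)
  have "AE y in N. (\<psi> \<circ> \<phi>) (b g y) = aZ g ((\<psi> \<circ> \<phi>) y)" if g: "g \<in> carrier G" for g
  proof -
    have "AE y in N. \<psi> (a g (\<phi> y)) = aZ g (\<psi> (\<phi> y))"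
      using e(2)[OF g] by (subst (asm) m(2)[symmetric]) (rule AE_distrD[OF m(1)])
    with e(1)[OF g] show ?thesis by eventually_elim simp
  qed
  moreover have "distr N Z (\<psi> \<circ> \<phi>) = Z"
    using distr_distr[OF m(3,1)] m(2,4) by simp
  ultimately show ?thesis
    using \<phi> \<psi> measurable_comp[OF m(1,3)] by (auto simp: factor_map_def measure_preserving_map_def)
qed

section \<open>Statistics, separation and cocycles in the ultraproduct\<close>

context ultraproduct_of_actions
begin

lemma tendsto_sheet_stat:
  assumes F: "finite F" "F \<subseteq> carrier G" and D: "0 < D"
    and s: "\<And>i g. g \<in> carrier G \<Longrightarrow> s i g \<in> M i \<rightarrow>\<^sub>M perms D"
    and A: "\<And>i j. A i j \<in> M i \<rightarrow>\<^sub>M count_space {..<p::nat}" and \<beta>: "\<And>i. \<beta> i \<in> M i \<rightarrow>\<^sub>M count_space {..<q::nat}"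
  shows "((\<lambda>i. sheet_stat G (M i) (a i) F D (s i) (A i) (\<beta> i) \<pi> r) \<longlongrightarrow>
    sheet_stat G X ua F D (\<lambda>g. ultra_fun U (\<lambda>i. s i g)) (\<lambda>j. ultra_fun U (\<lambda>i. A i j)) (ultra_fun U \<beta>) \<pi> r) U"
  unfolding sheet_stat_def
proof (intro tendsto_divide tendsto_sum tendsto_const)
  have iF: "inv f \<in> carrier G" if "f \<in> F" for f using F that by auto
  have finP: "finite {\<pi>. \<pi> permutes {..<D}}" by (rule finite_permutations) simp
  have sP: "s i g \<in> space (M i) \<rightarrow> {\<pi>. \<pi> permutes {..<D}}" if "g \<in> carrier G" for i g
    using measurable_space[OF s[OF that]] by auto
  have Ap: "A i j \<in> space (M i) \<rightarrow> {..<p}" for i j using measurable_space[OF A] by auto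
  have \<beta>q: "\<beta> i \<in> space (M i) \<rightarrow> {..<q}" for i using measurable_space[OF \<beta>] by auto
  fix j assume j: "j \<in> {..<D}"
  have "sheet_event G X ua F (\<lambda>g. ultra_fun U (\<lambda>i. s i g)) (\<lambda>j. ultra_fun U (\<lambda>i. A i j)) (ultra_fun U \<beta>) \<pi> r j =
      ultra_set U (\<lambda>i. sheet_event G (M i) (a i) F (s i) (A i) (\<beta> i) \<pi> r j)"
    unfolding sheet_event_def
  proof (rule internal_Collect)
    fix x assume x: "\<And>i. x i \<in> space (M i)"
    have 1: "\<forall>\<^sub>F i in U. \<forall>f\<in>F. s i (inv f) (x i) = ultra_fun U (\<lambda>i. s i (inv f)) (ultra_class U x)"
      by (rule eventually_ball_finite[OF F(1)]) (intro ballI ultra_fun_class(1)[OF finP sP x] iF)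
    \<comment> \<open>The sheet number is frozen at its limit value, which it takes for U-almost all
      i; what remains is a single sequence of finite-valued functions, to which
      \<open>ultra_fun_class\<close> applies.\<close>
    have 2: "\<forall>\<^sub>F i in U. \<forall>f\<in>F. A i (ultra_fun U (\<lambda>i. s i (inv f)) (ultra_class U x) j) (a i (inv f) (x i)) =
        ultra_fun U (\<lambda>i. A i (ultra_fun U (\<lambda>i. s i (inv f)) (ultra_class U x) j)) (ua (inv f) (ultra_class U x))"
    proof (rule eventually_ball_finite[OF F(1)], intro ballI)
      fix f assume f: "f \<in> F"
      have ax: "a i (inv f) (x i) \<in> space (M i)" for i by (rule act_facts(5)[OF iF[OF f] x])
      show "\<forall>\<^sub>F i in U. A i (ultra_fun U (\<lambda>i. s i (inv f)) (ultra_class U x) j) (a i (inv f) (x i)) =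
        ultra_fun U (\<lambda>i. A i (ultra_fun U (\<lambda>i. s i (inv f)) (ultra_class U x) j)) (ua (inv f) (ultra_class U x))"
        unfolding act_class[OF x iF[OF f]]
        by (rule ultra_fun_class(1)[OF finite_lessThan Ap ax])
    qed
    have 3: "\<forall>\<^sub>F i in U. \<beta> i (x i) = ultra_fun U \<beta> (ultra_class U x)"
      by (rule ultra_fun_class(1)[OF finite_lessThan \<beta>q x])
    show "\<forall>\<^sub>F i in U. ((\<forall>f\<in>F. A i (s i (inv f) (x i) j) (a i (inv f) (x i)) = \<pi> f) \<and> \<beta> i (x i) = r) =
      ((\<forall>f\<in>F. ultra_fun U (\<lambda>i. A i (ultra_fun U (\<lambda>i. s i (inv f)) (ultra_class U x) j)) (ua (inv f) (ultra_class U x)) = \<pi> f) \<and>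
        ultra_fun U \<beta> (ultra_class U x) = r)"
      using 1 2 3 by eventually_elim simp
  qed
  then show "((\<lambda>i. measure (M i) (sheet_event G (M i) (a i) F (s i) (A i) (\<beta> i) \<pi> r j)) \<longlongrightarrow>
    measure X (sheet_event G X ua F (\<lambda>g. ultra_fun U (\<lambda>i. s i g)) (\<lambda>j. ultra_fun U (\<lambda>i. A i j))
      (ultra_fun U \<beta>) \<pi> r j)) U"
    using tendsto_internal[OF sheet_event_measurable[OF act F s A \<beta>]] by simp
next
  show "real D \<noteq> 0" using D by simp
qed

lemma tendsto_joint_dist:
  assumes F: "finite F" "F \<subseteq> carrier G" and \<pi>: "\<pi> \<in> extensional F"
    and \<alpha>: "\<And>i. \<alpha> i \<in> M i \<rightarrow>\<^sub>M count_space {..<p::nat}" and \<beta>: "\<And>i. \<beta> i \<in> M i \<rightarrow>\<^sub>M count_space {..<q::nat}"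
  shows "((\<lambda>i. joint_dist G (M i) (a i) F (\<alpha> i) (\<beta> i) \<pi> r) \<longlongrightarrow>
    joint_dist G X ua F (ultra_fun U \<alpha>) (ultra_fun U \<beta>) \<pi> r) U"
proof -
  have iF: "inv f \<in> carrier G" if "f \<in> F" for f using F that by auto
  have \<alpha>p: "\<alpha> i \<in> space (M i) \<rightarrow> {..<p}" for i using measurable_space[OF \<alpha>] by auto
  have \<beta>q: "\<beta> i \<in> space (M i) \<rightarrow> {..<q}" for i using measurable_space[OF \<beta>] by auto
  have "{c \<in> space X. shift_name G ua F (ultra_fun U \<alpha>) c = \<pi> \<and> ultra_fun U \<beta> c = r} =
      ultra_set U (\<lambda>i. {y \<in> space (M i). shift_name G (a i) F (\<alpha> i) y = \<pi> \<and> \<beta> i y = r})"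
    unfolding shift_name_eq_iff[OF \<pi>]
  proof (rule internal_Collect)
    fix x assume x: "\<And>i. x i \<in> space (M i)"
    have 1: "\<forall>\<^sub>F i in U. \<forall>f\<in>F. \<alpha> i (a i (inv f) (x i)) = ultra_fun U \<alpha> (ua (inv f) (ultra_class U x))"
    proof (rule eventually_ball_finite[OF F(1)], intro ballI)
      fix f assume f: "f \<in> F"
      show "\<forall>\<^sub>F i in U. \<alpha> i (a i (inv f) (x i)) = ultra_fun U \<alpha> (ua (inv f) (ultra_class U x))"
        unfolding act_class[OF x iF[OF f]]
        by (rule ultra_fun_class(1)[OF finite_lessThan \<alpha>p act_facts(5)[OF iF[OF f] x]])
    qed
    have 2: "\<forall>\<^sub>F i in U. \<beta> i (x i) = ultra_fun U \<beta> (ultra_class U x)"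
      by (rule ultra_fun_class(1)[OF finite_lessThan \<beta>q x])
    show "\<forall>\<^sub>F i in U. ((\<forall>f\<in>F. \<alpha> i (a i (inv f) (x i)) = \<pi> f) \<and> \<beta> i (x i) = r) =
      ((\<forall>f\<in>F. ultra_fun U \<alpha> (ua (inv f) (ultra_class U x)) = \<pi> f) \<and> ultra_fun U \<beta> (ultra_class U x) = r)"
      using 1 2 by eventually_elim simp
  qed
  then show ?thesis
    unfolding joint_dist_def using tendsto_internal[OF sets_shift_name[OF act F \<alpha> \<beta>]] by simp
qed

text \<open>The number of colours depends on \<epsilon> and not on the index i; this uniformity lets
  the colourings pass to the ultraproduct.\<close>

lemma ultra_separates:
  assumes ec: "\<And>i. ec_action G (M i) (a i)" and g: "g \<in> carrier G" "g \<noteq> \<one>" and \<epsilon>: "0 < \<epsilon>"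
  shows "\<exists>\<gamma> \<in> X \<rightarrow>\<^sub>M count_space (UNIV :: nat set). measure X {c \<in> space X. \<gamma> c = \<gamma> (ua (inv g) c)} < \<epsilon>"
proof -
  have ig: "inv g \<in> carrier G" using g by simp
  \<comment> \<open>One third of \<epsilon> for 1/p, one third for the slack in each factor; the
    last third restores the strict inequality that the limit may lose.\<close>
  obtain p :: nat where p: "3 / \<epsilon> < p" using reals_Archimedean2 by blast
  then have p0: "0 < p" using \<epsilon> by (cases p) auto
  define same where "same i \<gamma> = {x \<in> space (M i). \<gamma> x = \<gamma> (a i (inv g) x)}" for i and \<gamma> :: "'x \<Rightarrow> nat"
  have "\<forall>i. \<exists>\<gamma>. \<gamma> \<in> M i \<rightarrow>\<^sub>M count_space {..<p} \<and>
      measure (M i) (same i \<gamma>) < measure (M i) (space (M i)) / p + \<epsilon> / 3"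
  proof
    fix i
    have "0 < \<epsilon> / 3" using \<epsilon> by simp
    show "\<exists>\<gamma>. \<gamma> \<in> M i \<rightarrow>\<^sub>M count_space {..<p} \<and>
      measure (M i) (same i \<gamma>) < measure (M i) (space (M i)) / p + \<epsilon> / 3"
      unfolding same_def by (rule ec_action_separates[OF ec g sets.top p0 \<open>0 < \<epsilon> / 3\<close>]) blast
  qed
  from choice[OF this] obtain \<gamma> where \<gamma>: "\<And>i. \<gamma> i \<in> M i \<rightarrow>\<^sub>M count_space {..<p}"
    and less: "\<And>i. measure (M i) (same i (\<gamma> i)) < measure (M i) (space (M i)) / p + \<epsilon> / 3"
    by blast
  have \<gamma>p: "\<gamma> i \<in> space (M i) \<rightarrow> {..<p}" for i using measurable_space[OF \<gamma>] by auto
  have m: "ultra_fun U \<gamma> \<in> X \<rightarrow>\<^sub>M count_space {..<p}" by (rule ultra_fun_measurable[OF finite_lessThan \<gamma>])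
  have eq: "{c \<in> space X. ultra_fun U \<gamma> c = ultra_fun U \<gamma> (ua (inv g) c)} =
      ultra_set U (\<lambda>i. same i (\<gamma> i))"
    unfolding same_def
  proof (rule internal_Collect)
    fix x assume x: "\<And>i. x i \<in> space (M i)"
    show "\<forall>\<^sub>F i in U. (\<gamma> i (x i) = \<gamma> i (a i (inv g) (x i))) =
        (ultra_fun U \<gamma> (ultra_class U x) = ultra_fun U \<gamma> (ua (inv g) (ultra_class U x)))"
      using ultra_fun_class(1)[OF finite_lessThan \<gamma>p x]
        ultra_fun_class(1)[OF finite_lessThan \<gamma>p act_facts(5)[OF ig x]]
      unfolding act_class[OF x ig] by eventually_elim simp
  qed
  have sets: "same i (\<gamma> i) \<in> sets (M i)" for i
  proof -
    have "\<gamma> i \<in> M i \<rightarrow>\<^sub>M count_space UNIV" by (rule measurable_count_space_UNIV[OF \<gamma>])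
    from sets_eq_fun[OF this measurable_compose[OF act_facts(3)[OF ig] this]] show ?thesis unfolding same_def .
  qed
  have "measure X {c \<in> space X. ultra_fun U \<gamma> c = ultra_fun U \<gamma> (ua (inv g) c)} \<le> 1 / p + \<epsilon> / 3"
    unfolding eq
  proof (rule tendsto_upperbound[OF tendsto_internal[OF sets] _ ultrafilter_not_bot[OF U]])
    have "measure (M i) (same i (\<gamma> i)) \<le> 1 / p + \<epsilon> / 3" for i
      using less[of i] prob_space.prob_space[OF prob_space_factor, of i] by simp
    then show "\<forall>\<^sub>F i in U. measure (M i) (same i (\<gamma> i)) \<le> 1 / p + \<epsilon> / 3"
      by (rule always_eventually[OF allI])
  qed
  also have "1 / p + \<epsilon> / 3 < \<epsilon>"
  proof -
    have "1 / real p < \<epsilon> / 3" using p p0 \<epsilon> by (simp add: field_simps)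
    then show ?thesis using \<epsilon> by simp
  qed
  finally show ?thesis
    using measurable_count_space_UNIV[OF m] by (intro bexI[of _ "ultra_fun U \<gamma>"]) auto
qed

text \<open>The factor is generated by \<beta> and by one colouring for each group element and each
  bound 1/(n+1). Countably many functions keep it standard, and they are enough for
  \<open>free_factor\<close>.\<close>

lemma standard_free_factor:
  assumes ec: "\<And>i. ec_action G (M i) (a i)" and G: "countable (carrier G)"
    and \<beta>: "\<beta> \<in> X \<rightarrow>\<^sub>M count_space {..<q::nat}"
  obtains Z :: "real measure" and aZ \<psi> \<beta>Z
  where "standard_borel Z" "free_pmp_action G Z aZ" "factor_map G X ua Z aZ \<psi>"
    "\<beta>Z \<in> Z \<rightarrow>\<^sub>M count_space {..<q}" "\<And>c. c \<in> space X \<Longrightarrow> \<beta>Z (\<psi> c) = \<beta> c"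
proof -
  obtain c0 where "c0 \<in> space X" using X.not_empty by blast
  then have q: "0 < q" using measurable_space[OF \<beta>] by fastforce
  have "\<exists>\<gamma> \<in> X \<rightarrow>\<^sub>M count_space (UNIV :: nat set). g \<in> carrier G \<longrightarrow> g \<noteq> \<one> \<longrightarrow>
      measure X {c \<in> space X. \<gamma> c = \<gamma> (ua (inv g) c)} < inverse (real (Suc n))" for g n
    using ultra_separates[OF ec, of g "inverse (real (Suc n))"]
    by (cases "g \<in> carrier G \<and> g \<noteq> \<one>") (auto intro!: exI[of _ "\<lambda>_. 0 :: nat"])
  then have "\<forall>gn. \<exists>\<gamma>. \<gamma> \<in> X \<rightarrow>\<^sub>M count_space (UNIV :: nat set) \<and> (fst gn \<in> carrier G \<longrightarrow> fst gn \<noteq> \<one> \<longrightarrow>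
      measure X {c \<in> space X. \<gamma> c = \<gamma> (ua (inv fst gn) c)} < inverse (real (Suc (snd gn))))"
    by blast
  from choice[OF this] obtain \<gamma> where \<gamma>: "\<forall>gn. \<gamma> gn \<in> X \<rightarrow>\<^sub>M count_space (UNIV :: nat set) \<and> (fst gn \<in> carrier G \<longrightarrow> fst gn \<noteq> \<one> \<longrightarrow>
      measure X {c \<in> space X. \<gamma> gn c = \<gamma> gn (ua (inv fst gn) c)} < inverse (real (Suc (snd gn))))" ..
  define f where "f k = (case k of 0 \<Rightarrow> \<beta> | Suc m \<Rightarrow>
    \<gamma> (from_nat_into (carrier G) (fst (prod_decode m)), snd (prod_decode m)))" for k
  have fm: "f k \<in> X \<rightarrow>\<^sub>M count_space UNIV" for k
    using \<gamma> measurable_count_space_UNIV[OF \<beta>] by (cases k) (auto simp: f_def)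
  obtain Z :: "real measure" and aZ \<psi> h where sb: "standard_borel Z" and fac: "factor_map G X ua Z aZ \<psi>"
    and h: "\<And>k. h k \<in> Z \<rightarrow>\<^sub>M count_space (UNIV :: nat set)"
    and hf: "\<And>k c. c \<in> space X \<Longrightarrow> h k (\<psi> c) = f k c"
    by (rule standard_factor[OF ultra_act G fm]) (assumption | rule that)+
  have free: "free_pmp_action G Z aZ"
  proof (rule free_factor[OF fac])
    fix g and \<epsilon> :: real assume g: "g \<in> carrier G" "g \<noteq> \<one>" and \<epsilon>: "0 < \<epsilon>"
    obtain n where n: "inverse (real (Suc n)) < \<epsilon>" using reals_Archimedean[OF \<epsilon>] by blast
    define k where "k = Suc (prod_encode (to_nat_on (carrier G) g, n))"
    have fk: "f k = \<gamma> (g, n)" using g G by (simp add: f_def k_def)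
    have "{c \<in> space X. h k (\<psi> c) = h k (\<psi> (ua (inv g) c))} =
        {c \<in> space X. \<gamma> (g, n) c = \<gamma> (g, n) (ua (inv g) c)}"
      using pmp_action_facts(5)[OF ultra_act, of "inv g"] g by (auto simp: hf fk)
    then have "measure X {c \<in> space X. h k (\<psi> c) = h k (\<psi> (ua (inv g) c))} < \<epsilon>"
      using \<gamma>[rule_format, of "(g, n)"] g n by simp
    then show "\<exists>\<gamma>\<in>Z \<rightarrow>\<^sub>M count_space (UNIV :: nat set). measure X {x \<in> space X. \<gamma> (\<psi> x) = \<gamma> (\<psi> (ua (inv g) x))} < \<epsilon>"
      by (rule bexI[where x = "h k"]) (rule h)
  qed
  show thesis
  proof (rule that[OF sb free fac])
    \<comment> \<open>\<open>h 0\<close> is known to agree with \<beta> only along \<psi>; elsewhere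
      the default 0 keeps the values below q.\<close>
    show "(\<lambda>z. if h 0 z < q then h 0 z else 0) \<in> Z \<rightarrow>\<^sub>M count_space {..<q}"
      by (rule measurable_compose[OF h]) (use q in auto)
    show "(if h 0 (\<psi> c) < q then h 0 (\<psi> c) else 0) = \<beta> c" if "c \<in> space X" for c
      using measurable_space[OF \<beta> that] by (simp add: hf[OF that] f_def)
  qed
qed

text \<open>\<open>definable_cocycle_property\<close> ranges over finite groups of natural numbers,
  so the permutations of the D sheets are encoded as such a group \<open>K\<close>, and the cocycles
  obtained on the factors are decoded again.\<close>

lemma lift_permutation_cocycle:
  assumes dcp: "definable_cocycle_property TYPE('i) G (\<C> :: 'x measure \<Rightarrow> ('g \<Rightarrow> 'x \<Rightarrow> 'x) \<Rightarrow> bool)"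
    and C: "\<And>i. \<C> (M i) (a i)"
    and perm: "permutation_cocycle G X ua D s"
  obtains t where "\<And>i. permutation_cocycle G (M i) (a i) D (t i)"
    "\<And>g. g \<in> carrier G \<Longrightarrow> AE c in X. s g c = ultra_fun U (\<lambda>i. t i g) c"
proof -
  have s: "s g \<in> X \<rightarrow>\<^sub>M perms D" if "g \<in> carrier G" for g
    using perm that by (simp add: permutation_cocycle_def)
  have mult: "AE c in X. s (g \<otimes> h) c = s g (ua h c) \<circ> s h c"
    if "g \<in> carrier G" "h \<in> carrier G" for g h
    using perm that by (simp add: permutation_cocycle_def)
  define P where "P = {\<pi>. \<pi> permutes {..<D}}"
  have finP: "finite P" unfolding P_def by (rule finite_permutations) simp
  define enc :: "(nat \<Rightarrow> nat) \<Rightarrow> nat" where "enc = to_nat_on P"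
  define dec where "dec = from_nat_into P"
  have dec_enc[simp]: "dec (enc \<pi>) = \<pi>" if "\<pi> \<in> P" for \<pi>
    unfolding enc_def dec_def using that countable_finite[OF finP] by simp
  have comp: "\<pi> \<circ> \<rho> \<in> P" if "\<pi> \<in> P" "\<rho> \<in> P" for \<pi> \<rho> using that by (simp add: P_def permutes_compose)
  have idP: "id \<in> P" by (simp add: P_def permutes_id)
  define K :: "nat monoid" where
    "K = \<lparr>carrier = enc ` P, mult = (\<lambda>u w. enc (dec u \<circ> dec w)), one = enc id\<rparr>"
  have K: "group K"
  proof (rule groupI)
    show "\<exists>v\<in>carrier K. v \<otimes>\<^bsub>K\<^esub> u = \<one>\<^bsub>K\<^esub>" if u: "u \<in> carrier K" for u
    proof -
      have "u \<in> enc ` P" using u by (simp add: K_def)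
      then obtain \<pi> where \<pi>: "\<pi> \<in> P" "u = enc \<pi>" by (rule imageE)
      have "inv_into UNIV \<pi> \<in> P" using \<pi>(1) by (simp add: P_def permutes_inv)
      moreover have "inv_into UNIV \<pi> \<circ> \<pi> = id" using \<pi>(1) by (simp add: P_def permutes_inv_o)
      ultimately show ?thesis using \<pi> by (intro bexI[of _ "enc (inv_into UNIV \<pi>)"]) (auto simp: K_def)
    qed
  qed (auto simp: K_def comp idP comp_assoc)
  have finK: "finite (carrier K)" using finP by (simp add: K_def)
  define \<sigma> where "\<sigma> g c = enc (s g c)" for g c
  have s_P: "s g c \<in> P" if "g \<in> carrier G" "c \<in> space X" for g c
    using measurable_space[OF s[OF that(1)] that(2)] by (simp add: P_def)
  have coc: "cocycle G X ua K \<sigma>"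
    unfolding cocycle_def
  proof (intro conjI ballI)
    show "\<sigma> g \<in> X \<rightarrow>\<^sub>M count_space (carrier K)" if "g \<in> carrier G" for g
      unfolding \<sigma>_def by (rule measurable_compose[OF s[OF that]]) (auto simp: K_def P_def)
    show "AE c in X. \<sigma> (g \<otimes> h) c = \<sigma> g (ua h c) \<otimes>\<^bsub>K\<^esub> \<sigma> h c"
      if g: "g \<in> carrier G" and h: "h \<in> carrier G" for g h
      using mult[OF g h] AE_space
    proof eventually_elim
      case (elim c)
      then show ?case
        using s_P[OF g pmp_action_facts(5)[OF ultra_act h elim(2)]] s_P[OF h elim(2)] by (simp add: \<sigma>_def K_def)
    qed
  qed
  from dcp[unfolded definable_cocycle_property_def, rule_format, OF K finK U C coc]
  obtain \<tau> where \<tau>: "\<forall>i. cocycle G (M i) (a i) K (\<tau> i)"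
    and \<tau>\<sigma>: "\<forall>g\<in>carrier G. \<forall>k\<in>carrier K. AE c in X. \<sigma> g c = k \<longleftrightarrow> c \<in> ultra_set U (\<lambda>i. {y \<in> space (M i). \<tau> i g y = k})"
    by blast
  have \<tau>m: "\<tau> i g \<in> M i \<rightarrow>\<^sub>M count_space (carrier K)" if "g \<in> carrier G" for i g
    using \<tau> that by (auto simp: cocycle_def)
  have \<tau>K: "\<tau> i g \<in> space (M i) \<rightarrow> carrier K" if "g \<in> carrier G" for i g
    using measurable_space[OF \<tau>m[OF that]] by auto
  have decK: "dec u \<in> P" "enc (dec u) = u" if "u \<in> carrier K" for u using that by (auto simp: K_def)
  define t where "t i g y = dec (\<tau> i g y)" for i g y
  have tm: "t i g \<in> M i \<rightarrow>\<^sub>M perms D" if "g \<in> carrier G" for i g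
    unfolding t_def by (rule measurable_compose[OF \<tau>m[OF that]]) (use decK in \<open>auto simp: P_def\<close>)
  have tP: "t i g \<in> space (M i) \<rightarrow> P" if "g \<in> carrier G" for i g
    using measurable_space[OF tm[OF that]] by (auto simp: P_def)
  have multt: "AE y in M i. t i (g \<otimes> h) y = t i g (a i h y) \<circ> t i h y"
    if g: "g \<in> carrier G" and h: "h \<in> carrier G" for i g h
  proof -
    have "AE y in M i. \<tau> i (g \<otimes> h) y = \<tau> i g (a i h y) \<otimes>\<^bsub>K\<^esub> \<tau> i h y"
      using \<tau> g h by (auto simp: cocycle_def)
    then show ?thesis
      using AE_space
    proof eventually_elim
      case (elim y)
      have "\<tau> i g (a i h y) \<in> carrier K" "\<tau> i h y \<in> carrier K"
        using \<tau>K[OF g, of i] \<tau>K[OF h, of i] act_facts(5)[OF h elim(2)] elim(2) by auto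
      then show ?case using elim(1) decK comp by (simp add: t_def K_def)
    qed
  qed
  show thesis
  proof (rule that)
    show "permutation_cocycle G (M i) (a i) D (t i)" for i
      using tm multt by (simp add: permutation_cocycle_def)
    fix g assume g: "g \<in> carrier G"
    have "AE c in X. \<forall>k\<in>carrier K. \<sigma> g c = k \<longleftrightarrow> c \<in> ultra_set U (\<lambda>i. {y \<in> space (M i). \<tau> i g y = k})"
      using \<tau>\<sigma> g by (intro AE_finite_ball[OF finK]) blast
    then show "AE c in X. s g c = ultra_fun U (\<lambda>i. t i g) c"
      using AE_space
    proof eventually_elim
      case (elim c)
      obtain x where x: "c = ultra_class U x" "\<And>i. x i \<in> space (M i)" using representative[OF elim(2)] by blast
      have "\<sigma> g c \<in> carrier K" using s_P[OF g elim(2)] by (simp add: \<sigma>_def K_def)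
      then have "c \<in> ultra_set U (\<lambda>i. {y \<in> space (M i). \<tau> i g y = \<sigma> g c})" using elim(1) by blast
      then have "\<forall>\<^sub>F i in U. \<tau> i g (x i) = \<sigma> g c"
        by (simp add: x(1) ultra_class_in_iff eventually_conj_iff)
      moreover have "\<forall>\<^sub>F i in U. t i g (x i) = ultra_fun U (\<lambda>i. t i g) c"
        unfolding x(1) by (rule ultra_fun_class(1)[OF finP tP[OF g] x(2)])
      ultimately have "\<forall>\<^sub>F i in U. dec (\<sigma> g c) = ultra_fun U (\<lambda>i. t i g) c"
        by eventually_elim (simp add: t_def)
      then have "dec (\<sigma> g c) = ultra_fun U (\<lambda>i. t i g) c" using ultrafilter_not_bot[OF U] by simp
      then show ?case using s_P[OF g elim(2)] by (simp add: \<sigma>_def)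
    qed
  qed
qed

end

section \<open>Ultraproducts of existentially closed actions\<close>

text \<open>Existential closedness along the skew product. The points of the latter have type
  \<open>'x \<times> nat\<close>, different from the type in \<open>ec_action\<close>, hence the
  appeal to \<open>ec_action_all_types\<close>.\<close>

lemma ec_action_sheets:
  fixes G :: "'g monoid" and M :: "'x measure" and s :: "'g \<Rightarrow> 'x \<Rightarrow> nat \<Rightarrow> nat" and A :: "nat \<Rightarrow> 'x \<Rightarrow> nat"
  assumes ec: "ec_action G M a" and G: "countable (carrier G)" and D: "0 < D"
    and s: "permutation_cocycle G M a D s"
    and A: "\<And>j. A j \<in> M \<rightarrow>\<^sub>M count_space {..<p}" and \<beta>: "\<beta> \<in> M \<rightarrow>\<^sub>M count_space {..<q::nat}"
    and F: "finite F" "F \<subseteq> carrier G" and \<epsilon>: "0 < \<epsilon>"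
  shows "\<exists>\<alpha>. \<alpha> \<in> M \<rightarrow>\<^sub>M count_space {..<p} \<and> (\<forall>\<pi> \<in> F \<rightarrow>\<^sub>E {..<p}. \<forall>r<q.
    \<bar>sheet_stat G M a F D s A \<beta> \<pi> r - joint_dist G M a F \<alpha> \<beta> \<pi> r\<bar> < \<epsilon>)"
proof -
  have M: "pmp_action G M a" using ec by (simp add: ec_action_def)
  obtain N :: "('x \<times> nat) measure" and b \<alpha> where N: "factor_map G N b M a fst"
    and \<alpha>: "\<alpha> \<in> N \<rightarrow>\<^sub>M count_space {..<p}"
    and stat: "\<And>F q \<beta> \<pi> r. finite F \<Longrightarrow> F \<subseteq> carrier G \<Longrightarrow> \<beta> \<in> M \<rightarrow>\<^sub>M count_space {..<q::nat} \<Longrightarrow> \<pi> \<in> extensional F \<Longrightarrow>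
      joint_dist G N b F \<alpha> (\<beta> \<circ> fst) \<pi> r = sheet_stat G M a F D s A \<beta> \<pi> r"
    by (rule skew_product[OF M G D s A]) (assumption | rule that)+
  from ec_action_all_types[OF ec N, unfolded ec_factor_map_def, rule_format, OF \<alpha> \<beta> F \<epsilon>]
  obtain \<alpha>' where "\<alpha>' \<in> M \<rightarrow>\<^sub>M count_space {..<p}"
    "\<forall>\<pi> \<in> F \<rightarrow>\<^sub>E {..<p}. \<forall>r<q. \<bar>joint_dist G N b F \<alpha> (\<beta> \<circ> fst) \<pi> r - joint_dist G M a F \<alpha>' \<beta> \<pi> r\<bar> < \<epsilon>"
    by blast
  then show ?thesis
    using stat[OF F \<beta>] by (intro exI[of _ \<alpha>']) (auto simp: PiE_def)
qed

text \<open>The extension is first replaced by its canonical copy, whose points have the type for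
  which \<open>extension_MD_action\<close> is stated. Half of \<epsilon> pays for the finite-to-one
  extension, half for its sheets.\<close>

lemma extension_MD_sheets:
  fixes G :: "'g monoid" and Z :: "real measure" and N :: "'y measure"
  assumes MD: "extension_MD_group G" and G: "countable (carrier G)"
    and Z: "standard_borel Z" "free_pmp_action G Z a" and \<phi>: "factor_map G N b Z a \<phi>"
    and \<alpha>: "\<alpha> \<in> N \<rightarrow>\<^sub>M count_space {..<p::nat}" and \<beta>: "\<beta> \<in> Z \<rightarrow>\<^sub>M count_space {..<q::nat}"
    and F: "finite F" "F \<subseteq> carrier G" and \<epsilon>: "0 < \<epsilon>"
  obtains D s A where "0 < D" "permutation_cocycle G Z a D s"
    "\<And>j. A j \<in> Z \<rightarrow>\<^sub>M count_space {..<p}"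
    "\<And>\<pi> r. \<pi> \<in> F \<rightarrow>\<^sub>E {..<p} \<Longrightarrow> r < q \<Longrightarrow>
      \<bar>joint_dist G N b F \<alpha> (\<beta> \<circ> \<phi>) \<pi> r - sheet_stat G Z a F D s A \<beta> \<pi> r\<bar> < \<epsilon>"
proof -
  have \<epsilon>2: "0 < \<epsilon> / 2" using \<epsilon> by simp
  have MDZ: "extension_MD_action G Z a" using MD Z by (simp add: extension_MD_group_def)
  obtain N1 :: "(real \<times> ('g \<Rightarrow> nat)) measure" and b1 \<phi>1 \<alpha>1
    where N1: "factor_map G N1 b1 Z a \<phi>1" "\<alpha>1 \<in> N1 \<rightarrow>\<^sub>M count_space {..<p}"
    and j1: "\<And>\<pi> r. joint_dist G N1 b1 F \<alpha>1 (\<beta> \<circ> \<phi>1) \<pi> r = joint_dist G N b F \<alpha> (\<beta> \<circ> \<phi>) \<pi> r"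
  proof (rule factor_map_canonical[OF \<phi> \<alpha>])
    fix N' :: "(real \<times> ('g \<Rightarrow> nat)) measure" and b' \<phi>' \<alpha>'
    assume *: "factor_map G N' b' Z a \<phi>'" "\<alpha>' \<in> N' \<rightarrow>\<^sub>M count_space {..<p}"
      and j: "\<And>F q \<beta> \<pi> j. finite F \<Longrightarrow> F \<subseteq> carrier G \<Longrightarrow> \<beta> \<in> Z \<rightarrow>\<^sub>M count_space {..<q::nat} \<Longrightarrow>
        joint_dist G N' b' F \<alpha>' (\<beta> \<circ> \<phi>') \<pi> j = joint_dist G N b F \<alpha> (\<beta> \<circ> \<phi>) \<pi> j"
    show thesis by (rule that[OF *]) (rule j[OF F \<beta>])
  qed
  from MDZ[unfolded extension_MD_action_def, THEN conjunct2, rule_format, OF N1 \<beta> F \<epsilon>2]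
  obtain N' :: "(real \<times> ('g \<Rightarrow> nat)) measure" and b' \<phi>' \<alpha>'
    where N': "standard_borel N'" "factor_map G N' b' Z a \<phi>'" "AE x in Z. finite {y \<in> space N'. \<phi>' y = x}"
    and \<alpha>': "\<alpha>' \<in> N' \<rightarrow>\<^sub>M count_space {..<p}"
    and j2: "\<forall>\<pi> \<in> F \<rightarrow>\<^sub>E {..<p}. \<forall>r<q.
       \<bar>joint_dist G N1 b1 F \<alpha>1 (\<beta> \<circ> \<phi>1) \<pi> r - joint_dist G N' b' F \<alpha>' (\<beta> \<circ> \<phi>') \<pi> r\<bar> < \<epsilon> / 2"
    by blast
  show thesis
  proof (rule finite_to_one_sheets[OF G N'(2,1) Z(1) N'(3) \<alpha>' \<beta> F \<epsilon>2])
    fix D s A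
    assume D: "0 < D" and s: "permutation_cocycle G Z a D s"
      and A: "\<And>j. A j \<in> Z \<rightarrow>\<^sub>M count_space {..<p}"
      and close: "\<And>\<pi> r. \<pi> \<in> extensional F \<Longrightarrow>
        \<bar>joint_dist G N' b' F \<alpha>' (\<beta> \<circ> \<phi>') \<pi> r - sheet_stat G Z a F D s A \<beta> \<pi> r\<bar> < \<epsilon> / 2"
    show thesis
    proof (rule that[OF D s A])
      fix \<pi> r assume \<pi>: "\<pi> \<in> F \<rightarrow>\<^sub>E {..<p}" and r: "r < q"
      then have "\<pi> \<in> extensional F" by (simp add: PiE_def)
      moreover have "\<bar>joint_dist G N b F \<alpha> (\<beta> \<circ> \<phi>) \<pi> r - joint_dist G N' b' F \<alpha>' (\<beta> \<circ> \<phi>') \<pi> r\<bar> < \<epsilon> / 2"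
        using j2 \<pi> r by (simp add: j1)
      ultimately show "\<bar>joint_dist G N b F \<alpha> (\<beta> \<circ> \<phi>) \<pi> r - sheet_stat G Z a F D s A \<beta> \<pi> r\<bar> < \<epsilon>"
        using close[of \<pi> r] by linarith
    qed
  qed
qed

lemma (in ultraproduct_of_actions) ec_factor_map_ultraproduct:
  assumes G: "countable (carrier G)" and MD: "extension_MD_group G"
    and dcp: "definable_cocycle_property TYPE('i) G
      (free_pmp_action G :: 'x measure \<Rightarrow> ('g \<Rightarrow> 'x \<Rightarrow> 'x) \<Rightarrow> bool)"
    and ec: "\<And>i. ec_action G (M i) (a i)" and \<phi>: "factor_map G N b X ua \<phi>"
  shows "ec_factor_map G N b X ua \<phi>"
  unfolding ec_factor_map_def
proof (intro allI ballI impI)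
  fix p q \<alpha> \<beta> F and \<epsilon> :: real
  assume \<alpha>: "\<alpha> \<in> N \<rightarrow>\<^sub>M count_space {..<p::nat}" and \<beta>: "\<beta> \<in> X \<rightarrow>\<^sub>M count_space {..<q::nat}"
    and F: "finite F" "F \<subseteq> carrier G" and \<epsilon>: "0 < \<epsilon>"
  have \<epsilon>4: "0 < \<epsilon> / 4" using \<epsilon> by simp
  have \<phi>m: "\<phi> \<in> N \<rightarrow>\<^sub>M X" using \<phi> by (simp add: factor_map_def measure_preserving_map_def)
  obtain Z :: "real measure" and aZ \<psi> \<beta>Z where Z: "standard_borel Z" "free_pmp_action G Z aZ"
    and \<psi>: "factor_map G X ua Z aZ \<psi>" and \<beta>Z: "\<beta>Z \<in> Z \<rightarrow>\<^sub>M count_space {..<q}"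
    and \<beta>\<psi>: "\<And>c. c \<in> space X \<Longrightarrow> \<beta>Z (\<psi> c) = \<beta> c"
    by (rule standard_free_factor[OF ec G \<beta>]) (assumption | rule that)+
  have \<psi>m: "\<psi> \<in> X \<rightarrow>\<^sub>M Z" and eqv: "\<And>g. g \<in> carrier G \<Longrightarrow> AE c in X. \<psi> (ua g c) = aZ g (\<psi> c)"
    and \<psi>d: "distr X Z \<psi> = Z"
    using \<psi> by (auto simp: factor_map_def measure_preserving_map_def)
  \<comment> \<open>\<open>N\<close> is now regarded as an extension of \<open>Z\<close>. Its
    statistics with \<beta> are retained, because \<beta> is \<open>\<beta>Z \<circ> \<psi>\<close>
    on the ultraproduct.\<close>
  obtain D s A where D: "0 < D" and perm: "permutation_cocycle G Z aZ D s"
    and A: "\<And>j. A j \<in> Z \<rightarrow>\<^sub>M count_space {..<p}"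
    and close1: "\<And>\<pi> r. \<pi> \<in> F \<rightarrow>\<^sub>E {..<p} \<Longrightarrow> r < q \<Longrightarrow>
      \<bar>joint_dist G N b F \<alpha> (\<beta>Z \<circ> (\<psi> \<circ> \<phi>)) \<pi> r - sheet_stat G Z aZ F D s A \<beta>Z \<pi> r\<bar> < \<epsilon> / 4"
    by (rule extension_MD_sheets[OF MD G Z factor_map_comp[OF \<phi> \<psi>] \<alpha> \<beta>Z F \<epsilon>4]) (assumption | rule that)+
  have s: "s g \<in> Z \<rightarrow>\<^sub>M perms D" if "g \<in> carrier G" for g
    using perm that by (simp add: permutation_cocycle_def)
  \<comment> \<open>The definable cocycle property concerns cocycles of the ultraproduct and not of
    its factor \<open>Z\<close>, hence the pullback along \<psi>.\<close>
  define sX where "sX g c = s g (\<psi> c)" for g c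
  define AX where "AX j c = A j (\<psi> c)" for j c
  have sX: "sX g \<in> X \<rightarrow>\<^sub>M perms D" if "g \<in> carrier G" for g
    unfolding sX_def by (rule measurable_compose[OF \<psi>m s[OF that]])
  have AX: "AX j \<in> X \<rightarrow>\<^sub>M count_space {..<p}" for j
    unfolding AX_def by (rule measurable_compose[OF \<psi>m A])
  have multX: "AE c in X. sX (g \<otimes> h) c = sX g (ua h c) \<circ> sX h c"
    if g: "g \<in> carrier G" and h: "h \<in> carrier G" for g h
  proof -
    have "AE z in Z. s (g \<otimes> h) z = s g (aZ h z) \<circ> s h z"
      using perm g h by (simp add: permutation_cocycle_def)
    then have "AE c in X. s (g \<otimes> h) (\<psi> c) = s g (aZ h (\<psi> c)) \<circ> s h (\<psi> c)"
      by (subst (asm) \<psi>d[symmetric]) (rule AE_distrD[OF \<psi>m])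
    with eqv[OF h] show ?thesis unfolding sX_def by eventually_elim simp
  qed
  have permX: "permutation_cocycle G X ua D sX" using sX multX by (simp add: permutation_cocycle_def)
  have pull: "sheet_stat G Z aZ F D s A \<beta>Z \<pi> r = sheet_stat G X ua F D sX AX (\<beta>Z \<circ> \<psi>) \<pi> r" for \<pi> r
    using sheet_stat_pullback[OF \<psi> F s A \<beta>Z] by (simp add: sX_def[abs_def] AX_def[abs_def])
  obtain t where permt: "\<And>i. permutation_cocycle G (M i) (a i) D (t i)"
    and st: "\<And>g. g \<in> carrier G \<Longrightarrow> AE c in X. sX g c = ultra_fun U (\<lambda>i. t i g) c"
    by (rule lift_permutation_cocycle[OF dcp ec_imp_free[OF ec] permX]) (assumption | rule that)+
  have t: "t i g \<in> M i \<rightarrow>\<^sub>M perms D" if "g \<in> carrier G" for i g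
    using permt that by (simp add: permutation_cocycle_def)
  \<comment> \<open>With this \<delta>, \<open>sheet_stat_perturb\<close> costs \<epsilon>/8 and
    \<open>joint_dist_perturb\<close> at most \<epsilon>/8. Another \<epsilon>/8 is spent on the
    factors and \<epsilon>/4 on the sheets over \<open>Z\<close>, in total 5/8 of
    \<epsilon>.\<close>
  define \<delta> where "\<delta> = \<epsilon> / (8 * (1 + real (card F * D)))"
  have \<delta>: "0 < \<delta>" using \<epsilon> by (simp add: \<delta>_def add_pos_nonneg)
  have \<delta>1: "(1 + real (card F * D)) * \<delta> = \<epsilon> / 8" unfolding \<delta>_def by (simp add: field_simps add_nonneg_eq_0_iff)
  have \<delta>2: "\<delta> \<le> \<epsilon> / 8"
  proof -
    have "1 * \<delta> \<le> (1 + real (card F * D)) * \<delta>" using \<delta> by (intro mult_right_mono) auto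
    then show ?thesis unfolding \<delta>1 by simp
  qed
  \<comment> \<open>The cocycle is internal up to null sets, but the sheet colourings and \<beta>
    are merely measurable; they are replaced by internal functions that agree with them off sets of
    measure below \<delta>.\<close>
  have "\<forall>j. \<exists>\<gamma>. (\<forall>i. \<gamma> i \<in> M i \<rightarrow>\<^sub>M count_space {..<p}) \<and> measure X {c \<in> space X. ultra_fun U \<gamma> c \<noteq> AX j c} < \<delta>"
  proof
    fix j
    show "\<exists>\<gamma>. (\<forall>i. \<gamma> i \<in> M i \<rightarrow>\<^sub>M count_space {..<p}) \<and> measure X {c \<in> space X. ultra_fun U \<gamma> c \<noteq> AX j c} < \<delta>"
      by (rule internal_approx[OF AX[of j] \<delta>]) (intro exI conjI allI; assumption)
  qed
  from choice[OF this] obtain \<gamma> where \<gamma>: "\<And>j i. \<gamma> j i \<in> M i \<rightarrow>\<^sub>M count_space {..<p}"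
    and \<gamma>A: "\<And>j. measure X {c \<in> space X. ultra_fun U (\<gamma> j) c \<noteq> AX j c} < \<delta>" by blast
  obtain \<eta> where \<eta>: "\<And>i. \<eta> i \<in> M i \<rightarrow>\<^sub>M count_space {..<q}"
    and \<eta>\<beta>: "measure X {c \<in> space X. ultra_fun U \<eta> c \<noteq> \<beta> c} < \<delta>"
    by (rule internal_approx[OF \<beta> \<delta>]) (assumption | rule that)+
  have U\<eta>: "ultra_fun U \<eta> \<in> X \<rightarrow>\<^sub>M count_space {..<q}" by (rule ultra_fun_measurable[OF finite_lessThan \<eta>])
  have U\<gamma>: "ultra_fun U (\<gamma> j) \<in> X \<rightarrow>\<^sub>M count_space {..<p}" for j by (rule ultra_fun_measurable[OF finite_lessThan \<gamma>])
  have Ut: "ultra_fun U (\<lambda>i. t i g) \<in> X \<rightarrow>\<^sub>M perms D" if "g \<in> carrier G" for g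
    by (rule ultra_fun_measurable[OF _ t[OF that]]) (rule finite_permutations, simp)
  have \<epsilon>8: "0 < \<epsilon> / 8" using \<epsilon> by simp
  have "\<forall>i. \<exists>\<alpha>. \<alpha> \<in> M i \<rightarrow>\<^sub>M count_space {..<p} \<and> (\<forall>\<pi> \<in> F \<rightarrow>\<^sub>E {..<p}. \<forall>r<q.
      \<bar>sheet_stat G (M i) (a i) F D (t i) (\<lambda>j. \<gamma> j i) (\<eta> i) \<pi> r - joint_dist G (M i) (a i) F \<alpha> (\<eta> i) \<pi> r\<bar> < \<epsilon> / 8)"
    by (intro allI ec_action_sheets[OF ec G D permt \<gamma> \<eta> F \<epsilon>8])
  from choice[OF this] obtain \<alpha>' where \<alpha>': "\<And>i. \<alpha>' i \<in> M i \<rightarrow>\<^sub>M count_space {..<p}"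
    and close2: "\<And>i \<pi> r. \<pi> \<in> F \<rightarrow>\<^sub>E {..<p} \<Longrightarrow> r < q \<Longrightarrow>
      \<bar>sheet_stat G (M i) (a i) F D (t i) (\<lambda>j. \<gamma> j i) (\<eta> i) \<pi> r - joint_dist G (M i) (a i) F (\<alpha>' i) (\<eta> i) \<pi> r\<bar> < \<epsilon> / 8"
    by blast
  have U\<alpha>: "ultra_fun U \<alpha>' \<in> X \<rightarrow>\<^sub>M count_space {..<p}" by (rule ultra_fun_measurable[OF finite_lessThan \<alpha>'])
  show "\<exists>\<alpha>''\<in>X \<rightarrow>\<^sub>M count_space {..<p}. \<forall>\<pi>\<in>F \<rightarrow>\<^sub>E {..<p}. \<forall>r<q.
     \<bar>joint_dist G N b F \<alpha> (\<beta> \<circ> \<phi>) \<pi> r - joint_dist G X ua F \<alpha>'' \<beta> \<pi> r\<bar> < \<epsilon>"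
  proof (intro bexI[OF _ U\<alpha>] ballI allI impI)
    fix \<pi> r assume \<pi>: "\<pi> \<in> F \<rightarrow>\<^sub>E {..<p}" and r: "r < q"
    let ?J = "sheet_stat G X ua F D (\<lambda>g. ultra_fun U (\<lambda>i. t i g)) (\<lambda>j. ultra_fun U (\<gamma> j)) (ultra_fun U \<eta>) \<pi> r"
    have "{y \<in> space N. shift_name G b F \<alpha> y = \<pi> \<and> (\<beta>Z \<circ> (\<psi> \<circ> \<phi>)) y = r} =
        {y \<in> space N. shift_name G b F \<alpha> y = \<pi> \<and> (\<beta> \<circ> \<phi>) y = r}"
      using measurable_space[OF \<phi>m] by (auto simp: \<beta>\<psi>)
    then have e1: "\<bar>joint_dist G N b F \<alpha> (\<beta> \<circ> \<phi>) \<pi> r - sheet_stat G X ua F D sX AX (\<beta>Z \<circ> \<psi>) \<pi> r\<bar> < \<epsilon> / 4"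
      using close1[OF \<pi> r] unfolding pull by (simp add: joint_dist_def)
    have e2: "\<bar>sheet_stat G X ua F D sX AX (\<beta>Z \<circ> \<psi>) \<pi> r - ?J\<bar> \<le> \<epsilon> / 8"
      unfolding \<delta>1[symmetric]
    proof (rule sheet_stat_perturb[OF ultra_act F D sX Ut AX U\<gamma> measurable_comp[OF \<psi>m \<beta>Z] U\<eta> st])
      show "measure X {x \<in> space X. AX j x \<noteq> ultra_fun U (\<gamma> j) x} \<le> \<delta>" for j
        using \<gamma>A[of j] by (simp add: eq_commute)
      have "{x \<in> space X. (\<beta>Z \<circ> \<psi>) x \<noteq> ultra_fun U \<eta> x} = {c \<in> space X. ultra_fun U \<eta> c \<noteq> \<beta> c}"
        by (auto simp: \<beta>\<psi>)
      then show "measure X {x \<in> space X. (\<beta>Z \<circ> \<psi>) x \<noteq> ultra_fun U \<eta> x} \<le> \<delta>" using \<eta>\<beta> by simp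
    qed
    have ext: "\<pi> \<in> extensional F" using \<pi> by (simp add: PiE_def)
    have lim: "((\<lambda>i. \<bar>sheet_stat G (M i) (a i) F D (t i) (\<lambda>j. \<gamma> j i) (\<eta> i) \<pi> r -
          joint_dist G (M i) (a i) F (\<alpha>' i) (\<eta> i) \<pi> r\<bar>) \<longlongrightarrow>
        \<bar>?J - joint_dist G X ua F (ultra_fun U \<alpha>') (ultra_fun U \<eta>) \<pi> r\<bar>) U"
      by (intro tendsto_rabs tendsto_diff tendsto_joint_dist[OF F ext \<alpha>' \<eta>]
          tendsto_sheet_stat[where A = "\<lambda>i j. \<gamma> j i", OF F D t \<gamma> \<eta>])
    have e3: "\<bar>?J - joint_dist G X ua F (ultra_fun U \<alpha>') (ultra_fun U \<eta>) \<pi> r\<bar> \<le> \<epsilon> / 8"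
      by (rule tendsto_upperbound[OF lim _ ultrafilter_not_bot[OF U]])
         (intro always_eventually allI less_imp_le close2 \<pi> r)
    have e4: "\<bar>joint_dist G X ua F (ultra_fun U \<alpha>') (ultra_fun U \<eta>) \<pi> r - joint_dist G X ua F (ultra_fun U \<alpha>') \<beta> \<pi> r\<bar> \<le> \<delta>"
      by (rule joint_dist_perturb[OF ultra_act F U\<alpha> U\<eta> \<beta> less_imp_le[OF \<eta>\<beta>]])
    show "\<bar>joint_dist G N b F \<alpha> (\<beta> \<circ> \<phi>) \<pi> r - joint_dist G X ua F (ultra_fun U \<alpha>') \<beta> \<pi> r\<bar> < \<epsilon>"
      using e1 e2 e3 e4 \<delta>2 \<epsilon> by linarith
  qed
qed

theorem theorem6p12:
  fixes G :: "'g monoid"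
  assumes "group G" and "countable (carrier G)"
    and "extension_MD_group G"
    and "definable_cocycle_property TYPE('i) G
           (free_pmp_action G :: 'x measure \<Rightarrow> ('g \<Rightarrow> 'x \<Rightarrow> 'x) \<Rightarrow> bool)"
  shows "model_companion_exists TYPE('i) TYPE('x) G"
  unfolding model_companion_exists_def
proof (intro allI impI)
  fix U :: "'i filter" and M :: "'i \<Rightarrow> 'x measure" and a
  assume U: "ultrafilter U" and ec: "\<forall>i. ec_action G (M i) (a i)"
  interpret ultraproduct_of_actions U G M a
    by unfold_locales (use U ec in \<open>auto simp: ec_action_def\<close>)
  show "ec_action G X ua"
    unfolding ec_action_def
    by (intro conjI allI impI ultra_act ec_factor_map_ultraproduct assms(2-4)) (use ec in auto)
qed

end
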